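(* Let $(\epsilon_n)_{n\ge1}$ be a decreasing sequence with $\epsilon_n>0$ for all $n$ and $\sum_{n=1}^\infty\epsilon_n=\infty$. Let $\mathcal R$ be the set of ergodic $\tau\in\mathcal M$ such that for $m$-a.e. $y\in[0,1]$ and for every $N\ge1$, $$m\Big(\bigcup_{n=N}^\infty\tau^{-n}\big(B_{\epsilon_n}(y)\big)\Big)=1,$$ i.e. $[0,1]=\bigcup_{n=N}^\infty\tau^{-n}(B_{\epsilon_n}(y))$ up to a null set. Then $\mathcal R$ is a dense $G_\delta$ subset of $\mathcal M$.
   Context: $[0,1]$ is identified with the circle $\mathbb R/\mathbb Z$ (addition modulo one), with Lebesgue measure $m$ and the distance modulo one. For $y\in[0,1]$ and $r>0$, $B_r(y)=[y-r,y+r]$ modulo one. $\mathcal M$ denotes the group of invertible measure-preserving transformations of $([0,1],m)$ (modulo null sets), equipped with the weak topology: $\tau_j\to\tau$ iff $m(\tau_j(A)\,\triangle\,\tau(A))\to0$ for every measurable $A$; this is a Polish (completely metrizable) topology. *)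

theory Defs
  imports "HOL-Analysis.Analysis"
begin

text \<open>The circle [0,1) = R/Z with Lebesgue measure.\<close>
definition I01 :: "real set" where "I01 = {0..<1}"

definition Leb01 :: "real measure" where "Leb01 = restrict_space lebesgue I01"

definition cdist :: "real \<Rightarrow> real \<Rightarrow> real" where
  "cdist x y = min (frac (x - y)) (1 - frac (x - y))"

definition cball01 :: "real \<Rightarrow> real \<Rightarrow> real set" where
  "cball01 y r = {x \<in> I01. cdist x y \<le> r}"

definition measure_preserving :: "'a measure \<Rightarrow> ('a \<Rightarrow> 'a) \<Rightarrow> bool" where
  "measure_preserving M T \<longleftrightarrow> T \<in> measurable M M \<and>
     (\<forall>A \<in> sets M. emeasure M (T -` A \<inter> space M) = emeasure M A)"

text \<open>Representatives of elements of the group M: bimeasurable bijections of [0,1)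
  preserving Lebesgue measure (every class mod null sets has such a representative).\<close>
definition MPT :: "(real \<Rightarrow> real) set" where
  "MPT = {T. bij_betw T I01 I01 \<and> measure_preserving Leb01 T
             \<and> measure_preserving Leb01 (inv_into I01 T)}"

text \<open>Weak topology: the coarsest topology making each map T \<mapsto> T(A) continuous into
  the measure algebra (pseudo-metric m(C \<triangle> D)).\<close>
definition weak_top :: "(real \<Rightarrow> real) topology" where
  "weak_top = topology_generated_by
     {{T \<in> MPT. emeasure Leb01 ((T ` A - B) \<union> (B - T ` A)) < ennreal r} | A B r.
        A \<in> sets Leb01 \<and> B \<in> sets Leb01 \<and> r > 0}"

definition ergodic :: "(real \<Rightarrow> real) \<Rightarrow> bool" where
  "ergodic T \<longleftrightarrow> (\<forall>A \<in> sets Leb01.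
     emeasure Leb01 (((T -` A \<inter> I01) - A) \<union> (A - (T -` A \<inter> I01))) = 0
       \<longrightarrow> emeasure Leb01 A = 0 \<or> emeasure Leb01 A = 1)"

definition dense_in_top :: "'a topology \<Rightarrow> 'a set \<Rightarrow> bool" where
  "dense_in_top X S \<longleftrightarrow> S \<subseteq> topspace X \<and> X closure_of S = topspace X"

definition shrinking_target_set :: "(nat \<Rightarrow> real) \<Rightarrow> (real \<Rightarrow> real) set" where
  "shrinking_target_set eps = {T \<in> MPT. ergodic T \<and>
     (AE y in Leb01. \<forall>N\<ge>1.
        emeasure Leb01 (\<Union>n\<in>{N..}. (T ^^ n) -` cball01 y (eps n) \<inter> I01) = 1)}"

end

theory Submission
  imports Defs "HOL-Probability.Probability"
begin

text \<open>
  Both conditions are countable intersections of open ones. \<open>T\<close> is ergodic iff, for the indicator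
  of every finite union of dyadic cells, some convex combination of its translates under \<open>T\<close> is
  \<open>L\<^sup>2\<close>-close to a constant; the squared norm is a finite sum of measures of intersections and so is
  weakly continuous in \<open>T\<close>. The target condition says that the average over \<open>y\<close> of the measure of
  finite unions of the sets \<open>T\<^sup>-\<^sup>n(B\<^sub>n(y))\<close> tends to \<open>1\<close>.

  For density, a transformation is approximated by a cyclic permutation of dyadic cells, which is
  then realised by a tower over the dyadic odometer. For such a tower the event that the target
  around \<open>y\<close> is hit at some time in \<open>[2\<^sup>j, 2\<^sup>j\<^sup>+\<^sup>1)\<close> contains an event prescribing a block of binary
  digits of the difference of phases. These events are pairwise independent or disjoint and, by
  Cauchy condensation, have divergent total measure; Chebyshev's inequality concludes.
\<close>

subsection \<open>Measure-preserving transformations of the circle\<close>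

text \<open>A tower is an odometer in disguise: \<open>phase k\<close> numbers the dyadic cells of
  level \<open>J + k\<close> so that \<open>tower\<close> adds one modulo
  \<open>2 ^ (J + k)\<close>, compatibly for all \<open>k\<close>. Orbits are thus read off from
  differences of phases, which serves ergodicity and hitting times alike. At times between
  \<open>2 ^ j\<close> and \<open>2 ^ (j + 1)\<close> the radius is replaced by a power of two below
  \<open>eps (2 ^ (j + 1))\<close>; taking it as large as the length of the block permits keeps the
  measures of the events comparable to the condensed series. The obstacle to density is that a
  permutation of cells close to a given transformation may split into many cycles, while a tower
  needs a single one. Only the finitely many sets defining a neighbourhood matter, so cells are
  coloured by membership in these sets and in their images, and viewed as edges between colours. Few
  trails exhaust the edges; joining them into one cycle spoils a number of transitions bounded by
  the number of colours plus the imbalance of degrees, a small proportion of all cells.\<close>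

abbreviation mu :: "real set \<Rightarrow> real" where
  "mu \<equiv> measure Leb01"

lemma I01_in_lebesgue [simp]: "I01 \<in> sets lebesgue"
  by (simp add: I01_def)

lemma space_Leb01 [simp]: "space Leb01 = I01"
  by (simp add: Leb01_def space_restrict_space)

lemma sets_Leb01_iff: "A \<in> sets Leb01 \<longleftrightarrow> A \<in> sets lebesgue \<and> A \<subseteq> I01"
  by (auto simp: Leb01_def sets_restrict_space_iff)

lemma emeasure_Leb01: "A \<subseteq> I01 \<Longrightarrow> emeasure Leb01 A = emeasure lebesgue A"
  by (simp add: Leb01_def emeasure_restrict_space)

lemma I01_sets [simp]: "I01 \<in> sets Leb01"
  by (simp add: sets_Leb01_iff)

lemma sets_Leb01_borel: "B \<in> sets borel \<Longrightarrow> B \<inter> I01 \<in> sets Leb01"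
  by (auto simp: sets_Leb01_iff intro!: sets.Int)

interpretation Leb: prob_space Leb01
  by (rule prob_spaceI) (simp add: emeasure_Leb01, simp add: I01_def)

lemma sets_Leb01_subset: "A \<in> sets Leb01 \<Longrightarrow> A \<subseteq> I01"
  by (simp add: sets_Leb01_iff)

lemma mu_I01 [simp]: "mu I01 = 1"
  using Leb.prob_space by simp

lemma MPT_bij: "T \<in> MPT \<Longrightarrow> bij_betw T I01 I01"
  by (simp add: MPT_def)

lemma MPT_in: "T \<in> MPT \<Longrightarrow> x \<in> I01 \<Longrightarrow> T x \<in> I01"
  using MPT_bij bij_betw_apply by metis

lemma MPT_measurable: "T \<in> MPT \<Longrightarrow> T \<in> measurable Leb01 Leb01"
  by (simp add: MPT_def measure_preserving_def)

lemma MPT_vimage_sets: "T \<in> MPT \<Longrightarrow> A \<in> sets Leb01 \<Longrightarrow> T -` A \<inter> I01 \<in> sets Leb01"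
  using measurable_sets[OF MPT_measurable, of T A] by simp

lemma MPT_vimage_mu: "T \<in> MPT \<Longrightarrow> A \<in> sets Leb01 \<Longrightarrow> mu (T -` A \<inter> I01) = mu A"
  by (simp add: MPT_def measure_preserving_def measure_def)

lemma MPT_image_eq:
  assumes "T \<in> MPT" "A \<subseteq> I01"
  shows "inv_into I01 T -` A \<inter> I01 = T ` A"
proof -
  have b: "bij_betw T I01 I01" by (rule MPT_bij[OF assms(1)])
  then have i: "inj_on T I01" and s: "T ` I01 = I01" by (auto simp: bij_betw_def)
  show ?thesis
  proof
    show "inv_into I01 T -` A \<inter> I01 \<subseteq> T ` A"
      using f_inv_into_f[of _ T I01] s by force
    show "T ` A \<subseteq> inv_into I01 T -` A \<inter> I01"
      using inv_into_f_f[OF i] assms(2) s by auto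
  qed
qed

lemma MPT_image_sets: "T \<in> MPT \<Longrightarrow> A \<in> sets Leb01 \<Longrightarrow> T ` A \<in> sets Leb01"
proof -
  assume a: "T \<in> MPT" "A \<in> sets Leb01"
  then have "inv_into I01 T \<in> measurable Leb01 Leb01"
    by (simp add: MPT_def measure_preserving_def)
  from measurable_sets[OF this a(2)] show ?thesis
    using MPT_image_eq[OF a(1) sets_Leb01_subset[OF a(2)]] by simp
qed

lemma MPT_image_mu: "T \<in> MPT \<Longrightarrow> A \<in> sets Leb01 \<Longrightarrow> mu (T ` A) = mu A"
proof -
  assume a: "T \<in> MPT" "A \<in> sets Leb01"
  then have "emeasure Leb01 (inv_into I01 T -` A \<inter> I01) = emeasure Leb01 A"
    by (simp add: MPT_def measure_preserving_def)
  then show ?thesis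
    using MPT_image_eq[OF a(1) sets_Leb01_subset[OF a(2)]] by (simp add: measure_def)
qed

lemma MPT_image_vimage:
  assumes "T \<in> MPT" "A \<subseteq> I01" shows "T ` (T -` A \<inter> I01) = A"
proof -
  have "T ` I01 = I01" using MPT_bij[OF assms(1)] by (simp add: bij_betw_def)
  then show ?thesis using assms(2) by (force simp: image_iff)
qed

lemma MPT_I:
  assumes b: "bij_betw T I01 I01"
    and im: "\<And>A. A \<in> sets Leb01 \<Longrightarrow> T ` A \<in> sets Leb01 \<and> emeasure Leb01 (T ` A) = emeasure Leb01 A"
    and vi: "\<And>A. A \<in> sets Leb01 \<Longrightarrow>
      T -` A \<inter> I01 \<in> sets Leb01 \<and> emeasure Leb01 (T -` A \<inter> I01) = emeasure Leb01 A"
  shows "T \<in> MPT"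
proof -
  have i: "inj_on T I01" and s: "T ` I01 = I01" using b by (auto simp: bij_betw_def)
  have inv: "inv_into I01 T -` A \<inter> I01 = T ` A" if "A \<subseteq> I01" for A
  proof
    show "inv_into I01 T -` A \<inter> I01 \<subseteq> T ` A"
      using f_inv_into_f[of _ T I01] s by force
    show "T ` A \<subseteq> inv_into I01 T -` A \<inter> I01"
      using inv_into_f_f[OF i] that s by auto
  qed
  have 1: "measure_preserving Leb01 T"
    unfolding measure_preserving_def using vi s by (auto intro!: measurableI)
  have 2: "measure_preserving Leb01 (inv_into I01 T)"
    unfolding measure_preserving_def using im inv sets_Leb01_subset inv_into_into[of _ T I01] s
    by (auto intro!: measurableI)
  show ?thesis using b 1 2 by (simp add: MPT_def)
qed

lemma MPT_id: "id \<in> MPT"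
  by (rule MPT_I) (simp_all add: sets_Leb01_iff Int_absorb2)

lemma MPT_comp:
  assumes "S \<in> MPT" "T \<in> MPT" shows "S \<circ> T \<in> MPT"
proof (rule MPT_I)
  show "bij_betw (S \<circ> T) I01 I01"
    using MPT_bij[OF assms(1)] MPT_bij[OF assms(2)] by (rule bij_betw_trans[rotated])
  fix A assume A: "A \<in> sets Leb01"
  show "(S \<circ> T) ` A \<in> sets Leb01 \<and> emeasure Leb01 ((S \<circ> T) ` A) = emeasure Leb01 A"
    using A assms unfolding image_comp[symmetric]
    by (simp add: MPT_image_sets MPT_image_mu Leb.emeasure_eq_measure)
  have eq: "(S \<circ> T) -` A \<inter> I01 = T -` (S -` A \<inter> I01) \<inter> I01"
    using MPT_in[OF assms(2)] by auto
  show "(S \<circ> T) -` A \<inter> I01 \<in> sets Leb01 \<and> emeasure Leb01 ((S \<circ> T) -` A \<inter> I01) = emeasure Leb01 A"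
    unfolding eq Leb.emeasure_eq_measure
    using MPT_vimage_sets[OF assms(1) A] MPT_vimage_mu[OF assms(1) A] assms(2)
    by (metis MPT_vimage_sets MPT_vimage_mu)
qed

lemma MPT_funpow: "T \<in> MPT \<Longrightarrow> T ^^ n \<in> MPT"
proof (induction n)
  case 0
  then show ?case using MPT_id by (simp add: id_def)
next
  case (Suc n)
  then show ?case using MPT_comp[of T "T ^^ n"] by (simp add: comp_def)
qed

text \<open>A bijection is determined up to measure by its displacement: on each level set of
  \<open>T x - x\<close> it is a translation.\<close>

lemma translation_pieces_image:
  assumes inj: "inj_on T I01" and into: "T ` I01 \<subseteq> I01" and Q: "countable Q"
    and disp: "\<And>x. x \<in> I01 \<Longrightarrow> T x - x \<in> Q"
    and meas: "\<And>q. {x \<in> I01. T x - x = q} \<in> sets Leb01"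
    and A: "A \<in> sets Leb01"
  shows "T ` A \<in> sets Leb01 \<and> emeasure Leb01 (T ` A) = emeasure Leb01 A"
proof -
  define P where "P q = A \<inter> {x \<in> I01. T x - x = q}" for q
  have P: "P q \<in> sets Leb01" for q using A meas by (auto simp: P_def)
  have AU: "A = (\<Union>q\<in>Q. P q)"
    using disp sets_Leb01_subset[OF A] by (auto simp: P_def)
  have TP: "T ` P q = (\<lambda>x. q + x) ` P q" for q
    by (rule image_cong) (auto simp: P_def)
  have TPI: "T ` P q \<subseteq> I01" for q using into by (auto simp: P_def)
  have TPm: "T ` P q \<in> sets Leb01" for q
    unfolding sets_Leb01_iff using TPI lebesgue_sets_translation[of "P q" q] P[of q]
    by (auto simp: TP sets_Leb01_iff)
  have em: "emeasure Leb01 (T ` P q) = emeasure Leb01 (P q)" for q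
    using emeasure_lebesgue_affine[of 1 q "P q"] TPI[of q] sets_Leb01_subset[OF P[of q]]
    by (simp add: emeasure_Leb01 TP add.commute)
  have dP: "disjoint_family_on P Q" by (auto simp: P_def disjoint_family_on_def)
  have PI: "P q \<subseteq> I01" for q by (auto simp: P_def)
  have dTP: "disjoint_family_on (\<lambda>q. T ` P q) Q"
    using inj_on_image_Int[OF inj PI PI] dP unfolding disjoint_family_on_def by (metis image_empty)
  have TAU: "T ` A = (\<Union>q\<in>Q. T ` P q)" using AU by auto
  have 1: "T ` A \<in> sets Leb01" unfolding TAU using Q TPm by (intro sets.countable_UN') auto
  have "emeasure Leb01 (T ` A) = (\<integral>\<^sup>+q. emeasure Leb01 (T ` P q) \<partial>count_space Q)"
    unfolding TAU using TPm Q dTP by (intro emeasure_UN_countable) auto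
  also have "\<dots> = (\<integral>\<^sup>+q. emeasure Leb01 (P q) \<partial>count_space Q)" by (simp add: em)
  also have "\<dots> = emeasure Leb01 A"
    by (subst AU, rule emeasure_UN_countable[symmetric]) (use P Q dP in auto)
  finally show ?thesis using 1 by simp
qed

lemma MPT_countable_displacement:
  assumes b: "bij_betw T I01 I01" and Q: "countable Q"
    and disp: "\<And>x. x \<in> I01 \<Longrightarrow> T x - x \<in> Q"
    and meas: "\<And>q. {x \<in> I01. T x - x = q} \<in> sets Leb01"
  shows "T \<in> MPT"
proof (rule MPT_I[OF b])
  have inj: "inj_on T I01" and s: "T ` I01 = I01" using b by (auto simp: bij_betw_def)
  show img: "T ` A \<in> sets Leb01 \<and> emeasure Leb01 (T ` A) = emeasure Leb01 A"
    if "A \<in> sets Leb01" for A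
    using translation_pieces_image[OF inj _ Q disp meas that] s by blast
  define S where "S = inv_into I01 T"
  have ST: "S (T x) = x" if "x \<in> I01" for x using that inj by (simp add: S_def)
  have TS: "T (S y) = y" "S y \<in> I01" if "y \<in> I01" for y
    using that s f_inv_into_f[of y T I01] inv_into_into[of y T I01] by (auto simp: S_def)
  have bS: "bij_betw S I01 I01" unfolding S_def by (rule bij_betw_inv_into[OF b])
  fix A assume A: "A \<in> sets Leb01"
  have eq: "T -` A \<inter> I01 = S ` A"
    using ST TS sets_Leb01_subset[OF A] by force
  show "T -` A \<inter> I01 \<in> sets Leb01 \<and> emeasure Leb01 (T -` A \<inter> I01) = emeasure Leb01 A"
    unfolding eq
  proof (rule translation_pieces_image)
    show "inj_on S I01" "S ` I01 \<subseteq> I01" using bS by (auto simp: bij_betw_def)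
    show "countable (uminus ` Q)" using Q by simp
    show "S y - y \<in> uminus ` Q" if "y \<in> I01" for y
      using disp[OF TS(2)[OF that]] TS(1)[OF that]
      by (metis image_eqI minus_diff_eq)
    show "{y \<in> I01. S y - y = q} \<in> sets Leb01" for q
    proof -
      \<comment> \<open>The inverse moves by \<open>q\<close> exactly on the image of the set where
        \<open>T\<close> moves by \<open>- q\<close>; hence the claim on images has to precede the
        one on preimages.\<close>
      have "{y \<in> I01. S y - y = q} = T ` {x \<in> I01. T x - x = - q}"
        (is "?L = T ` ?R")
      proof
        show "?L \<subseteq> T ` ?R"
        proof
          fix y assume "y \<in> ?L"
          then have "S y \<in> ?R" "y = T (S y)" using TS[of y] by auto
          then show "y \<in> T ` ?R" by blast
        qed
        show "T ` ?R \<subseteq> ?L" using ST b by (auto simp: bij_betw_def)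
      qed
      then show ?thesis using img[OF meas[of "-q"]] by simp
    qed
  qed (rule A)
qed

subsection \<open>The weak topology\<close>

definition sym_dist :: "real set \<Rightarrow> real set \<Rightarrow> real" where
  "sym_dist A B = mu (sym_diff A B)"

lemma sym_dist_nonneg [simp]: "0 \<le> sym_dist A B"
  by (simp add: sym_dist_def)

lemma sym_dist_self [simp]: "sym_dist A A = 0"
  by (simp add: sym_dist_def)

lemma sym_dist_commute: "sym_dist A B = sym_dist B A"
  by (simp add: sym_dist_def Un_commute)

text \<open>Subadditivity applied to an inclusion of symmetric differences; it covers both the
  triangle inequality and the stability of intersections.\<close>

lemma sym_dist_triangle_general:
  assumes "sym_diff X Y \<subseteq> sym_diff A B \<union> sym_diff C D"
    and [measurable]: "A \<in> sets Leb01" "B \<in> sets Leb01" "C \<in> sets Leb01" "D \<in> sets Leb01"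
  shows "sym_dist X Y \<le> sym_dist A B + sym_dist C D"
proof -
  have "mu (sym_diff X Y) \<le> mu (sym_diff A B \<union> sym_diff C D)"
    by (rule Leb.finite_measure_mono[OF assms(1)]) measurable
  also have "\<dots> \<le> mu (sym_diff A B) + mu (sym_diff C D)"
    by (rule measure_Un_le) measurable
  finally show ?thesis by (simp add: sym_dist_def)
qed

lemma sym_dist_triangle:
  "A \<in> sets Leb01 \<Longrightarrow> B \<in> sets Leb01 \<Longrightarrow> C \<in> sets Leb01 \<Longrightarrow> sym_dist A C \<le> sym_dist A B + sym_dist B C"
  by (rule sym_dist_triangle_general) auto

lemma sym_dist_Int:
  "A \<in> sets Leb01 \<Longrightarrow> B \<in> sets Leb01 \<Longrightarrow> C \<in> sets Leb01 \<Longrightarrow> D \<in> sets Leb01 \<Longrightarrow>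
   sym_dist (A \<inter> C) (B \<inter> D) \<le> sym_dist A B + sym_dist C D"
  by (rule sym_dist_triangle_general) auto

lemma mu_diff_le_sym_dist:
  assumes [measurable]: "A \<in> sets Leb01" "B \<in> sets Leb01"
  shows "\<bar>mu A - mu B\<bar> \<le> sym_dist A B"
proof -
  have le: "mu X \<le> mu Y + sym_dist X Y" if [measurable]: "X \<in> sets Leb01" "Y \<in> sets Leb01" for X Y
  proof -
    have "mu X \<le> mu (Y \<union> sym_diff X Y)"
      by (rule Leb.finite_measure_mono) auto
    also have "\<dots> \<le> mu Y + mu (sym_diff X Y)"
      by (rule measure_Un_le) measurable
    finally show ?thesis by (simp add: sym_dist_def)
  qed
  show ?thesis using le[of A B] le[of B A] by (simp add: sym_dist_commute)
qed

lemma sym_dist_UN_le: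
  assumes "finite F" and A: "\<And>n. n \<in> F \<Longrightarrow> A n \<in> sets Leb01" and B: "\<And>n. n \<in> F \<Longrightarrow> B n \<in> sets Leb01"
  shows "sym_dist (\<Union>n\<in>F. A n) (\<Union>n\<in>F. B n) \<le> (\<Sum>n\<in>F. sym_dist (A n) (B n))"
proof -
  have "mu (sym_diff (\<Union>n\<in>F. A n) (\<Union>n\<in>F. B n)) \<le> mu (\<Union>n\<in>F. sym_diff (A n) (B n))"
    using assms by (intro Leb.finite_measure_mono sets.finite_UN) auto
  also have "\<dots> \<le> (\<Sum>n\<in>F. mu (sym_diff (A n) (B n)))"
    using assms by (intro measure_UNION_le) auto
  finally show ?thesis by (simp add: sym_dist_def)
qed

lemma sym_dist_image:
  assumes "T \<in> MPT" "A \<in> sets Leb01" "B \<in> sets Leb01"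
  shows "sym_dist (T ` A) (T ` B) = sym_dist A B"
proof -
  have inj: "inj_on T I01" using MPT_bij[OF assms(1)] by (simp add: bij_betw_def)
  have "sym_diff (T ` A) (T ` B) = T ` sym_diff A B"
    using sets_Leb01_subset[OF assms(2)] sets_Leb01_subset[OF assms(3)] inj
    by (auto dest: inj_onD)
  then show ?thesis using MPT_image_mu[OF assms(1)] assms by (simp add: sym_dist_def)
qed

lemma sym_dist_vimage:
  assumes "T \<in> MPT" "A \<in> sets Leb01" "B \<in> sets Leb01"
  shows "sym_dist (T -` A \<inter> I01) (T -` B \<inter> I01) = sym_dist A B"
proof -
  have "sym_diff (T -` A \<inter> I01) (T -` B \<inter> I01) = T -` sym_diff A B \<inter> I01" by auto
  then show ?thesis using MPT_vimage_mu[OF assms(1), of "sym_diff A B"] assms by (simp add: sym_dist_def)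
qed

lemma topspace_weak_top [simp]: "topspace weak_top = MPT"
proof -
  have "MPT \<in> {{T \<in> MPT. emeasure Leb01 ((T ` A - B) \<union> (B - T ` A)) < ennreal r} | A B r.
        A \<in> sets Leb01 \<and> B \<in> sets Leb01 \<and> r > 0}"
    by (intro CollectI exI[of _ "{}"] exI[of _ "1::real"]) simp
  then show ?thesis unfolding weak_top_def topology_generated_by_topspace by blast
qed

lemma emeasure_less_iff_sym_dist:
  "r > 0 \<Longrightarrow> emeasure Leb01 (sym_diff A B) < ennreal r \<longleftrightarrow> sym_dist A B < r"
  by (simp add: sym_dist_def Leb.emeasure_eq_measure ennreal_less_iff)

lemma eventually_sym_dist_image_less:
  assumes "T \<in> MPT" "A \<in> sets Leb01" "r > 0"
  shows "eventually (\<lambda>S. sym_dist (S ` A) (T ` A) < r) (nhdsin weak_top T)"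
proof -
  let ?U = "{S \<in> MPT. emeasure Leb01 (sym_diff (S ` A) (T ` A)) < ennreal r}"
  have "openin weak_top ?U" unfolding weak_top_def
    using assms MPT_image_sets[OF assms(1,2)]
    by (intro topology_generated_by_Basis CollectI exI[of _ A] exI[of _ "T ` A"] exI[of _ r]) simp
  moreover have "T \<in> ?U" using assms by simp
  ultimately show ?thesis unfolding eventually_nhdsin
    using assms(3) by (intro disjI2 exI[of _ ?U]) (auto simp: emeasure_less_iff_sym_dist)
qed

lemma eventually_MPT: "eventually (\<lambda>S. S \<in> MPT) (nhdsin weak_top T)"
  unfolding eventually_nhdsin using openin_topspace[of weak_top] by auto

lemma openin_weak_topI:
  assumes "U \<subseteq> MPT" "\<And>T. T \<in> U \<Longrightarrow> eventually (\<lambda>S. S \<in> U) (nhdsin weak_top T)"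
  shows "openin weak_top U"
proof (subst openin_subopen, intro ballI)
  fix T assume T: "T \<in> U"
  show "\<exists>V. openin weak_top V \<and> T \<in> V \<and> V \<subseteq> U"
    using assms(2)[OF T] T assms(1) unfolding eventually_nhdsin by auto
qed

text \<open>Induction on the generation of the topology. A subbasic set is centred at an arbitrary
  \<open>B\<close>; the triangle inequality recentres it at \<open>T\<close>
  A\<open>with radius\<close>r - sym_dist (T \<open>A) B\<close>. Density then has to be checked on
  finitely many sets only.\<close>

lemma openin_weak_top_basic_nhd:
  assumes "openin weak_top U" "T \<in> U"
  shows "\<exists>\<A> r. finite \<A> \<and> \<A> \<subseteq> sets Leb01 \<and> r > 0 \<and>
     (\<forall>S\<in>MPT. (\<forall>A\<in>\<A>. sym_dist (S ` A) (T ` A) < r) \<longrightarrow> S \<in> U)"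
  using openin_topology_generated_by[OF assms(1)[unfolded weak_top_def]] assms(2)
proof (induction U rule: generate_topology_on.induct)
  case Empty
  then show ?case by simp
next
  case (Int U V)
  obtain \<A> r where 1: "finite \<A>" "\<A> \<subseteq> sets Leb01" "r > 0"
     "\<forall>S\<in>MPT. (\<forall>A\<in>\<A>. sym_dist (S ` A) (T ` A) < r) \<longrightarrow> S \<in> U" using Int by auto
  obtain \<B> s where 2: "finite \<B>" "\<B> \<subseteq> sets Leb01" "s > 0"
     "\<forall>S\<in>MPT. (\<forall>A\<in>\<B>. sym_dist (S ` A) (T ` A) < s) \<longrightarrow> S \<in> V" using Int by auto
  show ?case
    by (rule exI[of _ "\<A> \<union> \<B>"], rule exI[of _ "min r s"]) (use 1 2 in auto)
next
  case (UN K)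
  then obtain k where k: "k \<in> K" "T \<in> k" by auto
  from UN(2)[OF k] k(1) show ?case by (meson Union_iff)
next
  case (Basis U)
  then obtain A B r where U: "U = {T \<in> MPT. emeasure Leb01 (sym_diff (T ` A) B) < ennreal r}"
    and A: "A \<in> sets Leb01" "B \<in> sets Leb01" "r > 0" by auto
  from Basis(2) have T: "T \<in> MPT" "sym_dist (T ` A) B < r"
    unfolding U using A(3) by (auto simp: emeasure_less_iff_sym_dist)
  have "S \<in> U" if "S \<in> MPT" "sym_dist (S ` A) (T ` A) < r - sym_dist (T ` A) B" for S
    using that sym_dist_triangle[of "S ` A" "T ` A" B] A MPT_image_sets T
    by (auto simp: U emeasure_less_iff_sym_dist)
  then show ?case
    using A T by (intro exI[of _ "{A}"] exI[of _ "r - sym_dist (T ` A) B"]) auto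
qed

text \<open>Since \<open>S\<close> is an isometry for \<open>sym_dist\<close>, the error after
  \<open>n\<close> steps is carried along unchanged, and each further step adds only the error of
  \<open>S\<close> against \<open>T\<close> on a fixed set.\<close>

lemma tendsto_sym_dist_funpow_image:
  assumes T: "T \<in> MPT" and A: "A \<in> sets Leb01"
  shows "((\<lambda>S. sym_dist ((S ^^ n) ` A) ((T ^^ n) ` A)) \<longlongrightarrow> 0) (nhdsin weak_top T)"
proof (induction n)
  case 0
  then show ?case by simp
next
  case (Suc n)
  let ?C = "(T ^^ n) ` A"
  have C: "?C \<in> sets Leb01" using MPT_image_sets[OF MPT_funpow[OF T] A] .
  have "((\<lambda>S. sym_dist (S ` ?C) (T ` ?C)) \<longlongrightarrow> 0) (nhdsin weak_top T)"
    using eventually_sym_dist_image_less[OF T C] by (auto simp: tendsto_iff)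
  from tendsto_add[OF Suc this]
  have lim: "((\<lambda>S. sym_dist ((S ^^ n) ` A) ?C + sym_dist (S ` ?C) (T ` ?C)) \<longlongrightarrow> 0) (nhdsin weak_top T)"
    by simp
  have "\<forall>\<^sub>F S in nhdsin weak_top T. sym_dist ((S ^^ Suc n) ` A) ((T ^^ Suc n) ` A)
      \<le> sym_dist ((S ^^ n) ` A) ?C + sym_dist (S ` ?C) (T ` ?C)"
    using eventually_MPT
  proof eventually_elim
    case (elim S)
    have SA: "(S ^^ n) ` A \<in> sets Leb01" using MPT_image_sets[OF MPT_funpow[OF elim] A] .
    have "sym_dist (S ` (S ^^ n) ` A) (T ` ?C)
        \<le> sym_dist (S ` (S ^^ n) ` A) (S ` ?C) + sym_dist (S ` ?C) (T ` ?C)"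
      using SA C T elim by (intro sym_dist_triangle) (auto simp: MPT_image_sets)
    then show ?case using sym_dist_image[OF elim SA C] by (simp add: image_comp)
  qed
  then show ?case
    by (intro tendsto_sandwich[OF _ _ tendsto_const lim]) auto
qed

lemma tendsto_sym_dist_funpow_vimage:
  assumes T: "T \<in> MPT" and A: "A \<in> sets Leb01"
  shows "((\<lambda>S. sym_dist ((S ^^ n) -` A \<inter> I01) ((T ^^ n) -` A \<inter> I01)) \<longlongrightarrow> 0) (nhdsin weak_top T)"
proof -
  let ?C = "(T ^^ n) -` A \<inter> I01"
  note Tn = MPT_funpow[OF T, of n]
  have C: "?C \<in> sets Leb01" by (rule MPT_vimage_sets[OF Tn A])
  have "\<forall>\<^sub>F S in nhdsin weak_top T. sym_dist ((S ^^ n) ` ?C) ((T ^^ n) ` ?C) = sym_dist ((S ^^ n) -` A \<inter> I01) ?C"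
    using eventually_MPT
  proof eventually_elim
    case (elim S)
    note Sn = MPT_funpow[OF elim, of n]
    have "sym_dist ((S ^^ n) ` ((S ^^ n) -` A \<inter> I01)) ((S ^^ n) ` ?C) = sym_dist ((S ^^ n) -` A \<inter> I01) ?C"
      by (rule sym_dist_image[OF Sn MPT_vimage_sets[OF Sn A] C])
    then show ?case
      unfolding MPT_image_vimage[OF Sn sets_Leb01_subset[OF A]] MPT_image_vimage[OF Tn sets_Leb01_subset[OF A]]
      by (simp only: sym_dist_commute)
  qed
  from Lim_transform_eventually[OF tendsto_sym_dist_funpow_image[OF T C] this] show ?thesis .
qed

lemma tendsto_mu_of_sym_dist:
  assumes "((\<lambda>S. sym_dist (X S) Y) \<longlongrightarrow> 0) F" "eventually (\<lambda>S. X S \<in> sets Leb01) F" "Y \<in> sets Leb01"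
  shows "((\<lambda>S. mu (X S)) \<longlongrightarrow> mu Y) F"
proof (rule Lim_null_comparison[THEN LIM_zero_cancel])
  show "\<forall>\<^sub>F S in F. norm (mu (X S) - mu Y) \<le> sym_dist (X S) Y"
    using assms(2) by eventually_elim (use mu_diff_le_sym_dist assms(3) in auto)
qed (rule assms(1))

lemma tendsto_mu_funpow_vimage_Int:
  assumes T: "T \<in> MPT" and A: "A \<in> sets Leb01"
  shows "((\<lambda>S. mu ((S ^^ i) -` A \<inter> (S ^^ j) -` A \<inter> I01)) \<longlongrightarrow> mu ((T ^^ i) -` A \<inter> (T ^^ j) -` A \<inter> I01))
    (nhdsin weak_top T)"
proof -
  let ?V = "\<lambda>S i. (S ^^ i) -` A \<inter> I01"
  have V: "?V S i \<in> sets Leb01" if "S \<in> MPT" for S i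
    by (rule MPT_vimage_sets[OF MPT_funpow[OF that] A])
  have lim: "((\<lambda>S. sym_dist (?V S i) (?V T i) + sym_dist (?V S j) (?V T j)) \<longlongrightarrow> 0) (nhdsin weak_top T)"
    using tendsto_add[OF tendsto_sym_dist_funpow_vimage[OF T A] tendsto_sym_dist_funpow_vimage[OF T A]] by simp
  have "\<forall>\<^sub>F S in nhdsin weak_top T. sym_dist (?V S i \<inter> ?V S j) (?V T i \<inter> ?V T j)
      \<le> sym_dist (?V S i) (?V T i) + sym_dist (?V S j) (?V T j)"
    using eventually_MPT by eventually_elim (intro sym_dist_Int V T)
  then have "((\<lambda>S. sym_dist (?V S i \<inter> ?V S j) (?V T i \<inter> ?V T j)) \<longlongrightarrow> 0) (nhdsin weak_top T)"
    by (intro tendsto_sandwich[OF _ _ tendsto_const lim]) auto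
  then have "((\<lambda>S. mu (?V S i \<inter> ?V S j)) \<longlongrightarrow> mu (?V T i \<inter> ?V T j)) (nhdsin weak_top T)"
  proof (rule tendsto_mu_of_sym_dist)
    show "\<forall>\<^sub>F S in nhdsin weak_top T. ?V S i \<inter> ?V S j \<in> sets Leb01"
      using eventually_MPT by eventually_elim (intro sets.Int V)
  qed (intro sets.Int V T)
  moreover have "(S ^^ i) -` A \<inter> (S ^^ j) -` A \<inter> I01 = ?V S i \<inter> ?V S j" for S by auto
  ultimately show ?thesis by simp
qed

subsection \<open>Dyadic cells\<close>

definition cell :: "nat \<Rightarrow> real \<Rightarrow> nat" where
  "cell J x = nat \<lfloor>2 ^ J * x\<rfloor>"

definition cells :: "nat \<Rightarrow> nat set \<Rightarrow> real set" where
  "cells J C = {x \<in> I01. cell J x \<in> C}"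

lemma of_nat_cell: "x \<in> I01 \<Longrightarrow> int (cell J x) = \<lfloor>2 ^ J * x\<rfloor>"
  by (simp add: cell_def I01_def)

lemma cell_bounds:
  assumes "x \<in> I01"
  shows "real (cell J x) \<le> 2 ^ J * x" "2 ^ J * x < real (cell J x) + 1"
proof -
  have "real (cell J x) = of_int \<lfloor>2 ^ J * x\<rfloor>"
    using of_nat_cell[OF assms, of J] by (metis of_int_of_nat_eq)
  then show "real (cell J x) \<le> 2 ^ J * x" "2 ^ J * x < real (cell J x) + 1" by linarith+
qed

lemma cell_eqI:
  assumes "real c \<le> 2 ^ J * x" "2 ^ J * x < real c + 1"
  shows "cell J x = c"
proof -
  have "\<lfloor>2 ^ J * x\<rfloor> = int c" using assms by (intro floor_unique) auto
  then show ?thesis by (simp add: cell_def)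
qed

lemma cell_less: "x \<in> I01 \<Longrightarrow> cell J x < 2 ^ J"
proof -
  assume x: "x \<in> I01"
  have "real (cell J x) \<le> 2 ^ J * x" by (rule cell_bounds[OF x])
  also have "\<dots> < 2 ^ J * 1" using x by (intro mult_strict_left_mono) (auto simp: I01_def)
  finally have "real (cell J x) < real (2 ^ J)" by simp
  then show ?thesis by (simp only: of_nat_less_iff)
qed

lemma cell_eq_imp_close:
  assumes "x \<in> I01" "y \<in> I01" "cell J x = cell J y"
  shows "\<bar>x - y\<bar> < 1 / 2 ^ J"
proof -
  have "\<bar>2 ^ J * x - 2 ^ J * y\<bar> < 1"
    using cell_bounds[OF assms(1), of J] cell_bounds[OF assms(2), of J] assms(3) by linarith
  then have "2 ^ J * \<bar>x - y\<bar> < 1" by (simp add: right_diff_distrib[symmetric] abs_mult)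
  then show ?thesis by (simp add: field_simps)
qed

lemma cell_refine: "cell J x = cell (J + k) x div 2 ^ k"
proof -
  have "\<lfloor>2 ^ J * x\<rfloor> = \<lfloor>2 ^ (J + k) * x / of_int (2 ^ k)\<rfloor>" by (simp add: power_add)
  also have "\<dots> = \<lfloor>2 ^ (J + k) * x\<rfloor> div 2 ^ k" by (rule floor_divide_real_eq_div) simp
  finally show ?thesis by (simp add: cell_def nat_div_distrib' nat_power_eq)
qed

lemma cells_sets [simp]: "cells J C \<in> sets Leb01"
proof -
  have [measurable]: "cell J \<in> measurable borel (count_space UNIV)" unfolding cell_def by measurable
  have "{x. cell J x \<in> C} \<in> sets borel" by measurable
  from sets_Leb01_borel[OF this] show ?thesis by (simp add: cells_def Int_def conj_commute)
qed

text \<open>Outer regularity replaces \<open>A\<close> by a relatively open set, which is the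
  increasing union of the cells it contains. All fine levels work, so one level can later serve
  several sets.\<close>

lemma approximate_by_cells:
  assumes A: "A \<in> sets Leb01" and e: "e > 0"
  shows "\<exists>J0. \<forall>J\<ge>J0. \<exists>C. sym_dist A (cells J C) < e"
proof -
  obtain U where U: "open U" "A \<subseteq> U" "emeasure lebesgue (U - A) < ennreal (e / 2)"
    by (rule sets_lebesgue_outer_open[of A "e / 2"]) (use A e in \<open>auto simp: sets_Leb01_iff\<close>)
  define V where "V = U \<inter> I01"
  have V: "V \<in> sets Leb01" unfolding V_def using U(1) by (intro sets_Leb01_borel) auto
  \<comment> \<open>Numbers of nonexistent cells satisfy this vacuously, but \<open>cells\<close>
    ignores them.\<close>
  define C where "C J = {c. \<forall>z\<in>I01. cell J z = c \<longrightarrow> z \<in> U}" for J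
  have sub: "cells J (C J) \<subseteq> V" for J by (auto simp: cells_def C_def V_def)
  have inc: "incseq (\<lambda>J. cells J (C J))"
  proof (rule incseq_SucI)
    fix J show "cells J (C J) \<subseteq> cells (Suc J) (C (Suc J))"
      using cell_refine[of J _ 1] by (auto simp: cells_def C_def)
  qed
  have un: "(\<Union>J. cells J (C J)) = V"
  proof
    show "V \<subseteq> (\<Union>J. cells J (C J))"
    proof
      fix x assume x: "x \<in> V"
      then obtain d where d: "d > 0" "ball x d \<subseteq> U" using U(1) by (auto simp: V_def open_contains_ball)
      obtain J where "(1 / 2) ^ J < d" using real_arch_pow_inv[of d "1/2"] d(1) by auto
      then have J: "1 / 2 ^ J < d" by (simp add: power_divide)
      have "z \<in> U" if "z \<in> I01" "cell J z = cell J x" for z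
        using cell_eq_imp_close[OF that(1) _ that(2)] x J d(2) by (force simp: V_def dist_real_def ball_def)
      then show "x \<in> (\<Union>J. cells J (C J))" using x by (auto simp: cells_def C_def V_def)
    qed
  qed (use sub in auto)
  have "(\<lambda>J. mu (cells J (C J))) \<longlonglongrightarrow> mu (\<Union>J. cells J (C J))"
    by (rule Leb.finite_Lim_measure_incseq) (use inc in auto)
  then have "\<forall>\<^sub>F J in sequentially. mu V - e / 2 < mu (cells J (C J))"
    unfolding un using e by (intro order_tendstoD(1)) auto
  then obtain J0 where J0: "\<And>J. J \<ge> J0 \<Longrightarrow> mu V - e / 2 < mu (cells J (C J))"
    by (auto simp: eventually_sequentially)
  have AV: "sym_dist A V < e / 2"
  proof -
    have "sym_diff A V = (U - A) \<inter> I01" using U(2) sets_Leb01_subset[OF A] by (auto simp: V_def)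
    moreover have "emeasure Leb01 ((U - A) \<inter> I01) \<le> emeasure lebesgue (U - A)"
      using U(1) A by (subst emeasure_Leb01) (auto intro!: emeasure_mono simp: sets_Leb01_iff)
    ultimately show ?thesis
      using emeasure_less_iff_sym_dist[of "e/2" A V] e U(3) by auto
  qed
  have "sym_dist A (cells J (C J)) < e" if "J \<ge> J0" for J
  proof -
    have "sym_dist V (cells J (C J)) = mu (V - cells J (C J))"
      unfolding sym_dist_def using sub[of J] by (simp add: Diff_eq_empty_iff[THEN iffD2])
    also have "\<dots> = mu V - mu (cells J (C J))"
      using V sub[of J] by (intro Leb.finite_measure_Diff) auto
    also have "\<dots> < e / 2" using J0[OF that] by simp
    finally show ?thesis using sym_dist_triangle[OF A V, of "cells J (C J)"] AV by simp
  qed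
  then show ?thesis by blast
qed

text \<open>Each colour class is approximated by a union of cells, and a cell receives any colour
  whose union contains it. A point that disagrees with its cell lies in the symmetric difference of
  some class and its approximation, so the errors add up to at most the number of colours times
  \<open>d\<close>.\<close>

lemma approximate_colouring:
  fixes F :: "real \<Rightarrow> 'c"
  assumes fin: "finite (F ` I01)" and meas: "\<And>s. {x \<in> I01. F x = s} \<in> sets Leb01" and e: "e > 0"
  shows "\<exists>J0. \<forall>J\<ge>J0. \<exists>f. range f \<subseteq> F ` I01 \<and> mu {x \<in> I01. F x \<noteq> f (cell J x)} < e"
proof -
  let ?S = "F ` I01"
  let ?L = "\<lambda>s. {x \<in> I01. F x = s}"
  have z: "0 \<in> I01" by (simp add: I01_def)
  then have p: "card ?S > 0" using fin by (auto simp: card_gt_0_iff)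
  define d where "d = e / card ?S"
  have d: "d > 0" using e p by (simp add: d_def)
  have "\<forall>s\<in>?S. \<exists>J0. \<forall>J\<ge>J0. \<exists>C. sym_dist (?L s) (cells J C) < d"
    using approximate_by_cells[OF meas d] by blast
  then obtain J0 where J0: "\<And>s J. s \<in> ?S \<Longrightarrow> J \<ge> J0 s \<Longrightarrow> \<exists>C. sym_dist (?L s) (cells J C) < d"
    by metis
  have "\<exists>f. range f \<subseteq> ?S \<and> mu {x \<in> I01. F x \<noteq> f (cell J x)} < e" if J: "J \<ge> Max (J0 ` ?S)" for J
  proof -
    have "\<forall>s\<in>?S. \<exists>C. sym_dist (?L s) (cells J C) < d"
      using J fin J0 by (meson Max_ge dual_order.trans finite_imageI imageI)
    then obtain C where C: "\<And>s. s \<in> ?S \<Longrightarrow> sym_dist (?L s) (cells J (C s)) < d" by metis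
    \<comment> \<open>Cells claimed by no colour get the colour of the point 0, so that
      \<open>f\<close> takes only colours of \<open>F\<close>.\<close>
    define f where "f c = (if \<exists>s\<in>?S. c \<in> C s then SOME s. s \<in> ?S \<and> c \<in> C s else F 0)" for c
    have f: "f c \<in> ?S \<and> c \<in> C (f c)" if "\<exists>s\<in>?S. c \<in> C s" for c
      using someI_ex[of "\<lambda>s. s \<in> ?S \<and> c \<in> C s"] that unfolding f_def by auto
    have rf: "f c \<in> ?S" for c using f[of c] z by (cases "\<exists>s\<in>?S. c \<in> C s") (auto simp: f_def)
    let ?D = "\<lambda>s. sym_diff (?L s) (cells J (C s))"
    have D: "?D s \<in> sets Leb01" for s by (intro sets.Un sets.Diff meas cells_sets)
    have "{x \<in> I01. F x \<noteq> f (cell J x)} \<subseteq> (\<Union>s\<in>?S. ?D s)"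
    proof
      fix x assume x: "x \<in> {x \<in> I01. F x \<noteq> f (cell J x)}"
      show "x \<in> (\<Union>s\<in>?S. ?D s)"
      proof (rule ccontr)
        assume n: "x \<notin> (\<Union>s\<in>?S. ?D s)"
        have *: "F x = s \<longleftrightarrow> cell J x \<in> C s" if "s \<in> ?S" for s
          using n that x by (auto simp: cells_def)
        from *[of "F x"] x have "\<exists>s\<in>?S. cell J x \<in> C s" by auto
        from f[OF this] * x show False by auto
      qed
    qed
    then have "mu {x \<in> I01. F x \<noteq> f (cell J x)} \<le> mu (\<Union>s\<in>?S. ?D s)"
      using fin D by (intro Leb.finite_measure_mono sets.finite_UN) auto
    also have "\<dots> \<le> (\<Sum>s\<in>?S. mu (?D s))" by (rule measure_UNION_le[OF fin D])
    also have "\<dots> < (\<Sum>s\<in>?S. d)" using C fin z by (intro sum_strict_mono) (auto simp: sym_dist_def)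
    also have "\<dots> = e" using p by (simp add: d_def)
    finally show ?thesis using rf by (intro exI[of _ f]) auto
  qed
  then show ?thesis by blast
qed

subsection \<open>A mean ergodic theorem\<close>

lemma distr_MPT: "T \<in> MPT \<Longrightarrow> distr Leb01 Leb01 T = Leb01"
  by (rule measure_eqI)
    (simp_all add: emeasure_distr MPT_measurable MPT_vimage_sets MPT_vimage_mu Leb.emeasure_eq_measure)

lemma AE_MPT: "T \<in> MPT \<Longrightarrow> AE x in Leb01. P x \<Longrightarrow> AE x in Leb01. P (T x)"
  by (rule AE_distrD[OF MPT_measurable]) (simp, subst distr_MPT)

lemma integral_MPT:
  fixes f :: "real \<Rightarrow> real"
  assumes "T \<in> MPT" "f \<in> borel_measurable Leb01"
  shows "(\<integral>x. f (T x) \<partial>Leb01) = (\<integral>x. f x \<partial>Leb01)"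
  using integral_distr[OF MPT_measurable[OF assms(1)] assms(2)] by (simp add: distr_MPT[OF assms(1)])

definition orbit_avg :: "(real \<Rightarrow> real) \<Rightarrow> real set \<Rightarrow> nat \<Rightarrow> (nat \<Rightarrow> real) \<Rightarrow> real \<Rightarrow> real" where
  "orbit_avg T D n w x = (\<Sum>i<n. w i * indicator D ((T ^^ i) x))"

text \<open>The weights vanish from \<open>n\<close> on, so averages of different lengths can be
  padded to a common length before their midpoint is formed.\<close>

definition weights :: "nat \<Rightarrow> (nat \<Rightarrow> real) \<Rightarrow> bool" where
  "weights n w \<longleftrightarrow> (\<forall>i. 0 \<le> w i) \<and> (\<forall>i\<ge>n. w i = 0) \<and> (\<Sum>i<n. w i) = 1"

text \<open>The average has mean \<open>mu D\<close>, so the excess of the energy over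
  \<open>(mu D)\<^sup>2\<close> is its variance.\<close>

definition energy :: "(real \<Rightarrow> real) \<Rightarrow> real set \<Rightarrow> nat \<Rightarrow> (nat \<Rightarrow> real) \<Rightarrow> real" where
  "energy T D n w = (\<Sum>i<n. \<Sum>j<n. w i * w j * mu ((T ^^ i) -` D \<inter> (T ^^ j) -` D \<inter> I01))"

lemma funpow_measurable: "T \<in> MPT \<Longrightarrow> T ^^ n \<in> measurable Leb01 Leb01"
  by (intro MPT_measurable MPT_funpow)

lemma orbit_avg_measurable:
  assumes "T \<in> MPT" and [measurable]: "D \<in> sets Leb01"
  shows "orbit_avg T D n w \<in> borel_measurable Leb01"
proof -
  have [measurable]: "T ^^ i \<in> measurable Leb01 Leb01" for i by (rule funpow_measurable[OF assms(1)])
  show ?thesis unfolding orbit_avg_def by measurable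
qed

lemma orbit_avg_bounds:
  assumes "weights n w" shows "0 \<le> orbit_avg T D n w x" "orbit_avg T D n w x \<le> 1"
proof -
  show "0 \<le> orbit_avg T D n w x"
    using assms unfolding orbit_avg_def weights_def by (intro sum_nonneg) (auto simp: indicator_def)
  have "orbit_avg T D n w x \<le> (\<Sum>i<n. w i)"
    using assms unfolding orbit_avg_def weights_def by (intro sum_mono) (auto simp: indicator_def)
  then show "orbit_avg T D n w x \<le> 1" using assms by (simp add: weights_def)
qed

lemma integral_indicator_Int:
  assumes "T \<in> MPT" "D \<in> sets Leb01"
  shows "(\<integral>x. indicator D ((T ^^ i) x) * indicator D ((T ^^ j) x) \<partial>Leb01)
    = mu ((T ^^ i) -` D \<inter> (T ^^ j) -` D \<inter> I01)"
    and "integrable Leb01 (\<lambda>x. indicator D ((T ^^ i) x) * indicator D ((T ^^ j) x) :: real)"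
proof -
  have V: "(T ^^ i) -` D \<inter> I01 \<in> sets Leb01" for i
    by (rule MPT_vimage_sets[OF MPT_funpow[OF assms(1)] assms(2)])
  have eq: "(T ^^ i) -` D \<inter> (T ^^ j) -` D \<inter> I01 = ((T ^^ i) -` D \<inter> I01) \<inter> ((T ^^ j) -` D \<inter> I01)"
    by auto
  have W: "(T ^^ i) -` D \<inter> (T ^^ j) -` D \<inter> I01 \<in> sets Leb01" unfolding eq by (intro sets.Int V)
  have f: "indicator D ((T ^^ i) x) * indicator D ((T ^^ j) x) =
     (indicator ((T ^^ i) -` D \<inter> (T ^^ j) -` D \<inter> I01) x :: real)" if "x \<in> space Leb01" for x
    using that by (auto simp: indicator_def)
  show "(\<integral>x. indicator D ((T ^^ i) x) * indicator D ((T ^^ j) x) \<partial>Leb01)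
    = mu ((T ^^ i) -` D \<inter> (T ^^ j) -` D \<inter> I01)"
    using W by (subst Bochner_Integration.integral_cong[OF refl f]) auto
  show "integrable Leb01 (\<lambda>x. indicator D ((T ^^ i) x) * indicator D ((T ^^ j) x) :: real)"
    using W by (subst Bochner_Integration.integrable_cong[OF refl f]) (auto simp: Leb.emeasure_eq_measure)
qed

lemma energy_eq:
  assumes "T \<in> MPT" "D \<in> sets Leb01"
  shows "energy T D n w = (\<integral>x. (orbit_avg T D n w x)\<^sup>2 \<partial>Leb01)"
proof -
  have "(orbit_avg T D n w x)\<^sup>2 =
     (\<Sum>i<n. \<Sum>j<n. w i * w j * (indicator D ((T ^^ i) x) * indicator D ((T ^^ j) x)))" for x
    unfolding orbit_avg_def power2_eq_square sum_product by (simp add: mult_ac)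
  then show ?thesis
    using integral_indicator_Int[OF assms] by (simp add: energy_def)
qed

lemma integral_orbit_avg:
  assumes "T \<in> MPT" "D \<in> sets Leb01" "weights n w"
  shows "(\<integral>x. orbit_avg T D n w x \<partial>Leb01) = mu D"
proof -
  have V: "(T ^^ i) -` D \<inter> I01 \<in> sets Leb01" "mu ((T ^^ i) -` D \<inter> I01) = mu D" for i
    using MPT_vimage_sets[OF MPT_funpow[OF assms(1)] assms(2)]
      MPT_vimage_mu[OF MPT_funpow[OF assms(1)] assms(2)] by auto
  note I = integral_indicator_Int[OF assms(1,2), of i i for i]
  have ii: "indicator D y * indicator D y = (indicator D y :: real)" for y :: real
    by (simp add: indicator_def)
  have "(\<integral>x. orbit_avg T D n w x \<partial>Leb01) = (\<Sum>i<n. \<integral>x. w i * indicator D ((T ^^ i) x) \<partial>Leb01)"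
    unfolding orbit_avg_def using I(2) by (intro Bochner_Integration.integral_sum) (simp add: ii)
  also have "\<dots> = (\<Sum>i<n. w i * mu D)"
    using I(1) V by (simp add: ii)
  also have "\<dots> = mu D" using assms(3) by (simp add: sum_distrib_right[symmetric] weights_def)
  finally show ?thesis .
qed

lemma orbit_avg_pad: "weights n w \<Longrightarrow> n \<le> N \<Longrightarrow> orbit_avg T D n w x = orbit_avg T D N w x"
  unfolding orbit_avg_def by (rule sum.mono_neutral_left) (auto simp: weights_def)

lemma weights_pad: "weights n w \<Longrightarrow> n \<le> N \<Longrightarrow> weights N w"
proof -
  assume a: "weights n w" "n \<le> N"
  then have "(\<Sum>i<n. w i) = (\<Sum>i<N. w i)"
    by (intro sum.mono_neutral_left) (auto simp: weights_def)
  then show ?thesis using a by (auto simp: weights_def)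
qed

lemma orbit_avg_midpoint:
  assumes "weights n u" "weights m v"
  shows "\<exists>k w. weights k w \<and> (\<forall>x. orbit_avg T D k w x = (orbit_avg T D n u x + orbit_avg T D m v x) / 2)"
proof -
  let ?k = "max n m"
  have u: "weights ?k u" and v: "weights ?k v" using assms by (auto intro: weights_pad)
  let ?w = "\<lambda>i. (u i + v i) / 2"
  have "weights ?k ?w"
    using u v by (auto simp: weights_def sum.distrib sum_divide_distrib[symmetric])
  moreover have "orbit_avg T D ?k ?w x = (orbit_avg T D n u x + orbit_avg T D m v x) / 2" for x
  proof -
    have lin: "(\<Sum>i<?k. ?w i * I i) = ((\<Sum>i<?k. u i * I i) + (\<Sum>i<?k. v i * I i)) / 2"
      for I :: "nat \<Rightarrow> real"
      by (simp add: sum.distrib[symmetric] sum_divide_distrib algebra_simps add_divide_distrib)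
    have "orbit_avg T D ?k ?w x = (orbit_avg T D ?k u x + orbit_avg T D ?k v x) / 2"
      unfolding orbit_avg_def by (rule lin)
    also have "orbit_avg T D ?k u x = orbit_avg T D n u x"
      by (rule orbit_avg_pad[OF assms(1), symmetric]) simp
    also have "orbit_avg T D ?k v x = orbit_avg T D m v x"
      by (rule orbit_avg_pad[OF assms(2), symmetric]) simp
    finally show ?thesis .
  qed
  ultimately show ?thesis by blast
qed

lemma orbit_avg_shift:
  assumes "weights n w"
  shows "\<exists>k v. weights k v \<and> (\<forall>x. orbit_avg T D k v x = orbit_avg T D n w (T x))"
proof -
  define v where "v i = (case i of 0 \<Rightarrow> 0 | Suc j \<Rightarrow> w j)" for i
  have v: "v 0 = 0" "v (Suc j) = w j" for j by (simp_all add: v_def)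
  have "weights (Suc n) v" unfolding weights_def
  proof (intro conjI allI impI)
    show "0 \<le> v i" for i using assms v by (cases i) (auto simp: weights_def)
    show "v i = 0" if "Suc n \<le> i" for i using assms v that by (cases i) (auto simp: weights_def)
    show "sum v {..<Suc n} = 1" unfolding sum.lessThan_Suc_shift v using assms by (simp add: weights_def)
  qed
  moreover have "orbit_avg T D (Suc n) v x = orbit_avg T D n w (T x)" for x
    unfolding orbit_avg_def sum.lessThan_Suc_shift v by (simp add: funpow_swap1)
  ultimately show ?thesis by blast
qed

text \<open>The inequality \<open>\<bar>y\<bar> \<le> (t * y\<^sup>2 + 1 / t) / 2\<close> with
  \<open>t = 4 ^ k\<close> turns square integrals of order \<open>(1 / 16) ^ k\<close> into
  integrals of order \<open>(1 / 4) ^ k\<close>; Tonelli then sums them. This yields limits of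
  functions almost everywhere.\<close>

lemma AE_summable_of_integral_bound:
  fixes h :: "nat \<Rightarrow> real \<Rightarrow> real"
  assumes h: "\<And>k. integrable Leb01 (h k)" "\<And>k. integrable Leb01 (\<lambda>x. (h k x)\<^sup>2)"
    and b: "\<And>k. (\<integral>x. (h k x)\<^sup>2 \<partial>Leb01) \<le> 4 * (1 / 16) ^ k"
  shows "AE x in Leb01. summable (\<lambda>k. \<bar>h k x\<bar>)"
proof -
  have [measurable]: "h k \<in> borel_measurable Leb01" for k using h(1) by auto
  have i1: "(\<integral>x. \<bar>h k x\<bar> \<partial>Leb01) \<le> 4 * (1 / 4) ^ k" for k
  proof -
    let ?t = "4 ^ k :: real"
    have pw: "\<bar>y\<bar> \<le> (?t * y\<^sup>2 + 1 / ?t) / 2" for y :: real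
    proof -
      have "0 \<le> (?t * \<bar>y\<bar> - 1)\<^sup>2" by simp
      then have "2 * ?t * \<bar>y\<bar> \<le> ?t * ?t * y\<^sup>2 + 1" by (simp add: power2_eq_square algebra_simps)
      then have "2 * ?t * \<bar>y\<bar> / ?t \<le> (?t * ?t * y\<^sup>2 + 1) / ?t" by (intro divide_right_mono) auto
      then show ?thesis by (simp add: add_divide_distrib)
    qed
    have "(\<integral>x. \<bar>h k x\<bar> \<partial>Leb01) \<le> (\<integral>x. (?t * (h k x)\<^sup>2 + 1 / ?t) / 2 \<partial>Leb01)"
      using h by (intro integral_mono pw) auto
    also have "\<dots> = (?t * (\<integral>x. (h k x)\<^sup>2 \<partial>Leb01) + 1 / ?t) / 2"
      using h by (simp add: Leb.prob_space)
    also have "\<dots> \<le> (?t * (4 * (1 / 16) ^ k) + 1 / ?t) / 2"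
      using b[of k] by (intro divide_right_mono add_right_mono mult_left_mono) auto
    also have "\<dots> \<le> 4 * (1 / 4) ^ k"
    proof -
      have "(16::real) ^ k = 4 ^ k * 4 ^ k" by (simp add: power_mult_distrib[symmetric])
      then show ?thesis by (simp add: power_divide field_simps)
    qed
    finally show ?thesis .
  qed
  have nn: "(\<integral>\<^sup>+x. ennreal \<bar>h k x\<bar> \<partial>Leb01) \<le> ennreal (4 * (1 / 4) ^ k)" for k
    using i1[of k] h(1) by (subst nn_integral_eq_integral) (auto intro!: ennreal_leI)
  have "(\<integral>\<^sup>+x. (\<Sum>k. ennreal \<bar>h k x\<bar>) \<partial>Leb01) = (\<Sum>k. \<integral>\<^sup>+x. ennreal \<bar>h k x\<bar> \<partial>Leb01)"
    by (rule nn_integral_suminf) measurable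
  also have "\<dots> \<le> (\<Sum>k. ennreal (4 * (1 / 4) ^ k))" by (intro suminf_le nn) auto
  also have "\<dots> = ennreal (\<Sum>k. 4 * (1 / 4) ^ k)"
    by (rule suminf_ennreal2) (auto intro!: summable_mult summable_geometric)
  also have "\<dots> < \<infinity>" by simp
  finally have "(\<integral>\<^sup>+x. (\<Sum>k. ennreal \<bar>h k x\<bar>) \<partial>Leb01) \<noteq> \<infinity>" by simp
  then have "AE x in Leb01. (\<Sum>k. ennreal \<bar>h k x\<bar>) \<noteq> \<infinity>"
    by (intro nn_integral_PInf_AE) measurable
  then show ?thesis
    by eventually_elim (auto intro: summable_suminf_not_top)
qed

text \<open>A mean ergodic theorem: a minimising sequence of convex combinations is Cauchy by the
  parallelogram law, its limit is invariant and hence constant.\<close>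

lemma ergodic_energy:
  assumes T: "T \<in> MPT" and erg: "ergodic T" and D: "D \<in> sets Leb01" and e: "e > 0"
  shows "\<exists>n w. weights n w \<and> energy T D n w < (mu D)\<^sup>2 + e"
proof -
  \<comment> \<open>Closed under midpoints, as the parallelogram law requires, and under composition
    with \<open>T\<close>, which will make the limit invariant.\<close>
  define K where "K = {orbit_avg T D n w | n w. weights n w}"
  have Kmeas: "f \<in> borel_measurable Leb01" if "f \<in> K" for f
    using that orbit_avg_measurable[OF T D] by (auto simp: K_def)
  have Kb: "0 \<le> f x" "f x \<le> 1" if "f \<in> K" for f x
    using that orbit_avg_bounds by (auto simp: K_def)
  have Kabs: "\<bar>f x\<bar> \<le> 1" if "f \<in> K" for f x using Kb[OF that, of x] by auto
  have Kint: "integrable Leb01 f" if "f \<in> K" for f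
    by (rule Leb.integrable_const_bound[where B = 1]) (use Kmeas[OF that] Kabs[OF that] in auto)
  have Kprod: "integrable Leb01 (\<lambda>x. f x * g x)" if "f \<in> K" "g \<in> K" for f g
  proof (rule Leb.integrable_const_bound[where B = 1])
    show "AE x in Leb01. norm (f x * g x) \<le> 1"
      using Kabs[OF that(1)] Kabs[OF that(2)] by (auto simp: abs_mult intro!: mult_le_one)
    show "(\<lambda>x. f x * g x) \<in> borel_measurable Leb01" using Kmeas that by (intro borel_measurable_times) auto
  qed
  have Ksq: "integrable Leb01 (\<lambda>x. (f x)\<^sup>2)" if "f \<in> K" for f
    using Kprod[OF that that] by (simp add: power2_eq_square)
  have Kmid: "(\<lambda>x. (f x + g x) / 2) \<in> K" if "f \<in> K" "g \<in> K" for f g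
  proof -
    note fg = that
    obtain n u where u: "f = orbit_avg T D n u" "weights n u" using fg(1) unfolding K_def by blast
    obtain m v where v: "g = orbit_avg T D m v" "weights m v" using fg(2) unfolding K_def by blast
    from orbit_avg_midpoint[OF u(2) v(2), of T D] obtain k w where
      "weights k w" "\<And>x. orbit_avg T D k w x = (f x + g x) / 2" unfolding u(1) v(1) by blast
    then have "(\<lambda>x. (f x + g x) / 2) = orbit_avg T D k w \<and> weights k w" by auto
    then show ?thesis unfolding K_def by blast
  qed
  have Kshift: "(\<lambda>x. f (T x)) \<in> K" if "f \<in> K" for f
  proof -
    note fK = that
    obtain n u where u: "f = orbit_avg T D n u" "weights n u" using fK unfolding K_def by blast
    from orbit_avg_shift[OF u(2), of T D] obtain k w where
      "weights k w" "\<And>x. orbit_avg T D k w x = f (T x)" unfolding u(1) by blast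
    then have "(\<lambda>x. f (T x)) = orbit_avg T D k w \<and> weights k w" by auto
    then show ?thesis unfolding K_def by blast
  qed
  have KD: "(\<integral>x. f x \<partial>Leb01) = mu D" if "f \<in> K" for f
    using that integral_orbit_avg[OF T D] by (auto simp: K_def)
  let ?q = "\<lambda>f. \<integral>x. (f x)\<^sup>2 \<partial>Leb01"
  define c where "c = Inf (?q ` K)"
  have "orbit_avg T D 1 (\<lambda>i. if i = 0 then 1 else 0) \<in> K"
    unfolding K_def by (force simp: weights_def)
  then have ne: "?q ` K \<noteq> {}" by blast
  have bdd: "bdd_below (?q ` K)" by (intro bdd_belowI[of _ 0]) auto
  have c_le: "c \<le> ?q f" if "f \<in> K" for f
    unfolding c_def using that bdd by (intro cInf_lower) auto
  \<comment> \<open>Parallelogram law: the midpoint lies in \<open>K\<close>, so its square integral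
    is at least \<open>c\<close>.\<close>
  have par: "(\<integral>x. (f x - g x)\<^sup>2 \<partial>Leb01) \<le> 2 * ?q f + 2 * ?q g - 4 * c" if "f \<in> K" "g \<in> K" for f g
  proof -
    have "(\<integral>x. (f x - g x)\<^sup>2 \<partial>Leb01) = (\<integral>x. 2 * (f x)\<^sup>2 + 2 * (g x)\<^sup>2 - 4 * ((f x + g x) / 2)\<^sup>2 \<partial>Leb01)"
      by (rule Bochner_Integration.integral_cong) (auto simp: power2_eq_square field_simps)
    also have "\<dots> = 2 * ?q f + 2 * ?q g - 4 * (\<integral>x. ((f x + g x) / 2)\<^sup>2 \<partial>Leb01)"
      using Ksq[OF that(1)] Ksq[OF that(2)] Ksq[OF Kmid[OF that]] by simp
    also have "\<dots> \<le> 2 * ?q f + 2 * ?q g - 4 * c" using c_le[OF Kmid[OF that]] by simp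
    finally show ?thesis .
  qed
  \<comment> \<open>With this rate the parallelogram bound for consecutive members is at most
    \<open>4 * (1 / 16) ^ k\<close>, as the summability lemma demands.\<close>
  have "\<exists>f\<in>K. ?q f < c + (1 / 16) ^ k" for k :: nat
  proof -
    have "Inf (?q ` K) < c + (1 / 16) ^ k" by (simp add: c_def)
    from cInf_lessD[OF ne this] show ?thesis by blast
  qed
  then obtain f where f: "\<And>k. f k \<in> K" "\<And>k. ?q (f k) < c + (1 / 16) ^ k" by metis
  have [measurable]: "f k \<in> borel_measurable Leb01" for k by (rule Kmeas[OF f(1)])
  have diff_sq: "integrable Leb01 (\<lambda>x. (g x - h x)\<^sup>2)" if "g \<in> K" "h \<in> K" for g h
  proof -
    have "(\<lambda>x. (g x - h x)\<^sup>2) = (\<lambda>x. (g x)\<^sup>2 + (h x)\<^sup>2 - 2 * (g x * h x))"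
      by (auto simp: power2_eq_square algebra_simps)
    then show ?thesis using Ksq that Kprod[OF that] by simp
  qed
  have "AE x in Leb01. summable (\<lambda>k. \<bar>f (Suc k) x - f k x\<bar>)"
  proof (rule AE_summable_of_integral_bound)
    fix k
    show "(\<integral>x. (f (Suc k) x - f k x)\<^sup>2 \<partial>Leb01) \<le> 4 * (1 / 16) ^ k"
      using par[OF f(1) f(1), of "Suc k" k] f(2)[of k] f(2)[of "Suc k"]
        power_decreasing[of k "Suc k" "1/16 :: real"] by linarith
  qed (use f(1) Kint diff_sq in auto)
  then have conv: "AE x in Leb01. (\<lambda>k. f k x) \<longlonglongrightarrow> lim (\<lambda>k. f k x)"
  proof eventually_elim
    case (elim x)
    then have "summable (\<lambda>k. f (Suc k) x - f k x)" by (rule summable_rabs_cancel)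
    then have "convergent (\<lambda>n. \<Sum>k<n. f (Suc k) x - f k x)"
      by (simp add: summable_iff_convergent)
    moreover have "(\<Sum>k<n. f (Suc k) x - f k x) = f n x - f 0 x" for n
      by (rule sum_lessThan_telescope)
    ultimately have "convergent (\<lambda>n. f n x - f 0 x)" by simp
    then have "convergent (\<lambda>n. (f n x - f 0 x) + f 0 x)" by (intro convergent_add convergent_const)
    then show ?case by (simp add: convergent_LIMSEQ_iff)
  qed
  define g where "g x = lim (\<lambda>k. f k x)" for x
  have [measurable]: "g \<in> borel_measurable Leb01"
    unfolding g_def by (rule borel_measurable_lim_metric) measurable
  have conv: "AE x in Leb01. (\<lambda>k. f k x) \<longlonglongrightarrow> g x" using conv by (simp add: g_def)
  \<comment> \<open>\<open>f k\<close> and its composition with \<open>T\<close> lie in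
    \<open>K\<close> with the same square integral, both nearly minimal; by the parallelogram law
    they are close.\<close>
  have "AE x in Leb01. summable (\<lambda>k. \<bar>f k x - f k (T x)\<bar>)"
  proof (rule AE_summable_of_integral_bound)
    fix k
    have "?q (\<lambda>x. f k (T x)) = ?q (f k)"
      using integral_MPT[OF T, of "\<lambda>x. (f k x)\<^sup>2"] by simp
    then show "(\<integral>x. (f k x - f k (T x))\<^sup>2 \<partial>Leb01) \<le> 4 * (1 / 16) ^ k"
      using par[OF f(1) Kshift[OF f(1)], of k k] f(2)[of k] by linarith
  qed (use f(1) Kint Kshift diff_sq in auto)
  with conv AE_MPT[OF T conv] have inv: "AE x in Leb01. g (T x) = g x"
  proof eventually_elim
    case (elim x)
    then have "(\<lambda>k. f k x - f k (T x)) \<longlonglongrightarrow> 0"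
      using summable_LIMSEQ_zero[of "\<lambda>k. \<bar>f k x - f k (T x)\<bar>"] by (simp add: tendsto_rabs_zero_iff)
    moreover have "(\<lambda>k. f k x - f k (T x)) \<longlonglongrightarrow> g x - g (T x)"
      using elim by (intro tendsto_diff) auto
    ultimately show ?case using LIMSEQ_unique by fastforce
  qed
  have f1: "AE x in Leb01. norm (f k x) \<le> 1" for k using Kabs[OF f(1)] by simp
  have one: "integrable Leb01 (\<lambda>_. 1 :: real)" by simp
  have g_int: "integrable Leb01 g"
    by (rule integrable_dominated_convergence[OF _ _ one conv f1]) simp_all
  have "(\<lambda>k. \<integral>x. f k x \<partial>Leb01) \<longlonglongrightarrow> (\<integral>x. g x \<partial>Leb01)"
    by (rule integral_dominated_convergence[OF _ _ one conv f1]) simp_all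
  then have "(\<integral>x. g x \<partial>Leb01) = mu D"
    using KD[OF f(1)] by (simp add: LIMSEQ_const_iff)
  note g = g_int this
  \<comment> \<open>By ergodicity this invariant set is null or full. Either way \<open>g\<close>
    stays almost everywhere on one side of its own mean, hence equals it.\<close>
  define A where "A = {x \<in> I01. g x > mu D}"
  have A: "A \<in> sets Leb01"
  proof -
    have "{x \<in> space Leb01. g x > mu D} \<in> sets Leb01" by measurable
    then show ?thesis by (simp add: A_def)
  qed
  have "emeasure Leb01 (sym_diff (T -` A \<inter> I01) A) = 0"
  proof -
    have "AE x in Leb01. x \<notin> sym_diff (T -` A \<inter> I01) A"
      using inv MPT_in[OF T] by (auto simp: A_def)
    moreover have "sym_diff (T -` A \<inter> I01) A \<in> sets Leb01"
      by (intro sets.Un sets.Diff A MPT_vimage_sets[OF T A])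
    ultimately have "sym_diff (T -` A \<inter> I01) A \<in> null_sets Leb01"
      by (simp only: AE_iff_null_sets)
    then show ?thesis by (rule null_setsD1)
  qed
  with erg A have "emeasure Leb01 A = 0 \<or> emeasure Leb01 A = 1" unfolding ergodic_def by blast
  then have "AE x in Leb01. g x = mu D"
  proof
    assume "emeasure Leb01 A = 0"
    then have "AE x in Leb01. x \<notin> A" using A by (intro AE_not_in) auto
    then have le: "AE x in Leb01. 0 \<le> mu D - g x"
      using AE_space by eventually_elim (auto simp: A_def)
    have "(\<integral>x. mu D - g x \<partial>Leb01) = 0" using g by (simp add: Leb.prob_space)
    then have "AE x in Leb01. mu D - g x = 0"
      using g le by (subst (asm) integral_nonneg_eq_0_iff_AE) auto
    then show ?thesis by eventually_elim simp
  next
    assume "emeasure Leb01 A = 1"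
    then have "AE x in Leb01. x \<in> A" using A by (simp add: Leb.AE_in_set_eq_1 measure_def)
    then have le: "AE x in Leb01. 0 \<le> g x - mu D"
      by eventually_elim (auto simp: A_def)
    have "(\<integral>x. g x - mu D \<partial>Leb01) = 0" using g by (simp add: Leb.prob_space)
    then have "AE x in Leb01. g x - mu D = 0"
      using g le by (subst (asm) integral_nonneg_eq_0_iff_AE) auto
    then show ?thesis by eventually_elim simp
  qed
  then have "(\<integral>x. (g x)\<^sup>2 \<partial>Leb01) = (\<integral>x. (mu D)\<^sup>2 \<partial>Leb01)"
    by (intro integral_cong_AE) auto
  moreover have "(\<lambda>k. ?q (f k)) \<longlonglongrightarrow> ?q g"
  proof (rule integral_dominated_convergence[OF _ _ one])
    show "AE x in Leb01. (\<lambda>k. (f k x)\<^sup>2) \<longlonglongrightarrow> (g x)\<^sup>2"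
      using conv by eventually_elim (rule tendsto_power)
    show "AE x in Leb01. norm ((f k x)\<^sup>2) \<le> 1" for k
      using Kabs[OF f(1)] by (simp add: abs_square_le_1)
  qed simp_all
  ultimately have "(\<lambda>k. ?q (f k)) \<longlonglongrightarrow> (mu D)\<^sup>2" by (simp add: Leb.prob_space)
  then have "\<forall>\<^sub>F k in sequentially. ?q (f k) < (mu D)\<^sup>2 + e"
    using e by (intro order_tendstoD(2)) auto
  then obtain k where k: "?q (f k) < (mu D)\<^sup>2 + e" by (auto simp: eventually_sequentially)
  obtain n w where "weights n w" "f k = orbit_avg T D n w" using f(1)[of k] by (auto simp: K_def)
  then show ?thesis using k energy_eq[OF T D, of n w] by metis
qed

subsection \<open>Ergodicity is a countable intersection of open conditions\<close>

lemma energy_less_open: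
  assumes D: "D \<in> sets Leb01"
  shows "openin weak_top {T \<in> MPT. \<exists>n w. weights n w \<and> energy T D n w < r}"
proof (rule openin_weak_topI)
  fix T assume "T \<in> {T \<in> MPT. \<exists>n w. weights n w \<and> energy T D n w < r}"
  then obtain n w where T: "T \<in> MPT" and w: "weights n w" "energy T D n w < r" by blast
  have "((\<lambda>S. energy S D n w) \<longlongrightarrow> energy T D n w) (nhdsin weak_top T)"
    unfolding energy_def
    by (intro tendsto_sum tendsto_mult tendsto_const tendsto_mu_funpow_vimage_Int T D)
  then have "\<forall>\<^sub>F S in nhdsin weak_top T. energy S D n w < r" by (rule order_tendstoD) (rule w)
  with eventually_MPT show "\<forall>\<^sub>F S in nhdsin weak_top T. S \<in> {T \<in> MPT. \<exists>n w. weights n w \<and> energy T D n w < r}"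
    by eventually_elim (use w in blast)
qed blast

text \<open>Let \<open>D\<close> be a union of cells close to an invariant set \<open>A\<close>. All
  preimages of \<open>D\<close> are close to \<open>A\<close>, so each of their intersections has
  measure about \<open>mu A\<close>, and so has every convex combination of these measures. Small
  energy puts such a combination near \<open>(mu A)\<^sup>2\<close>, whence
  \<open>mu A \<le> (mu A)\<^sup>2\<close>.\<close>

lemma ergodic_of_small_energy:
  assumes T: "T \<in> MPT"
    and small: "\<And>J C k. finite C \<Longrightarrow>
      \<exists>n w. weights n w \<and> energy T (cells J C) n w < (mu (cells J C))\<^sup>2 + 1 / real (Suc k)"
  shows "ergodic T"
  unfolding ergodic_def
proof (intro ballI impI)
  fix A assume A: "A \<in> sets Leb01" and inv: "emeasure Leb01 (sym_diff (T -` A \<inter> I01) A) = 0"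
  let ?V = "\<lambda>B i. (T ^^ i) -` B \<inter> I01"
  have V: "?V B i \<in> sets Leb01" if "B \<in> sets Leb01" for B i
    by (rule MPT_vimage_sets[OF MPT_funpow[OF T] that])
  have inv1: "sym_dist (T -` A \<inter> I01) A = 0" using inv by (simp add: sym_dist_def measure_def)
  have invi: "sym_dist (?V A i) A = 0" for i
  proof (induction i)
    case 0
    have "?V A 0 = A" using sets_Leb01_subset[OF A] by auto
    then show ?case by simp
  next
    case (Suc i)
    have "?V A (Suc i) = T -` (?V A i) \<inter> I01" using MPT_in[OF T] by (auto simp: funpow_swap1)
    then have "sym_dist (?V A (Suc i)) (T -` A \<inter> I01) = sym_dist (?V A i) A"
      using sym_dist_vimage[OF T V[OF A] A] by metis
    then show ?case
      using sym_dist_triangle[OF V[OF A] MPT_vimage_sets[OF T A] A, of "Suc i"] Suc inv1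
        sym_dist_nonneg[of "?V A (Suc i)" A] by linarith
  qed
  have bound: "mu A - (mu A)\<^sup>2 < 6 / real (Suc k)" for k
  proof -
    define e where "e = 1 / real (Suc k)"
    have e: "0 < e" "e \<le> 1" by (auto simp: e_def)
    obtain J C0 where C0: "sym_dist A (cells J C0) < e" using approximate_by_cells[OF A e(1)] by blast
    \<comment> \<open>Finite index sets keep the family of tested sets countable.\<close>
    have "cells J C0 = cells J (C0 \<inter> {..<2 ^ J})" using cell_less by (auto simp: cells_def)
    then obtain C where C: "finite C" "sym_dist A (cells J C) < e" using C0 by (metis finite_Int finite_lessThan)
    let ?D = "cells J C"
    obtain n w where w: "weights n w" "energy T ?D n w < (mu ?D)\<^sup>2 + e"
      using small[OF C(1), of J k] unfolding e_def by blast
    have VD: "sym_dist (?V ?D i) A < e" for i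
      using sym_dist_triangle[OF V[OF cells_sets] V[OF A] A, of i J C i] invi[of i]
        sym_dist_vimage[OF MPT_funpow[OF T] cells_sets A, of i J C] C(2) sym_dist_commute[of A ?D] by linarith
    have low: "mu A - 2 * e \<le> mu ((T ^^ i) -` ?D \<inter> (T ^^ j) -` ?D \<inter> I01)" for i j
    proof -
      have eq: "(T ^^ i) -` ?D \<inter> (T ^^ j) -` ?D \<inter> I01 = ?V ?D i \<inter> ?V ?D j" by auto
      have "sym_dist (?V ?D i \<inter> ?V ?D j) (A \<inter> A) \<le> sym_dist (?V ?D i) A + sym_dist (?V ?D j) A"
        by (intro sym_dist_Int V A cells_sets)
      moreover have "\<bar>mu (?V ?D i \<inter> ?V ?D j) - mu A\<bar> \<le> sym_dist (?V ?D i \<inter> ?V ?D j) A"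
        by (intro mu_diff_le_sym_dist sets.Int V A cells_sets)
      ultimately show ?thesis unfolding eq using VD[of i] VD[of j] by simp
    qed
    have "mu A - 2 * e = (\<Sum>i<n. \<Sum>j<n. w i * w j * (mu A - 2 * e))"
    proof -
      have "(\<Sum>i<n. \<Sum>j<n. w i * w j * (mu A - 2 * e)) = (\<Sum>i<n. w i) * (\<Sum>j<n. w j) * (mu A - 2 * e)"
        unfolding sum_product by (simp add: sum_distrib_right)
      then show ?thesis using w(1) by (simp add: weights_def)
    qed
    also have "\<dots> \<le> energy T ?D n w"
      unfolding energy_def using w(1) by (intro sum_mono mult_left_mono low) (auto simp: weights_def)
    finally have "mu A - 2 * e < (mu ?D)\<^sup>2 + e" using w(2) by simp
    moreover have "(mu ?D)\<^sup>2 \<le> (mu A + e)\<^sup>2"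
      using mu_diff_le_sym_dist[OF A, of ?D] C(2) by (intro power_mono) auto
    moreover have "(mu A + e)\<^sup>2 \<le> (mu A)\<^sup>2 + 3 * e"
    proof -
      have "mu A * e \<le> 1 * e" using e by (intro mult_right_mono Leb.prob_le_1) auto
      moreover have "e * e \<le> 1 * e" using e by (intro mult_right_mono) auto
      ultimately show ?thesis by (simp add: power2_eq_square algebra_simps)
    qed
    \<comment> \<open>Six errors: two from the intersections, one from the energy, three from
      replacing \<open>mu ?D\<close> by \<open>mu A\<close> inside the square.\<close>
    ultimately have "mu A - (mu A)\<^sup>2 < 6 * e" by linarith
    then show ?thesis by (simp add: e_def)
  qed
  have "mu A - (mu A)\<^sup>2 \<le> 0"
  proof (rule ccontr)
    assume n: "\<not> mu A - (mu A)\<^sup>2 \<le> 0"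
    then obtain k where "6 / (mu A - (mu A)\<^sup>2) < real (Suc k)"
      by (meson reals_Archimedean2 less_trans of_nat_less_iff lessI)
    with n bound[of k] show False by (simp add: field_simps)
  qed
  then have "mu A * (1 - mu A) \<le> 0" by (simp add: power2_eq_square algebra_simps)
  moreover have "0 \<le> mu A" "mu A \<le> 1" by simp_all
  ultimately have "mu A = 0 \<or> mu A = 1" by (smt (verit) mult_pos_pos)
  then show "emeasure Leb01 A = 0 \<or> emeasure Leb01 A = 1" by (auto simp: Leb.emeasure_eq_measure)
qed

lemma gdelta_ergodic: "gdelta_in weak_top {T \<in> MPT. ergodic T}"
proof -
  let ?E = "\<lambda>(J, C, k). {T \<in> MPT. \<exists>n w. weights n w \<and>
      energy T (cells J C) n w < (mu (cells J C))\<^sup>2 + 1 / real (Suc k)}"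
  let ?I = "(UNIV :: nat set) \<times> {C :: nat set. finite C} \<times> (UNIV :: nat set)"
  have "gdelta_in weak_top (\<Inter> (?E ` ?I))"
  proof (rule gdelta_in_Inter)
    show "countable (?E ` ?I)"
      by (intro countable_image countable_SIGMA countable_Collect_finite countableI_type)
    show "?E ` ?I \<noteq> {}" by blast
    show "gdelta_in weak_top S" if "S \<in> ?E ` ?I" for S
      using that by (auto intro!: open_imp_gdelta_in energy_less_open)
  qed
  moreover have "\<Inter> (?E ` ?I) = {T \<in> MPT. ergodic T}"
  proof
    show "{T \<in> MPT. ergodic T} \<subseteq> \<Inter> (?E ` ?I)" by (auto intro!: ergodic_energy)
    show "\<Inter> (?E ` ?I) \<subseteq> {T \<in> MPT. ergodic T}"
    proof
      fix T assume T: "T \<in> \<Inter> (?E ` ?I)"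
      have E: "T \<in> ?E p" if "p \<in> ?I" for p using T that by (rule INT_D)
      have "T \<in> MPT" using E[of "(0, {}, 0)"] by simp
      moreover from this have "ergodic T"
      proof (rule ergodic_of_small_energy)
        fix J :: nat and C :: "nat set" and k :: nat assume "finite C"
        then show "\<exists>n w. weights n w \<and> energy T (cells J C) n w < (mu (cells J C))\<^sup>2 + 1 / real (Suc k)"
          using E[of "(J, C, k)"] by simp
      qed
      ultimately show "T \<in> {T \<in> MPT. ergodic T}" by blast
    qed
  qed
  ultimately show ?thesis by simp
qed

subsection \<open>The shrinking target property is a countable intersection of open conditions\<close>

text \<open>Together with \<open>cdist_attained\<close> this exhibits \<open>cdist x y\<close> as
  the least distance of \<open>x - y\<close> to an integer, a form in which estimates amount to
  choosing \<open>k\<close>.\<close>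

lemma cdist_le: "cdist x y \<le> \<bar>x - y - of_int k\<bar>"
proof (cases "k \<le> \<lfloor>x - y\<rfloor>")
  case True
  then have "of_int k \<le> (of_int \<lfloor>x - y\<rfloor> :: real)" by simp
  then show ?thesis unfolding cdist_def frac_def by linarith
next
  case False
  then have "of_int \<lfloor>x - y\<rfloor> + 1 \<le> (of_int k :: real)" by linarith
  then show ?thesis unfolding cdist_def frac_def by linarith
qed

lemma cdist_attained: "\<exists>k. cdist x y = \<bar>x - y - of_int k\<bar>"
proof (cases "frac (x - y) \<le> 1 - frac (x - y)")
  case True
  then have "cdist x y = \<bar>x - y - of_int \<lfloor>x - y\<rfloor>\<bar>" unfolding cdist_def frac_def by linarith
  then show ?thesis by blast
next
  case False
  then have "cdist x y = \<bar>x - y - of_int (\<lfloor>x - y\<rfloor> + 1)\<bar>" unfolding cdist_def frac_def by simp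
  then show ?thesis by blast
qed

lemma cdist_lipschitz: "\<bar>cdist x y - cdist x z\<bar> \<le> \<bar>y - z\<bar>"
proof -
  have le: "cdist x u \<le> cdist x v + \<bar>u - v\<bar>" for u v
  proof -
    obtain k where "cdist x v = \<bar>x - v - of_int k\<bar>" using cdist_attained by blast
    then show ?thesis using cdist_le[of x u k] by linarith
  qed
  show ?thesis using le[of y z] le[of z y] by linarith
qed

lemma rotation_MPT: "(\<lambda>x. frac (x - a)) \<in> MPT"
proof (rule MPT_countable_displacement)
  let ?Q = "range (\<lambda>k::int. - a - of_int k)"
  have fr: "frac (frac (x + b) - b) = x" if "x \<in> I01" for x b :: real
    using that by (intro frac_unique_iff[THEN iffD2]) (auto simp: frac_def I01_def)
  have in01: "frac x \<in> I01" for x :: real by (simp add: I01_def frac_ge_0 frac_lt_1)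
  show "bij_betw (\<lambda>x. frac (x - a)) I01 I01"
    by (rule bij_betw_byWitness[where f' = "\<lambda>x. frac (x + a)"])
      (use fr[of _ a] fr[of _ "- a"] in01 in auto)
  show "countable ?Q" by (intro countable_image countableI_type)
  show "frac (x - a) - x \<in> ?Q" for x by (rule image_eqI[of _ _ "\<lfloor>x - a\<rfloor>"]) (auto simp: frac_def)
  show "{x \<in> I01. frac (x - a) - x = q} \<in> sets Leb01" for q
  proof -
    have "{x. x - a - of_int \<lfloor>x - a\<rfloor> - x = q} \<in> sets borel" by measurable
    from sets_Leb01_borel[OF this] show ?thesis
      by (simp add: frac_def Int_def conj_commute)
  qed
qed

lemma cball01_sets [simp]: "cball01 y r \<in> sets Leb01"
proof -
  have "{x. min (x - y - of_int \<lfloor>x - y\<rfloor>) (1 - (x - y - of_int \<lfloor>x - y\<rfloor>)) \<le> r} \<in> sets borel" by measurable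
  from sets_Leb01_borel[OF this] show ?thesis
    by (simp add: cball01_def cdist_def frac_def Int_def conj_commute)
qed

lemma mu_interval_le:
  assumes "a \<le> b" shows "mu ({a..b} \<inter> I01) \<le> b - a"
proof -
  have "mu ({a..b} \<inter> I01) = measure lebesgue ({a..b} \<inter> I01)"
    by (simp add: measure_def emeasure_Leb01)
  also have "\<dots> \<le> measure lebesgue {a..b}"
    by (rule measure_mono_fmeasurable) auto
  also have "\<dots> = b - a" using assms by simp
  finally show ?thesis .
qed

text \<open>Let \<open>h = \<bar>y - z\<bar>\<close>. A point in just one of the balls has distance
  within \<open>h\<close> of \<open>r\<close> from \<open>y\<close>. Rotated by \<open>y\<close>, it
  lies in one of two intervals of length \<open>2 * h\<close>, around \<open>r\<close> and around
  \<open>1 - r\<close>.\<close>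

lemma sym_dist_cball01: "sym_dist (cball01 y r) (cball01 z r) \<le> 4 * \<bar>y - z\<bar>"
proof -
  let ?h = "\<bar>y - z\<bar>"
  let ?A = "({r - ?h..r + ?h} \<inter> I01) \<union> ({1 - r - ?h..1 - r + ?h} \<inter> I01)"
  have A: "?A \<in> sets Leb01" by (intro sets.Un sets_Leb01_borel) auto
  have "sym_diff (cball01 y r) (cball01 z r) \<subseteq> (\<lambda>x. frac (x - y)) -` ?A \<inter> I01"
  proof
    fix x assume x: "x \<in> sym_diff (cball01 y r) (cball01 z r)"
    then have "\<bar>cdist x y - r\<bar> \<le> ?h" using cdist_lipschitz[of x y z] by (auto simp: cball01_def)
    then have "frac (x - y) \<in> ?A"
      by (auto simp: cdist_def min_def I01_def frac_ge_0 frac_lt_1 split: if_splits)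
    then show "x \<in> (\<lambda>x. frac (x - y)) -` ?A \<inter> I01" using x by (auto simp: cball01_def)
  qed
  then have "sym_dist (cball01 y r) (cball01 z r) \<le> mu ((\<lambda>x. frac (x - y)) -` ?A \<inter> I01)"
    unfolding sym_dist_def
    by (intro Leb.finite_measure_mono MPT_vimage_sets[OF rotation_MPT A])
  also have "\<dots> = mu ?A" by (rule MPT_vimage_mu[OF rotation_MPT A])
  also have "\<dots> \<le> mu ({r - ?h..r + ?h} \<inter> I01) + mu ({1 - r - ?h..1 - r + ?h} \<inter> I01)"
    by (intro measure_Un_le sets_Leb01_borel) auto
  also have "\<dots> \<le> 2 * ?h + 2 * ?h"
    using mu_interval_le[of "r - ?h" "r + ?h"] mu_interval_le[of "1 - r - ?h" "1 - r + ?h"] by simp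
  finally show ?thesis by simp
qed

section \<open>Measures of finite unions of hitting sets, averaged over the centre\<close>

definition hits :: "(nat \<Rightarrow> real) \<Rightarrow> (real \<Rightarrow> real) \<Rightarrow> nat \<Rightarrow> real \<Rightarrow> real set" where
  "hits eps T n y = (T ^^ n) -` cball01 y (eps n) \<inter> I01"

lemma hits_sets: "T \<in> MPT \<Longrightarrow> hits eps T n y \<in> sets Leb01"
  unfolding hits_def by (intro MPT_vimage_sets MPT_funpow cball01_sets)

lemma sym_dist_hits: "T \<in> MPT \<Longrightarrow> sym_dist (hits eps T n y) (hits eps T n z) \<le> 4 * \<bar>y - z\<bar>"
  unfolding hits_def by (subst sym_dist_vimage) (auto intro: MPT_funpow sym_dist_cball01)

definition hit_measure :: "(nat \<Rightarrow> real) \<Rightarrow> (real \<Rightarrow> real) \<Rightarrow> nat \<Rightarrow> nat \<Rightarrow> real \<Rightarrow> real" where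
  "hit_measure eps T N M y = mu (\<Union>n\<in>{N..M}. hits eps T n y)"

lemma hit_measure_diff:
  assumes "S \<in> MPT" "T \<in> MPT"
  shows "\<bar>hit_measure eps S N M y - hit_measure eps T N M z\<bar>
    \<le> (\<Sum>n\<in>{N..M}. sym_dist (hits eps S n y) (hits eps T n z))"
  unfolding hit_measure_def
  using mu_diff_le_sym_dist sym_dist_UN_le[of "{N..M}" "\<lambda>n. hits eps S n y" "\<lambda>n. hits eps T n z"]
    hits_sets[OF assms(1)] hits_sets[OF assms(2)]
  by (smt (verit) finite_atLeastAtMost sets.finite_UN)

text \<open>Each hitting set moves by at most \<open>4 * \<bar>y - z\<bar>\<close> when the centre
  moves, so the function is Lipschitz in the centre.\<close>

lemma hit_measure_measurable:
  assumes T: "T \<in> MPT" shows "hit_measure eps T N M \<in> borel_measurable Leb01"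
proof -
  let ?L = "4 * real (card {N..M})"
  have lip: "\<bar>hit_measure eps T N M y - hit_measure eps T N M z\<bar> \<le> ?L * \<bar>y - z\<bar>" for y z
  proof -
    have "\<bar>hit_measure eps T N M y - hit_measure eps T N M z\<bar> \<le> (\<Sum>n\<in>{N..M}. 4 * \<bar>y - z\<bar>)"
      using hit_measure_diff[OF T T, of eps N M y z] sym_dist_hits[OF T, of eps _ y z]
      by (meson order_trans sum_mono)
    then show ?thesis by simp
  qed
  have "?L-lipschitz_on UNIV (hit_measure eps T N M)"
    by (rule lipschitz_onI) (use lip in \<open>auto simp: dist_real_def\<close>)
  then have "continuous_on UNIV (hit_measure eps T N M)" by (rule lipschitz_on_continuous_on)
  then have "hit_measure eps T N M \<in> borel_measurable lebesgue"
    by (intro measurable_completion) (simp add: borel_measurable_continuous_onI)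
  then show ?thesis unfolding Leb01_def by (rule measurable_restrict_space1)
qed

lemma hit_measure_bounds: "0 \<le> hit_measure eps T N M y" "hit_measure eps T N M y \<le> 1"
  by (simp_all add: hit_measure_def)

lemma hit_measure_integrable:
  assumes T: "T \<in> MPT" shows "integrable Leb01 (hit_measure eps T N M)"
  by (rule Leb.integrable_const_bound[where B = 1])
    (use hit_measure_bounds hit_measure_measurable[OF T] in auto)

text \<open>A weak neighbourhood controls finitely many balls only, so the centres are restricted to
  a grid of mesh \<open>1 / q\<close>. Moving a centre to the grid costs \<open>4 / q\<close> for
  \<open>S\<close> and again for \<open>T\<close>, comparing \<open>S\<close> with \<open>T\<close>
  there costs \<open>1 / q\<close>: hence \<open>9 / q\<close> per time.\<close>

lemma hit_measure_uniform:
  assumes T: "T \<in> MPT" and e: "e > 0"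
  shows "\<forall>\<^sub>F S in nhdsin weak_top T. \<forall>y\<in>I01. \<bar>hit_measure eps S N M y - hit_measure eps T N M y\<bar> \<le> e"
proof -
  let ?c = "real (card {N..M})"
  obtain q0 :: nat where "9 * ?c / e < real q0" using reals_Archimedean2 by blast
  then obtain q :: nat where q: "9 * ?c / e < real q" "q > 0"
    by (intro that[of "Suc q0"]) auto
  let ?Y = "(\<lambda>i. real i / real q) ` {..<q}"
  have "\<forall>\<^sub>F S in nhdsin weak_top T. \<forall>n\<in>{N..M}. \<forall>z\<in>?Y. sym_dist (hits eps S n z) (hits eps T n z) < 1 / q"
    unfolding hits_def using q
    by (intro eventually_ball_finite ballI order_tendstoD(2)[OF tendsto_sym_dist_funpow_vimage[OF T cball01_sets]]) auto
  with eventually_MPT show ?thesis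
  proof eventually_elim
    case (elim S)
    show ?case
    proof
      fix y assume y: "y \<in> I01"
      define z where "z = real (nat \<lfloor>q * y\<rfloor>) / real q"
      have fl: "0 \<le> \<lfloor>q * y\<rfloor>" "\<lfloor>q * y\<rfloor> < int q"
        using y q(2) by (auto simp: I01_def floor_less_iff)
      have z: "z \<in> ?Y" unfolding z_def using fl by (intro imageI) (simp add: nat_less_iff)
      have "y - z = (q * y - of_int \<lfloor>q * y\<rfloor>) / q"
        using q(2) fl(1) by (simp add: z_def field_simps)
      then have "\<bar>y - z\<bar> = \<bar>q * y - of_int \<lfloor>q * y\<rfloor>\<bar> / q" by (simp add: abs_divide)
      also have "\<dots> \<le> 1 / q" by (intro divide_right_mono) linarith+
      finally have yz: "\<bar>y - z\<bar> \<le> 1 / q" .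
      have "sym_dist (hits eps S n y) (hits eps T n y) \<le> 9 / q" if n: "n \<in> {N..M}" for n
      proof -
        have 1: "sym_dist (hits eps S n y) (hits eps T n y)
          \<le> sym_dist (hits eps S n y) (hits eps S n z) + sym_dist (hits eps S n z) (hits eps T n y)"
          by (intro sym_dist_triangle hits_sets T elim)
        have 2: "sym_dist (hits eps S n z) (hits eps T n y)
          \<le> sym_dist (hits eps S n z) (hits eps T n z) + sym_dist (hits eps T n z) (hits eps T n y)"
          by (intro sym_dist_triangle hits_sets T elim)
        have 3: "sym_dist (hits eps S n z) (hits eps T n z) < 1 / q" using elim(2) n z by blast
        have 4: "sym_dist (hits eps S n y) (hits eps S n z) \<le> 4 * (1 / q)"
          using sym_dist_hits[OF elim(1), of eps n y z] yz by (meson mult_left_mono order_trans zero_le_numeral)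
        have 5: "sym_dist (hits eps T n z) (hits eps T n y) \<le> 4 * (1 / q)"
          using sym_dist_hits[OF T, of eps n y z] yz
          by (metis sym_dist_commute mult_left_mono order_trans zero_le_numeral)
        have "a \<le> 9 * d" if "a \<le> b + c" "c \<le> f + g" "f < d" "b \<le> 4 * d" "g \<le> 4 * d"
          for a b c d f g :: real using that by linarith
        from this[OF 1 2 3 4 5] show ?thesis by simp
      qed
      then have "(\<Sum>n\<in>{N..M}. sym_dist (hits eps S n y) (hits eps T n y)) \<le> (\<Sum>n\<in>{N..M}. 9 / q)"
        by (rule sum_mono)
      also have "\<dots> \<le> e" using q e by (simp add: field_simps)
      finally show "\<bar>hit_measure eps S N M y - hit_measure eps T N M y\<bar> \<le> e"
        using hit_measure_diff[OF elim(1) T, of eps N M y y] by linarith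
    qed
  qed
qed

lemma hit_integral_open:
  "openin weak_top {T \<in> MPT. \<exists>M. r < (\<integral>y. hit_measure eps T N M y \<partial>Leb01)}"
proof (rule openin_weak_topI)
  fix T assume "T \<in> {T \<in> MPT. \<exists>M. r < (\<integral>y. hit_measure eps T N M y \<partial>Leb01)}"
  then obtain M where T: "T \<in> MPT" and M: "r < (\<integral>y. hit_measure eps T N M y \<partial>Leb01)" by blast
  define e where "e = ((\<integral>y. hit_measure eps T N M y \<partial>Leb01) - r) / 2"
  have e: "e > 0" using M by (simp add: e_def)
  from eventually_MPT hit_measure_uniform[OF T e, of eps N M]
  show "\<forall>\<^sub>F S in nhdsin weak_top T. S \<in> {T \<in> MPT. \<exists>M. r < (\<integral>y. hit_measure eps T N M y \<partial>Leb01)}"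
  proof eventually_elim
    case (elim S)
    have "(\<integral>y. hit_measure eps T N M y - e \<partial>Leb01) \<le> (\<integral>y. hit_measure eps S N M y \<partial>Leb01)"
      using elim hit_measure_integrable[OF T] hit_measure_integrable[OF elim(1)]
      by (intro integral_mono) (auto simp: abs_le_iff)
    then have "(\<integral>y. hit_measure eps T N M y \<partial>Leb01) - e \<le> (\<integral>y. hit_measure eps S N M y \<partial>Leb01)"
      using hit_measure_integrable[OF T] by (simp add: Leb.prob_space)
    then have "r < (\<integral>y. hit_measure eps S N M y \<partial>Leb01)" using M unfolding e_def by (simp add: field_simps)
    then show ?case using elim(1) by blast
  qed
qed blast

text \<open>A function with values in \<open>[0, 1]\<close> equals 1 almost everywhere iff its
  integral is 1. The finite windows increase to the whole tail, so by dominated convergence an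
  integral near 1 is already reached at a finite \<open>M\<close>. The quantifier over
  \<open>y\<close> has thus become an integral.\<close>

lemma AE_hits_iff:
  assumes T: "T \<in> MPT"
  shows "(AE y in Leb01. \<forall>N\<ge>1. emeasure Leb01 (\<Union>n\<in>{N..}. hits eps T n y) = 1) \<longleftrightarrow>
    (\<forall>N\<ge>1. \<forall>k. \<exists>M. 1 - 1 / real (Suc k) < (\<integral>y. hit_measure eps T N M y \<partial>Leb01))"
proof -
  define u where "u N y = mu (\<Union>n\<in>{N..}. hits eps T n y)" for N y
  have lim: "(\<lambda>M. hit_measure eps T N M y) \<longlonglongrightarrow> u N y" for N y
  proof -
    have "(\<Union>M. \<Union>n\<in>{N..M}. hits eps T n y) = (\<Union>n\<in>{N..}. hits eps T n y)"
      by (auto, meson atLeastAtMost_iff order_refl)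
    moreover have "(\<lambda>M. mu (\<Union>n\<in>{N..M}. hits eps T n y)) \<longlonglongrightarrow> mu (\<Union>M. \<Union>n\<in>{N..M}. hits eps T n y)"
      using hits_sets[OF T] by (intro Leb.finite_Lim_measure_incseq) (fastforce simp: incseq_def)+
    ultimately show ?thesis by (simp add: u_def hit_measure_def)
  qed
  note hm[measurable] = hit_measure_measurable[OF T]
  have um[measurable]: "u N \<in> borel_measurable Leb01" for N
    by (rule borel_measurable_LIMSEQ_metric[OF hm lim])
  have u01: "0 \<le> u N y" "u N y \<le> 1" for N y by (simp_all add: u_def)
  have uint: "integrable Leb01 (u N)" for N
    by (rule Leb.integrable_const_bound[where B = 1]) (use u01 in auto)
  have mono: "hit_measure eps T N M y \<le> u N y" for N M y
    unfolding hit_measure_def u_def using hits_sets[OF T]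
    by (intro Leb.finite_measure_mono sets.countable_UN') auto
  have ilim: "(\<lambda>M. \<integral>y. hit_measure eps T N M y \<partial>Leb01) \<longlonglongrightarrow> (\<integral>y. u N y \<partial>Leb01)" for N
    by (rule integral_dominated_convergence[where w = "\<lambda>_. 1"])
      (use lim hit_measure_bounds in auto)
  have one: "(AE y in Leb01. u N y = 1) \<longleftrightarrow> (\<integral>y. u N y \<partial>Leb01) = 1" for N
  proof -
    have "(\<integral>y. 1 - u N y \<partial>Leb01) = 0 \<longleftrightarrow> (AE y in Leb01. 1 - u N y = 0)"
      using uint u01 by (intro integral_nonneg_eq_0_iff_AE) auto
    moreover have "(\<integral>y. 1 - u N y \<partial>Leb01) = 1 - (\<integral>y. u N y \<partial>Leb01)"
      using uint by (simp add: Leb.prob_space)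
    ultimately show ?thesis by (auto elim: eventually_mono)
  qed
  have iff: "(\<integral>y. u N y \<partial>Leb01) = 1 \<longleftrightarrow>
      (\<forall>k. \<exists>M. 1 - 1 / real (Suc k) < (\<integral>y. hit_measure eps T N M y \<partial>Leb01))" for N
  proof
    assume "(\<integral>y. u N y \<partial>Leb01) = 1"
    then have l: "(\<lambda>M. \<integral>y. hit_measure eps T N M y \<partial>Leb01) \<longlonglongrightarrow> 1" using ilim[of N] by simp
    show "\<forall>k. \<exists>M. 1 - 1 / real (Suc k) < (\<integral>y. hit_measure eps T N M y \<partial>Leb01)"
    proof
      fix k
      have "\<forall>\<^sub>F M in sequentially. 1 - 1 / real (Suc k) < (\<integral>y. hit_measure eps T N M y \<partial>Leb01)"
        by (rule order_tendstoD(1)[OF l]) simp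
      then show "\<exists>M. 1 - 1 / real (Suc k) < (\<integral>y. hit_measure eps T N M y \<partial>Leb01)"
        by (auto simp: eventually_sequentially)
    qed
  next
    assume a: "\<forall>k. \<exists>M. 1 - 1 / real (Suc k) < (\<integral>y. hit_measure eps T N M y \<partial>Leb01)"
    have low: "1 - 1 / real (Suc k) < (\<integral>y. u N y \<partial>Leb01)" for k
    proof -
      obtain M where "1 - 1 / real (Suc k) < (\<integral>y. hit_measure eps T N M y \<partial>Leb01)" using a by blast
      also have "\<dots> \<le> (\<integral>y. u N y \<partial>Leb01)"
        using mono uint hit_measure_integrable[OF T] by (intro integral_mono) auto
      finally show ?thesis .
    qed
    have "1 \<le> (\<integral>y. u N y \<partial>Leb01)"
    proof (rule field_le_epsilon)
      fix e :: real assume "e > 0"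
      then obtain k where "inverse (real (Suc k)) < e" using reals_Archimedean by blast
      then show "1 \<le> (\<integral>y. u N y \<partial>Leb01) + e" using low[of k] by (simp add: inverse_eq_divide)
    qed
    moreover have "(\<integral>y. u N y \<partial>Leb01) \<le> (\<integral>y. 1 \<partial>Leb01)"
      using uint u01 by (intro integral_mono) auto
    ultimately show "(\<integral>y. u N y \<partial>Leb01) = 1" by (simp add: Leb.prob_space)
  qed
  have "(AE y in Leb01. \<forall>N\<ge>1. emeasure Leb01 (\<Union>n\<in>{N..}. hits eps T n y) = 1) \<longleftrightarrow>
      (AE y in Leb01. \<forall>N. 1 \<le> N \<longrightarrow> u N y = 1)"
    by (simp add: u_def Leb.emeasure_eq_measure)
  also have "\<dots> \<longleftrightarrow> (\<forall>N\<ge>1. AE y in Leb01. u N y = 1)"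
    unfolding AE_all_countable by simp
  finally show ?thesis using one iff by simp
qed

lemma gdelta_hits:
  "gdelta_in weak_top {T \<in> MPT. AE y in Leb01. \<forall>N\<ge>1. emeasure Leb01 (\<Union>n\<in>{N..}. hits eps T n y) = 1}"
proof -
  let ?H = "\<lambda>(N, k). {T \<in> MPT. \<exists>M. 1 - 1 / real (Suc k) < (\<integral>y. hit_measure eps T N M y \<partial>Leb01)}"
  let ?I = "{1 :: nat ..} \<times> (UNIV :: nat set)"
  have "gdelta_in weak_top (\<Inter> (?H ` ?I))"
  proof (rule gdelta_in_Inter)
    show "countable (?H ` ?I)" by (intro countable_image countableI_type)
    show "?H ` ?I \<noteq> {}" by auto
    show "gdelta_in weak_top S" if "S \<in> ?H ` ?I" for S
      using that by (auto intro!: open_imp_gdelta_in hit_integral_open)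
  qed
  moreover have "\<Inter> (?H ` ?I) = {T \<in> MPT. AE y in Leb01. \<forall>N\<ge>1. emeasure Leb01 (\<Union>n\<in>{N..}. hits eps T n y) = 1}"
  proof (intro set_eqI iffI)
    fix T assume T: "T \<in> \<Inter> (?H ` ?I)"
    then have H: "T \<in> ?H (N, k)" if "N \<ge> 1" for N k using that by blast
    from H[of 1 0] have T: "T \<in> MPT" by simp
    have "\<forall>N\<ge>1. \<forall>k. \<exists>M. 1 - 1 / real (Suc k) < (\<integral>y. hit_measure eps T N M y \<partial>Leb01)" using H by auto
    then show "T \<in> {T \<in> MPT. AE y in Leb01. \<forall>N\<ge>1. emeasure Leb01 (\<Union>n\<in>{N..}. hits eps T n y) = 1}"
      using AE_hits_iff[OF T] T by blast
  next
    fix T assume T: "T \<in> {T \<in> MPT. AE y in Leb01. \<forall>N\<ge>1. emeasure Leb01 (\<Union>n\<in>{N..}. hits eps T n y) = 1}"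
    then have "\<forall>N\<ge>1. \<forall>k. \<exists>M. 1 - 1 / real (Suc k) < (\<integral>y. hit_measure eps T N M y \<partial>Leb01)"
      using AE_hits_iff[of T eps] by blast
    then show "T \<in> \<Inter> (?H ` ?I)" using T by simp
  qed
  ultimately show ?thesis by simp
qed

subsection \<open>A Borel--Cantelli lemma\<close>

text \<open>Chebyshev's inequality: the number of events that occur has variance at most its mean.\<close>

lemma (in prob_space) prob_UN_eq_1_of_neg_correlated:
  fixes F :: "nat \<Rightarrow> 'a set"
  assumes F: "\<And>i. F i \<in> events"
    and corr: "\<And>i j. i \<noteq> j \<Longrightarrow> prob (F i \<inter> F j) \<le> prob (F i) * prob (F j)"
    and div: "\<not> summable (\<lambda>i. prob (F i))"
  shows "prob (\<Union>i\<in>{N..}. F i) = 1"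
proof (rule ccontr)
  let ?U = "\<Union>i\<in>{N..}. F i"
  assume ne: "prob ?U \<noteq> 1"
  have U: "?U \<in> events" using F by (intro sets.countable_UN') auto
  \<comment> \<open>The mass missed by all events; it will bound every partial sum by
    \<open>1 / q\<close>.\<close>
  define q where "q = prob (space M - ?U)"
  have q: "q > 0"
    using ne prob_compl[OF U] prob_le_1[of ?U] by (simp add: q_def less_le)
  have bound: "(\<Sum>i\<in>{N..<m}. prob (F i)) \<le> 1 / q" for m
  proof -
    let ?I = "{N..<m}"
    let ?s = "\<Sum>i\<in>?I. prob (F i)"
    let ?S = "\<lambda>x. \<Sum>i\<in>?I. indicator (F i) x :: real"
    have s0: "0 \<le> ?s" by (intro sum_nonneg) auto
    have Sint: "integrable M ?S" "(\<integral>x. ?S x \<partial>M) = ?s"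
      using F by (simp_all add: emeasure_eq_measure)
    have sq: "(?S x)\<^sup>2 = (\<Sum>i\<in>?I. \<Sum>j\<in>?I. indicator (F i \<inter> F j) x)" for x
      unfolding power2_eq_square sum_product by (simp add: indicator_inter_arith)
    have Sqint: "integrable M (\<lambda>x. (?S x)\<^sup>2)" "(\<integral>x. (?S x)\<^sup>2 \<partial>M) = (\<Sum>i\<in>?I. \<Sum>j\<in>?I. prob (F i \<inter> F j))"
      unfolding sq using F by (simp_all add: emeasure_eq_measure)
    have "(\<Sum>i\<in>?I. \<Sum>j\<in>?I. prob (F i \<inter> F j))
        \<le> (\<Sum>i\<in>?I. \<Sum>j\<in>?I. prob (F i) * prob (F j) + (if i = j then prob (F i) else 0))"
      using corr by (intro sum_mono) auto
    also have "\<dots> = ?s\<^sup>2 + ?s"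
      by (simp add: sum.distrib power2_eq_square sum_product)
    finally have Sq: "(\<integral>x. (?S x)\<^sup>2 \<partial>M) \<le> ?s\<^sup>2 + ?s" by (simp add: Sqint)
    \<comment> \<open>Where all events are missed the count is 0 and deviates from its mean
      \<open>?s\<close> by all of \<open>?s\<close>. So the variance is at least
      \<open>?s\<^sup>2 * q\<close>, while it is at most \<open>?s\<close>.\<close>
    have "?s\<^sup>2 * q = (\<integral>x. ?s\<^sup>2 * indicator (space M - ?U) x \<partial>M)"
      using U by (simp add: q_def)
    also have "\<dots> \<le> (\<integral>x. (?S x)\<^sup>2 - 2 * ?s * ?S x + ?s\<^sup>2 \<partial>M)"
    proof (rule integral_mono)
      show "integrable M (\<lambda>x. ?s\<^sup>2 * indicator (space M - ?U) x)"
        using U by (simp add: emeasure_eq_measure)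
      show "integrable M (\<lambda>x. (?S x)\<^sup>2 - 2 * ?s * ?S x + ?s\<^sup>2)"
        using Sint(1) Sqint(1) by (intro Bochner_Integration.integrable_add
          Bochner_Integration.integrable_diff integrable_mult_right) auto
      fix x assume "x \<in> space M"
      have sqd: "(?S x)\<^sup>2 - 2 * ?s * ?S x + ?s\<^sup>2 = (?S x - ?s)\<^sup>2" by (simp add: power2_diff)
      show "?s\<^sup>2 * indicator (space M - ?U) x \<le> (?S x)\<^sup>2 - 2 * ?s * ?S x + ?s\<^sup>2"
      proof (cases "x \<in> ?U")
        case True
        then show ?thesis unfolding sqd by simp
      next
        case False
        then have "?S x = 0" by (intro sum.neutral) auto
        then show ?thesis by (simp add: indicator_def)
      qed
    qed
    also have "\<dots> = (\<integral>x. (?S x)\<^sup>2 \<partial>M) - 2 * ?s * ?s + ?s\<^sup>2"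
      using Sint Sqint(1) by (simp add: prob_space del: integral_sum)
    also have "\<dots> \<le> ?s" using Sq by (simp add: power2_eq_square)
    finally have le: "?s\<^sup>2 * q \<le> ?s" .
    show ?thesis
    proof (cases "?s = 0")
      case False
      then have "?s * q \<le> 1" using le s0 by (simp add: power2_eq_square)
      then show ?thesis using q by (simp add: field_simps)
    qed (use q in simp)
  qed
  have "summable (\<lambda>i. prob (F i))"
  proof (rule summableI_nonneg_bounded)
    show "(\<Sum>i<m. prob (F i)) \<le> (\<Sum>i<N. prob (F i)) + 1 / q" for m
    proof -
      have "(\<Sum>i<m. prob (F i)) \<le> (\<Sum>i\<in>{..<N} \<union> {N..<m}. prob (F i))"
        by (intro sum_mono2) auto
      also have "\<dots> = (\<Sum>i<N. prob (F i)) + (\<Sum>i\<in>{N..<m}. prob (F i))"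
        by (rule sum.union_disjoint) auto
      finally show ?thesis using bound[of m] by linarith
    qed
  qed simp
  with div show False by simp
qed

subsection \<open>The dyadic odometer\<close>

text \<open>A countable group containing all displacements of the odometer and of the towers, and at
  the same time their exceptional null set.\<close>

definition dyadics :: "real set" where
  "dyadics = {x. \<exists>(n::nat) (k::int). x = of_int k / 2 ^ n}"

lemma dyadicsI: "of_int k / 2 ^ n \<in> dyadics"
  by (auto simp: dyadics_def)

lemma dyadics_countable: "countable dyadics"
proof -
  have "dyadics = (\<lambda>(n::nat, k::int). of_int k / 2 ^ n) ` UNIV" by (auto simp: dyadics_def)
  then show ?thesis by (metis countable_image countableI_type)
qed

lemma dyadics_add: "x \<in> dyadics \<Longrightarrow> y \<in> dyadics \<Longrightarrow> x + y \<in> dyadics"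
proof -
  assume "x \<in> dyadics" "y \<in> dyadics"
  then obtain n k m l where xy: "x = of_int k / 2 ^ n" "y = of_int l / 2 ^ m" by (auto simp: dyadics_def)
  have "x + y = of_int (k * 2 ^ m + l * 2 ^ n) / 2 ^ (n + m)"
    unfolding xy by (simp add: power_add add_frac_eq)
  then show ?thesis by (metis dyadicsI)
qed

lemma dyadics_uminus: "x \<in> dyadics \<Longrightarrow> - x \<in> dyadics"
  unfolding dyadics_def by clarsimp (metis minus_divide_left of_int_minus)

lemma dyadics_diff: "x \<in> dyadics \<Longrightarrow> y \<in> dyadics \<Longrightarrow> x - y \<in> dyadics"
  using dyadics_add[OF _ dyadics_uminus, of x y] by simp

lemma dyadics_nat [simp]: "real n \<in> dyadics"
  using dyadicsI[of "int n" 0] by simp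

lemma dyadics_scale_iff: "2 ^ j * x \<in> dyadics \<longleftrightarrow> x \<in> dyadics"
proof
  assume "2 ^ j * x \<in> dyadics"
  then obtain n k where "2 ^ j * x = of_int k / 2 ^ n" by (auto simp: dyadics_def)
  then have "x = of_int k / 2 ^ (n + j)" by (simp add: power_add field_simps)
  then show "x \<in> dyadics" by (metis dyadicsI)
next
  assume "x \<in> dyadics"
  then obtain n k where "x = of_int k / 2 ^ n" by (auto simp: dyadics_def)
  then have "2 ^ j * x = of_int (2 ^ j * k) / 2 ^ n" by simp
  then show "2 ^ j * x \<in> dyadics" by (metis dyadicsI)
qed

lemma half_power_Suc: "1 / (2::real) ^ Suc k = 1 / 2 ^ k / 2" "0 < 1 / (2::real) ^ k"
  by simp_all

text \<open>For \<open>u \<in> I01\<close>, the number of ones at the start of the binary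
  expansion.\<close>

definition lead_ones :: "real \<Rightarrow> nat" where
  "lead_ones u = (LEAST k. u < 1 - 1 / 2 ^ Suc k)"

text \<open>The von Neumann adding machine: add one to the first digit and carry to the right. If
  \<open>k\<close> ones lead, they become zeros and the zero after them becomes a one, a change of
  \<open>- (1 - 1 / 2 ^ k) + 1 / 2 ^ Suc k = 3 / 2 ^ Suc k - 1\<close>.\<close>

definition odo :: "real \<Rightarrow> real" where
  "odo u = u - 1 + 3 / 2 ^ Suc (lead_ones u)"

lemma lead_ones_eqI: "1 - 1 / 2 ^ k \<le> u \<Longrightarrow> u < 1 - 1 / 2 ^ Suc k \<Longrightarrow> lead_ones u = k"
  unfolding lead_ones_def
proof (rule Least_equality)
  fix l assume a: "1 - 1 / 2 ^ k \<le> u" "u < 1 - 1 / 2 ^ Suc l"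
  show "k \<le> l"
  proof (rule ccontr)
    assume "\<not> k \<le> l"
    then have "(2::real) ^ Suc l \<le> 2 ^ k" by (intro power_increasing) auto
    then have "1 / 2 ^ k \<le> 1 / (2::real) ^ Suc l" by (intro divide_left_mono) auto
    then show False using a by linarith
  qed
qed

lemma lead_ones_bounds:
  assumes "u \<in> I01"
  shows "1 - 1 / 2 ^ lead_ones u \<le> u" "u < 1 - 1 / 2 ^ Suc (lead_ones u)"
proof -
  obtain k where "(1 / 2) ^ k < 1 - u" using real_arch_pow_inv[of "1 - u" "1 / 2"] assms by (auto simp: I01_def)
  then have "1 / 2 ^ k < 1 - u" by (simp add: power_divide)
  moreover have "u < 1 - h / 2" if "h < 1 - u" "0 < h" for h using that by linarith
  ultimately have "u < 1 - 1 / 2 ^ Suc k" unfolding half_power_Suc(1) using half_power_Suc(2) by blast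
  then show "u < 1 - 1 / 2 ^ Suc (lead_ones u)" unfolding lead_ones_def by (rule LeastI)
  show "1 - 1 / 2 ^ lead_ones u \<le> u"
  proof (cases "lead_ones u")
    case 0
    then show ?thesis using assms by (simp add: I01_def)
  next
    case (Suc l)
    then have "\<not> u < 1 - 1 / 2 ^ Suc l"
      using not_less_Least[of l "\<lambda>k. u < 1 - 1 / 2 ^ Suc k"] by (simp add: lead_ones_def)
    then show ?thesis using Suc by simp
  qed
qed

text \<open>The number of leading ones becomes the number of leading zeros of the image, so it can
  be recovered from \<open>odo u\<close>; injectivity rests on this.\<close>

lemma odo_bounds:
  assumes "u \<in> I01"
  shows "1 / 2 ^ Suc (lead_ones u) \<le> odo u" "odo u < 1 / 2 ^ lead_ones u"
proof -
  have o: "odo u = u - 1 + 3 * (1 / 2 ^ lead_ones u) / 2" by (simp add: odo_def)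
  have *: "h / 2 \<le> u - 1 + 3 * h / 2 \<and> u - 1 + 3 * h / 2 < h" if "1 - h \<le> u" "u < 1 - h / 2" for h
    using that by linarith
  show "1 / 2 ^ Suc (lead_ones u) \<le> odo u" "odo u < 1 / 2 ^ lead_ones u"
    using *[OF lead_ones_bounds(1)[OF assms] lead_ones_bounds(2)[OF assms, unfolded half_power_Suc(1)]]
    unfolding o half_power_Suc(1) by blast+
qed

lemma odo_in: "u \<in> I01 \<Longrightarrow> odo u \<in> I01"
proof -
  assume "u \<in> I01"
  note b = odo_bounds[OF this]
  have "1 / 2 ^ lead_ones u \<le> (1::real)" by simp
  moreover have "0 < 1 / (2::real) ^ Suc (lead_ones u)" by simp
  ultimately show ?thesis using b unfolding I01_def by (simp only: atLeastLessThan_iff) linarith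
qed

lemma odo_inj: "inj_on odo I01"
proof (rule inj_onI)
  fix u v assume u: "u \<in> I01" and v: "v \<in> I01" and eq: "odo u = odo v"
  have le: "lead_ones x \<le> lead_ones y" if "x \<in> I01" "y \<in> I01" "odo x = odo y" for x y
  proof (rule ccontr)
    assume "\<not> ?thesis"
    then have "(2::real) ^ Suc (lead_ones y) \<le> 2 ^ lead_ones x" by (intro power_increasing) auto
    then have "1 / 2 ^ lead_ones x \<le> 1 / (2::real) ^ Suc (lead_ones y)" by (intro divide_left_mono) auto
    then show False using odo_bounds[OF that(1)] odo_bounds[OF that(2)] that(3) by linarith
  qed
  have "lead_ones u = lead_ones v" using le[OF u v eq] le[OF v u eq[symmetric]] by simp
  then show "u = v" using eq by (simp add: odo_def)
qed

text \<open>The number of leading zeros of \<open>w\<close> tells which translation to undo. The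
  point 0 would need the preimage with all digits one, which is 1 and lies outside
  \<open>I01\<close>.\<close>

lemma odo_surj:
  assumes w: "0 < w" "w < 1"
  shows "\<exists>u\<in>I01. odo u = w"
proof -
  define k where "k = (LEAST k. 1 / 2 ^ Suc k \<le> w)"
  obtain l where "(1 / 2) ^ l < w" using real_arch_pow_inv[of w "1 / 2"] w by auto
  then have "1 / 2 ^ l < w" by (simp add: power_divide)
  moreover have "h / 2 \<le> w" if "h < w" "0 < h" for h using that by linarith
  ultimately have "1 / 2 ^ Suc l \<le> w" unfolding half_power_Suc(1) using half_power_Suc(2) by blast
  then have k1: "1 / 2 ^ Suc k \<le> w" unfolding k_def by (rule LeastI)
  have k2: "w < 1 / 2 ^ k"
  proof (cases k)
    case 0
    then show ?thesis using w by simp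
  next
    case (Suc m)
    then have "\<not> 1 / 2 ^ Suc m \<le> w"
      using not_less_Least[of m "\<lambda>k. 1 / 2 ^ Suc k \<le> w"] by (simp add: k_def)
    then show ?thesis using Suc by simp
  qed
  define u where "u = w + 1 - 3 / 2 ^ Suc k"
  have "lead_ones u = k"
    by (rule lead_ones_eqI) (use k1 k2 in \<open>auto simp: u_def field_simps\<close>)
  then have "odo u = w" by (simp add: odo_def u_def)
  moreover have "u \<in> I01"
  proof -
    have "1 - 1 / 2 ^ k \<le> u" "u < 1 - 1 / 2 ^ Suc k" using k1 k2 by (auto simp: u_def field_simps)
    moreover have "1 / 2 ^ k \<le> (1::real)" "0 < 1 / (2::real) ^ Suc k" by simp_all
    ultimately show ?thesis unfolding I01_def by (simp only: atLeastLessThan_iff) linarith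
  qed
  ultimately show ?thesis by blast
qed

lemma odo_low: "u \<in> I01 \<Longrightarrow> u < 1 / 2 \<Longrightarrow> odo u = u + 1 / 2"
proof -
  assume "u \<in> I01" "u < 1 / 2"
  then have "lead_ones u = 0" by (intro lead_ones_eqI) (auto simp: I01_def)
  then show ?thesis by (simp add: odo_def)
qed

text \<open>A leading one turns into a zero and the carry applies the odometer to the remaining
  digits. This recursion is the one along which \<open>revbin\<close> is defined.\<close>

lemma odo_high:
  assumes "u \<in> I01" "1 / 2 \<le> u"
  shows "odo u = odo (2 * u - 1) / 2"
proof -
  have "2 * u - 1 \<in> I01" using assms by (auto simp: I01_def)
  note b = lead_ones_bounds[OF this]
  have "lead_ones u = Suc (lead_ones (2 * u - 1))"
    by (rule lead_ones_eqI) (use b in \<open>auto simp: field_simps\<close>)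
  then show ?thesis by (simp add: odo_def field_simps)
qed

lemma odo_diff_dyadic: "odo u - u \<in> dyadics"
proof -
  have "odo u - u = of_int 3 / 2 ^ Suc (lead_ones u) - real 1" by (simp add: odo_def)
  then show ?thesis by (metis dyadics_diff dyadicsI dyadics_nat)
qed

text \<open>The number whose binary digits are the first \<open>k\<close> digits of \<open>u\<close>, least significant first.\<close>

primrec revbin :: "nat \<Rightarrow> real \<Rightarrow> nat" where
  "revbin 0 u = 0"
| "revbin (Suc k) u = (if u < 1 / 2 then 0 else 1) + 2 * revbin k (frac (2 * u))"

lemma revbin_less: "revbin k u < 2 ^ k"
proof (induction k arbitrary: u)
  case (Suc k)
  from Suc[of "frac (2 * u)"] show ?case by simp
qed simp

lemma frac_in_I01 [simp]: "frac x \<in> I01"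
  by (simp add: I01_def frac_ge_0 frac_lt_1)

text \<open>With the first digit least significant, truncation is reduction modulo a power of two;
  values at different levels are therefore compatible.\<close>

lemma revbin_mod: "revbin (k + l) u mod 2 ^ k = revbin k u"
proof (induction k arbitrary: u)
  case (Suc k)
  let ?b = "if u < 1 / 2 then 0 else 1 :: nat"
  have "revbin (Suc k + l) u mod 2 ^ Suc k = (?b + 2 * revbin (k + l) (frac (2 * u))) mod (2 * 2 ^ k)" by simp
  also have "\<dots> = ?b + 2 * (revbin (k + l) (frac (2 * u)) mod 2 ^ k)"
    by (simp add: mod_mult2_eq)
  finally show ?case using Suc by simp
qed simp

lemma frac_double:
  assumes "u \<in> I01"
  shows "u < 1 / 2 \<Longrightarrow> frac (2 * u) = 2 * u" "\<not> u < 1 / 2 \<Longrightarrow> frac (2 * u) = 2 * u - 1"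
  using assms by (auto simp: I01_def frac_unique_iff)

text \<open>The odometer is addition of one on the 2-adic integers: \<open>odo_low\<close> is the
  case without carry, \<open>odo_high\<close> passes the carry to the next digit.\<close>

lemma revbin_odo: "u \<in> I01 \<Longrightarrow> revbin k (odo u) = (revbin k u + 1) mod 2 ^ k"
proof (induction k arbitrary: u)
  case (Suc k)
  show ?case
  proof (cases "u < 1 / 2")
    case True
    have o: "odo u = u + 1 / 2" by (rule odo_low[OF Suc.prems True])
    have f: "frac (2 * u + 1) = 2 * u"
      using Suc.prems True by (auto simp: I01_def frac_unique_iff)
    have "2 * revbin k (2 * u) + 1 < 2 ^ Suc k" using revbin_less[of k "2 * u"] by simp
    then show ?thesis
      using Suc.prems True f frac_double(1)[OF Suc.prems True] by (simp add: o I01_def algebra_simps)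
  next
    case False
    let ?t = "2 * u - 1"
    have t: "?t \<in> I01" using Suc.prems False by (auto simp: I01_def)
    have o: "odo u = odo ?t / 2" using odo_high[OF Suc.prems] False by simp
    have ot: "odo ?t \<in> I01" by (rule odo_in[OF t])
    then have "odo ?t / 2 < 1 / 2" "frac (2 * (odo ?t / 2)) = odo ?t"
      by (auto simp: I01_def frac_unique_iff)
    then have "revbin (Suc k) (odo u) = 2 * revbin k (odo ?t)" by (simp add: o)
    also have "\<dots> = 2 * ((revbin k ?t + 1) mod 2 ^ k)" using Suc.IH[OF t] by simp
    also have "\<dots> = (2 * (revbin k ?t + 1)) mod (2 * 2 ^ k)" by (simp only: mod_mult_mult1)
    finally show ?thesis using False frac_double(2)[OF Suc.prems False] by simp
  qed
qed simp

lemma cell_Suc: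
  assumes "u \<in> I01"
  shows "cell (Suc k) u = (if u < 1 / 2 then 0 else 1) * 2 ^ k + cell k (frac (2 * u))"
proof -
  let ?b = "if u < 1 / 2 then 0 else 1 :: nat"
  have u: "2 * u = real ?b + frac (2 * u)" using frac_double[OF assms] by auto
  have "2 ^ Suc k * u = 2 ^ k * (2 * u)" by simp
  also have "\<dots> = real (?b * 2 ^ k) + 2 ^ k * frac (2 * u)" by (subst u) (simp add: algebra_simps)
  finally have e: "2 ^ Suc k * u = real (?b * 2 ^ k) + 2 ^ k * frac (2 * u)" .
  show ?thesis
    by (rule cell_eqI) (use cell_bounds[of "frac (2 * u)" k] e in auto)
qed

text \<open>Both numbers record the first \<open>k\<close> binary digits, in opposite
  orders.\<close>

lemma revbin_eq_iff: "u \<in> I01 \<Longrightarrow> v \<in> I01 \<Longrightarrow> revbin k u = revbin k v \<longleftrightarrow> cell k u = cell k v"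
proof (induction k arbitrary: u v)
  case 0
  then show ?case using cell_less[of u 0] cell_less[of v 0] by simp
next
  case (Suc k)
  let ?b = "\<lambda>u::real. if u < 1 / 2 then 0 else 1 :: nat"
  have IH: "revbin k (frac (2 * u)) = revbin k (frac (2 * v)) \<longleftrightarrow> cell k (frac (2 * u)) = cell k (frac (2 * v))"
    by (rule Suc.IH) simp_all
  have "revbin (Suc k) u = revbin (Suc k) v \<longleftrightarrow> ?b u = ?b v \<and> revbin k (frac (2 * u)) = revbin k (frac (2 * v))"
  proof -
    have "b + 2 * r = c + 2 * t \<longleftrightarrow> b = c \<and> r = t" if "b < 2" "c < 2" for b c r t :: nat
      using that by presburger
    then show ?thesis unfolding revbin.simps by simp
  qed
  moreover have "cell (Suc k) u = cell (Suc k) v \<longleftrightarrow> ?b u = ?b v \<and> cell k (frac (2 * u)) = cell k (frac (2 * v))"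
    unfolding cell_Suc[OF Suc.prems(1)] cell_Suc[OF Suc.prems(2)]
    using cell_less[of "frac (2 * u)" k] cell_less[of "frac (2 * v)" k] by auto
  ultimately show ?case using IH by simp
qed

subsection \<open>Towers over the odometer\<close>

lemma odo_dyadic_iff: "odo u \<in> dyadics \<longleftrightarrow> u \<in> dyadics"
  using dyadics_add[OF odo_diff_dyadic[of u], of u] dyadics_diff[OF _ odo_diff_dyadic[of u], of "odo u"]
  by (auto simp: algebra_simps)

definition cell_offset :: "nat \<Rightarrow> real \<Rightarrow> real" where
  "cell_offset J x = 2 ^ J * x - real (cell J x)"

lemma cell_offset_in: "x \<in> I01 \<Longrightarrow> cell_offset J x \<in> I01"
  using cell_bounds[of x J] by (auto simp: cell_offset_def I01_def)

lemma cell_offset_dyadic_iff: "cell_offset J x \<in> dyadics \<longleftrightarrow> x \<in> dyadics"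
proof -
  have "cell_offset J x \<in> dyadics \<longleftrightarrow> 2 ^ J * x \<in> dyadics"
    using dyadics_add[OF _ dyadics_nat, of "cell_offset J x" "cell J x"]
      dyadics_diff[OF _ dyadics_nat, of "2 ^ J * x" "cell J x"]
    by (auto simp: cell_offset_def)
  then show ?thesis by (simp add: dyadics_scale_iff)
qed

lemma cell_offset_eqI:
  assumes "cell J x = cell J y" "cell_offset J x = cell_offset J y" shows "x = y"
  using assms by (simp add: cell_offset_def)

lemma point_of_cell_offset:
  assumes "c < 2 ^ J" "t \<in> I01"
  shows "(real c + t) / 2 ^ J \<in> I01" "cell J ((real c + t) / 2 ^ J) = c"
    "cell_offset J ((real c + t) / 2 ^ J) = t"
proof -
  have "real (c + 1) \<le> real (2 ^ J)" using assms(1) by (intro of_nat_mono) simp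
  then have "real c + t < 2 ^ J" using assms(2) by (simp add: I01_def)
  then show "(real c + t) / 2 ^ J \<in> I01" using assms(2) by (simp add: I01_def)
  show c: "cell J ((real c + t) / 2 ^ J) = c" using assms(2) by (intro cell_eqI) (auto simp: I01_def)
  show "cell_offset J ((real c + t) / 2 ^ J) = t" by (simp add: cell_offset_def c)
qed

lemma cell_add: "x \<in> I01 \<Longrightarrow> cell (J + k) x = cell J x * 2 ^ k + cell k (cell_offset J x)"
proof (rule cell_eqI)
  assume x: "x \<in> I01"
  have e: "2 ^ (J + k) * x = real (cell J x) * 2 ^ k + 2 ^ k * cell_offset J x"
    by (simp add: cell_offset_def power_add algebra_simps)
  show "real (cell J x * 2 ^ k + cell k (cell_offset J x)) \<le> 2 ^ (J + k) * x"
    "2 ^ (J + k) * x < real (cell J x * 2 ^ k + cell k (cell_offset J x)) + 1"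
    unfolding e using cell_bounds[OF cell_offset_in[OF x], of k J] by auto
qed

text \<open>The tower of height \<open>2 ^ J\<close> over the odometer: \<open>a\<close> lists the time at which a cell is visited,
  \<open>b\<close> the cell visited at a given time. Dyadic points are left fixed because the odometer
  itself misses \<open>0\<close>.\<close>

locale dyadic_tower =
  fixes J :: nat and a b :: "nat \<Rightarrow> nat"
  assumes a_less: "i < 2 ^ J \<Longrightarrow> a i < 2 ^ J" and b_less: "i < 2 ^ J \<Longrightarrow> b i < 2 ^ J"
    and b_a: "i < 2 ^ J \<Longrightarrow> b (a i) = i" and a_b: "i < 2 ^ J \<Longrightarrow> a (b i) = i"
begin

text \<open>The odometer acts only on the step from time \<open>2 ^ J - 1\<close> back to time 0, as
  the carry out of the digits that encode the time.\<close>

definition tower :: "real \<Rightarrow> real" where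
  "tower x = (if x \<in> dyadics then x else
     (real (b ((a (cell J x) + 1) mod 2 ^ J)) +
       (if a (cell J x) = 2 ^ J - 1 then odo (cell_offset J x) else cell_offset J x)) / 2 ^ J)"

lemma tower_dyadic: "x \<in> dyadics \<Longrightarrow> tower x = x"
  by (simp add: tower_def)

lemma tower_nondyadic:
  assumes "x \<in> I01" "x \<notin> dyadics"
  shows "tower x \<in> I01" "cell J (tower x) = b ((a (cell J x) + 1) mod 2 ^ J)"
    "cell_offset J (tower x) = (if a (cell J x) = 2 ^ J - 1 then odo (cell_offset J x) else cell_offset J x)"
    "tower x \<notin> dyadics"
proof -
  let ?t = "if a (cell J x) = 2 ^ J - 1 then odo (cell_offset J x) else cell_offset J x"
  have t: "?t \<in> I01" using cell_offset_in[OF assms(1)] odo_in by simp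
  have c: "b ((a (cell J x) + 1) mod 2 ^ J) < 2 ^ J" by (intro b_less) simp
  note p = point_of_cell_offset[OF c t]
  have e: "tower x = (real (b ((a (cell J x) + 1) mod 2 ^ J)) + ?t) / 2 ^ J"
    using assms(2) by (simp add: tower_def)
  show "tower x \<in> I01" unfolding e by (rule p(1))
  show "cell J (tower x) = b ((a (cell J x) + 1) mod 2 ^ J)" unfolding e by (rule p(2))
  show o: "cell_offset J (tower x) = ?t" unfolding e by (rule p(3))
  have "?t \<notin> dyadics" using assms(2) by (simp add: odo_dyadic_iff cell_offset_dyadic_iff)
  then show "tower x \<notin> dyadics" using cell_offset_dyadic_iff[of J "tower x"] o by simp
qed

lemma tower_inj: "inj_on tower I01"
proof (rule inj_onI)
  fix x y assume x: "x \<in> I01" and y: "y \<in> I01" and eq: "tower x = tower y"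
  show "x = y"
  proof (cases "x \<in> dyadics \<or> y \<in> dyadics")
    case True
    then have "x \<in> dyadics \<and> y \<in> dyadics"
      using eq tower_dyadic tower_nondyadic(4) x y by metis
    then show ?thesis using eq tower_dyadic by simp
  next
    case False
    note tx = tower_nondyadic[OF x] and ty = tower_nondyadic[OF y]
    have ax: "a (cell J x) < 2 ^ J" "a (cell J y) < 2 ^ J" using a_less cell_less x y by auto
    have "b ((a (cell J x) + 1) mod 2 ^ J) = b ((a (cell J y) + 1) mod 2 ^ J)"
      using tx(2) ty(2) False eq by simp
    then have "(a (cell J x) + 1) mod 2 ^ J = (a (cell J y) + 1) mod 2 ^ J"
      using a_b by (metis mod_less_divisor zero_less_numeral zero_less_power)
    then have "a (cell J x) = a (cell J y)" using ax by (auto simp: mod_Suc split: if_splits)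
    then have c: "cell J x = cell J y" using b_a cell_less x y by metis
    have "cell_offset J x = cell_offset J y"
      using tx(3) ty(3) False eq c inj_onD[OF odo_inj _ cell_offset_in[OF x] cell_offset_in[OF y]]
      by (auto split: if_splits)
    with c show ?thesis by (rule cell_offset_eqI)
  qed
qed

lemma tower_surj: "y \<in> I01 \<Longrightarrow> \<exists>x\<in>I01. tower x = y"
proof (cases "y \<in> dyadics")
  case True
  moreover assume "y \<in> I01"
  ultimately show ?thesis using tower_dyadic by blast
next
  case False
  assume y: "y \<in> I01"
  let ?N = "2 ^ J :: nat"
  let ?c = "cell J y" and ?t = "cell_offset J y"
  have t: "?t \<in> I01" by (rule cell_offset_in[OF y])
  have tn: "?t \<notin> dyadics" using False by (simp add: cell_offset_dyadic_iff)
  then have "?t \<noteq> 0" using dyadics_nat[of 0] by (metis of_nat_0)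
  then have t0: "0 < ?t" "?t < 1" using t by (auto simp: I01_def)
  \<comment> \<open>The time before \<open>a ?c\<close>, cyclically; adding \<open>?N - 1\<close>
    avoids truncated subtraction.\<close>
  define s where "s = (a ?c + (?N - 1)) mod ?N"
  have ac: "a ?c < ?N" by (intro a_less cell_less y)
  have s: "s < ?N" by (simp add: s_def)
  have "(s + 1) mod ?N = (a ?c + (?N - 1) + 1) mod ?N" unfolding s_def by (rule mod_add_left_eq)
  also have "a ?c + (?N - 1) + 1 = a ?c + ?N" by simp
  finally have s1: "(s + 1) mod ?N = a ?c" using ac by simp
  obtain u where u: "u \<in> I01" "(if s = ?N - 1 then odo u else u) = ?t"
    using odo_surj[OF t0] t by (metis (full_types))
  define x where "x = (real (b s) + u) / 2 ^ J"
  note p = point_of_cell_offset[OF b_less[OF s] u(1), folded x_def]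
  have "u \<notin> dyadics" using u(2) tn odo_dyadic_iff[of u] by (auto split: if_splits)
  then have "x \<notin> dyadics" using p(3) cell_offset_dyadic_iff[of J x] by simp
  note tx = tower_nondyadic[OF p(1) this]
  have "tower x = y"
  proof (rule cell_offset_eqI)
    show "cell J (tower x) = ?c" using tx(2) p(2) a_b[OF s] s1 b_a[OF cell_less[OF y]] by simp
    show "cell_offset J (tower x) = ?t" unfolding tx(3) p(2) a_b[OF s] p(3) by (rule u(2))
  qed
  then show ?thesis using p(1) by blast
qed

lemma tower_MPT: "tower \<in> MPT"
proof (rule MPT_countable_displacement[OF _ dyadics_countable])
  have "tower x \<in> I01" if "x \<in> I01" for x
    using that tower_dyadic tower_nondyadic(1) by (cases "x \<in> dyadics") auto
  then show "bij_betw tower I01 I01"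
    unfolding bij_betw_def using tower_inj tower_surj by blast
  show "tower x - x \<in> dyadics" if x: "x \<in> I01" for x
  proof (cases "x \<in> dyadics")
    case True
    then show ?thesis using tower_dyadic dyadics_nat[of 0] by simp
  next
    case False
    have "2 ^ J * (tower x - x) = (real (cell J (tower x)) - real (cell J x)) + (cell_offset J (tower x) - cell_offset J x)"
      by (simp add: cell_offset_def algebra_simps)
    moreover have "cell_offset J (tower x) - cell_offset J x \<in> dyadics"
      using tower_nondyadic(3)[OF x False] odo_diff_dyadic dyadics_nat[of 0] by simp
    ultimately have "2 ^ J * (tower x - x) \<in> dyadics"
      using dyadics_add dyadics_diff dyadics_nat by metis
    then show ?thesis by (simp only: dyadics_scale_iff)
  qed
  show "{x \<in> I01. tower x - x = q} \<in> sets Leb01" for q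
  proof -
    have [measurable]: "cell J \<in> measurable borel (count_space UNIV)" unfolding cell_def by measurable
    have [measurable]: "lead_ones \<in> measurable borel (count_space UNIV)"
      unfolding lead_ones_def by measurable
    have [measurable]: "odo \<in> borel_measurable borel" unfolding odo_def by measurable
    have [measurable]: "cell_offset J \<in> borel_measurable borel" unfolding cell_offset_def by measurable
    have [measurable]: "dyadics \<in> sets borel"
      by (rule sets.countable[OF _ dyadics_countable]) auto
    have "tower \<in> borel_measurable borel" unfolding tower_def by measurable
    then have "{x. tower x - x = q} \<in> sets borel" by measurable
    from sets_Leb01_borel[OF this] show ?thesis by (simp add: Int_def conj_commute)
  qed
qed

text \<open>The coordinate in which \<open>tower\<close> is addition of one: the time of visit
  supplies the \<open>J\<close> low digits, the odometer the \<open>k\<close> digits above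
  them.\<close>

definition phase :: "nat \<Rightarrow> real \<Rightarrow> nat" where
  "phase k x = a (cell J x) + 2 ^ J * revbin k (cell_offset J x)"

lemma phase_less: assumes "x \<in> I01" shows "phase k x < 2 ^ (J + k)"
proof -
  have "phase k x < 2 ^ J * (revbin k (cell_offset J x) + 1)"
    using a_less[OF cell_less[OF assms]] by (simp add: phase_def)
  also have "\<dots> \<le> 2 ^ J * 2 ^ k" using revbin_less[of k "cell_offset J x"] by (intro mult_le_mono2) simp
  finally show ?thesis by (simp add: power_add)
qed

lemma phase_eq_iff:
  assumes x: "x \<in> I01" and y: "y \<in> I01"
  shows "phase k x = phase k y \<longleftrightarrow> cell (J + k) x = cell (J + k) y"
proof -
  have digits: "c + 2 ^ J * r = d + 2 ^ J * s \<longleftrightarrow> c = d \<and> r = s" if "c < 2 ^ J" "d < 2 ^ J" for c d r s :: nat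
  proof
    assume e: "c + 2 ^ J * r = d + 2 ^ J * s"
    have "c = (c + 2 ^ J * r) mod 2 ^ J" "d = (d + 2 ^ J * s) mod 2 ^ J" using that by simp_all
    then have "c = d" using e by metis
    then show "c = d \<and> r = s" using e by simp
  qed simp
  have digits': "c * 2 ^ k + r = d * 2 ^ k + s \<longleftrightarrow> c = d \<and> r = s" if "r < 2 ^ k" "s < 2 ^ k" for c d r s :: nat
  proof
    assume e: "c * 2 ^ k + r = d * 2 ^ k + s"
    have "r = (c * 2 ^ k + r) mod 2 ^ k" "s = (d * 2 ^ k + s) mod 2 ^ k" using that by simp_all
    then have "r = s" using e by metis
    then show "c = d \<and> r = s" using e by simp
  qed simp
  have "a (cell J x) = a (cell J y) \<longleftrightarrow> cell J x = cell J y"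
    using b_a cell_less x y by metis
  moreover have "revbin k (cell_offset J x) = revbin k (cell_offset J y)
      \<longleftrightarrow> cell k (cell_offset J x) = cell k (cell_offset J y)"
    by (intro revbin_eq_iff cell_offset_in x y)
  ultimately show ?thesis
    unfolding phase_def cell_add[OF x] cell_add[OF y]
    using digits a_less cell_less x y digits' cell_offset_in by metis
qed

lemma phase_mod:
  assumes "x \<in> I01" shows "phase (k + l) x mod 2 ^ (J + k) = phase k x"
proof -
  have "phase (k + l) x mod (2 ^ J * 2 ^ k) =
      2 ^ J * (phase (k + l) x div 2 ^ J mod 2 ^ k) + phase (k + l) x mod 2 ^ J"
    by (rule mod_mult2_eq)
  moreover have "phase (k + l) x div 2 ^ J = revbin (k + l) (cell_offset J x)"
    "phase (k + l) x mod 2 ^ J = a (cell J x)"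
    using a_less[OF cell_less[OF assms]] by (simp_all add: phase_def)
  ultimately show ?thesis by (simp add: revbin_mod phase_def power_add)
qed

text \<open>Below the top of the tower only the low digits change. At the top they return to 0 and
  the odometer absorbs the carry by \<open>revbin_odo\<close>.\<close>

lemma phase_tower:
  assumes x: "x \<in> I01" "x \<notin> dyadics"
  shows "phase k (tower x) = (phase k x + 1) mod 2 ^ (J + k)"
proof -
  let ?i = "a (cell J x)" and ?u = "cell_offset J x"
  have i: "?i < 2 ^ J" by (intro a_less cell_less x)
  have c: "a (cell J (tower x)) = (?i + 1) mod 2 ^ J"
    unfolding tower_nondyadic(2)[OF x] by (rule a_b) simp
  show ?thesis
  proof (cases "?i = 2 ^ J - 1")
    case True
    then have "a (cell J (tower x)) = 0" using c by simp
    then have "phase k (tower x) = 2 ^ J * ((revbin k ?u + 1) mod 2 ^ k)"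
      unfolding phase_def tower_nondyadic(3)[OF x] using True revbin_odo[OF cell_offset_in[OF x(1)]] by simp
    also have "\<dots> = (2 ^ J * (revbin k ?u + 1)) mod (2 ^ J * 2 ^ k)" by (simp only: mod_mult_mult1)
    also have "2 ^ J * (revbin k ?u + 1) = phase k x + 1" using True by (simp add: phase_def)
    finally show ?thesis by (simp add: power_add)
  next
    case False
    then have "?i + 1 < 2 ^ J" using i by simp
    then have p: "phase k (tower x) = phase k x + 1"
      unfolding phase_def tower_nondyadic(3)[OF x] c using False by simp
    moreover have "phase k (tower x) < 2 ^ (J + k)" by (rule phase_less[OF tower_nondyadic(1)[OF x]])
    ultimately show ?thesis by simp
  qed
qed

lemma tower_funpow:
  assumes x: "x \<in> I01" "x \<notin> dyadics"
  shows "(tower ^^ n) x \<in> I01 \<and> (tower ^^ n) x \<notin> dyadics \<and>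
    phase k ((tower ^^ n) x) = (phase k x + n) mod 2 ^ (J + k)"
proof (induction n)
  case 0
  then show ?case using x phase_less[OF x(1)] by simp
next
  case (Suc n)
  then have "phase k (tower ((tower ^^ n) x)) = ((phase k x + n) mod 2 ^ (J + k) + 1) mod 2 ^ (J + k)"
    using phase_tower[of "(tower ^^ n) x" k] by simp
  also have "\<dots> = (phase k x + n + 1) mod 2 ^ (J + k)" by (rule mod_add_left_eq)
  finally show ?case using tower_nondyadic(1,4)[of "(tower ^^ n) x"] Suc by simp
qed

end

lemma AE_not_dyadic: "AE x in Leb01. x \<notin> dyadics"
proof (rule AE_I)
  have n: "dyadics \<inter> I01 \<in> null_sets lebesgue"
    by (intro null_sets_completionI countable_imp_null_set_lborel
        countable_subset[OF Int_lower1 dyadics_countable])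
  show "{x \<in> space Leb01. \<not> x \<notin> dyadics} \<subseteq> dyadics \<inter> I01" by auto
  show "emeasure Leb01 (dyadics \<inter> I01) = 0" using n by (simp add: emeasure_Leb01 null_sets_def)
  show "dyadics \<inter> I01 \<in> sets Leb01" using n by (simp add: sets_Leb01_iff null_sets_def)
qed

lemma sym_dist_eq_0_of_AE:
  assumes "A \<in> sets Leb01" "B \<in> sets Leb01" "AE x in Leb01. x \<in> A \<longleftrightarrow> x \<in> B"
  shows "sym_dist A B = 0"
proof -
  have "AE x in Leb01. x \<notin> sym_diff A B" using assms(3) by eventually_elim auto
  moreover have "sym_diff A B \<in> sets Leb01" using assms by (intro sets.Un sets.Diff)
  ultimately have "sym_diff A B \<in> null_sets Leb01" by (simp only: AE_iff_null_sets)
  then show ?thesis by (simp add: sym_dist_def measure_def null_setsD1)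
qed

text \<open>If \<open>L \<le> j\<close>, the window consists of \<open>2 ^ (j - L)\<close> full
  periods of length \<open>2 ^ L\<close>, each with at most \<open>2 ^ i\<close> admissible
  residues. If \<open>L > j\<close>, residues in the window are the numbers themselves, all at least
  \<open>2 ^ Suc i\<close>, and the set is empty.\<close>

lemma card_dyadic_window:
  fixes i j L :: nat
  assumes "i < j" "i < L"
  shows "card {n \<in> {2 ^ j..<(2::nat) ^ Suc j}. n mod 2 ^ L \<in> {2 ^ i..<2 ^ Suc i}} * 2 ^ L \<le> 2 ^ i * (2 ^ j :: nat)"
    (is "card ?W * _ \<le> _")
proof (cases "L \<le> j")
  case True
  let ?f = "\<lambda>n. (n div 2 ^ L, n mod 2 ^ L)"
  let ?P = "{2 ^ (j - L)..<(2 :: nat) ^ Suc (j - L)} \<times> {2 ^ i..<(2 :: nat) ^ Suc i}"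
  have pj: "(2::nat) ^ j = 2 ^ (j - L) * 2 ^ L" using True by (simp add: power_add[symmetric])
  have "?f ` ?W \<subseteq> ?P"
  proof
    fix p assume "p \<in> ?f ` ?W"
    then obtain n where n: "n \<in> ?W" "p = ?f n" by blast
    have "n div 2 ^ L \<ge> 2 ^ (j - L)"
      using n(1) unfolding pj by (simp add: less_eq_div_iff_mult_less_eq)
    moreover have "n div 2 ^ L < 2 ^ Suc (j - L)"
      using n(1) pj by (simp add: div_less_iff_less_mult mult.assoc)
    ultimately show "p \<in> ?P" using n by auto
  qed
  moreover have "inj_on ?f ?W" by (rule inj_onI) (metis div_mult_mod_eq prod.inject)
  ultimately have "card ?W \<le> card ?P" by (intro card_inj_on_le[of ?f]) auto
  also have "\<dots> = 2 ^ (j - L) * 2 ^ i" by (simp add: card_cartesian_product)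
  finally have "card ?W * 2 ^ L \<le> 2 ^ (j - L) * 2 ^ i * 2 ^ L" by (rule mult_le_mono1)
  then show ?thesis by (simp add: pj mult_ac)
next
  case False
  then have "(2::nat) ^ Suc j \<le> 2 ^ L" by (intro power_increasing) auto
  moreover have "(2::nat) ^ Suc i \<le> 2 ^ j" using assms(1) by (intro power_increasing) auto
  ultimately have W: "?W = {}" by (force simp: mod_less)
  show ?thesis unfolding W by simp
qed

section \<open>Equidistribution of phases, ergodicity of towers, and delays\<close>

context dyadic_tower
begin

lemma phase_set_eq_cells:
  "{x \<in> I01. phase k x \<in> R} = cells (J + k) {cell (J + k) x | x. x \<in> I01 \<and> phase k x \<in> R}"
proof (intro set_eqI iffI)
  fix x assume "x \<in> cells (J + k) {cell (J + k) x | x. x \<in> I01 \<and> phase k x \<in> R}"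
  then obtain z where z: "x \<in> I01" "cell (J + k) x = cell (J + k) z" "z \<in> I01" "phase k z \<in> R"
    by (auto simp: cells_def)
  then have "phase k x = phase k z" using phase_eq_iff by blast
  then show "x \<in> {x \<in> I01. phase k x \<in> R}" using z by simp
qed (auto simp: cells_def)

lemma phase_set_sets: "{x \<in> I01. phase k x \<in> R} \<in> sets Leb01"
  unfolding phase_set_eq_cells by simp

text \<open>Outside the dyadic points, \<open>tower\<close> pulls the class of phase
  \<open>Suc n\<close> back to that of phase \<open>n\<close>, there being no wrap-around below the
  period; it also fixes \<open>A\<close> up to a null set and preserves measure.\<close>

lemma mu_invariant_phase_step:
  assumes A: "A \<in> sets Leb01" and inv: "sym_dist (tower -` A \<inter> I01) A = 0" and n: "Suc n < 2 ^ (J + k)"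
  shows "mu (A \<inter> {x \<in> I01. phase k x \<in> {Suc n}}) = mu (A \<inter> {x \<in> I01. phase k x \<in> {n}})"
proof -
  let ?L = "\<lambda>n. {x \<in> I01. phase k x \<in> {n}}"
  note V = MPT_vimage_sets[OF tower_MPT]
  have L: "?L n \<in> sets Leb01" for n by (rule phase_set_sets)
  have "AE x in Leb01. x \<in> tower -` ?L (Suc n) \<inter> I01 \<longleftrightarrow> x \<in> ?L n"
    using AE_not_dyadic AE_space
  proof eventually_elim
    case (elim x)
    then have x: "x \<in> I01" "x \<notin> dyadics" by auto
    have "phase k x < 2 ^ (J + k)" by (rule phase_less[OF x(1)])
    then show ?case
      using tower_nondyadic(1)[OF x] phase_tower[OF x, of k] x(1) n by (auto simp: mod_Suc split: if_splits)
  qed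
  then have s: "sym_dist (tower -` ?L (Suc n) \<inter> I01) (?L n) = 0"
    by (intro sym_dist_eq_0_of_AE V L)
  have "sym_dist ((tower -` A \<inter> I01) \<inter> (tower -` ?L (Suc n) \<inter> I01)) (A \<inter> ?L n) \<le> 0"
    using sym_dist_Int[OF V[OF A] A V[OF L] L, of "Suc n" n] inv s by simp
  moreover have "(tower -` A \<inter> I01) \<inter> (tower -` ?L (Suc n) \<inter> I01) = tower -` (A \<inter> ?L (Suc n)) \<inter> I01" by auto
  ultimately have "\<bar>mu (tower -` (A \<inter> ?L (Suc n)) \<inter> I01) - mu (A \<inter> ?L n)\<bar> \<le> 0"
    using mu_diff_le_sym_dist[OF V[OF sets.Int[OF A L]] sets.Int[OF A L], of "Suc n" n] by simp
  then show ?thesis using MPT_vimage_mu[OF tower_MPT sets.Int[OF A L], of "Suc n"] by simp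
qed

lemma mu_phase_set_sum:
  assumes A: "A \<in> sets Leb01" and R: "finite R"
  shows "mu (A \<inter> {x \<in> I01. phase k x \<in> R}) = (\<Sum>n\<in>R. mu (A \<inter> {x \<in> I01. phase k x \<in> {n}}))"
proof -
  have "A \<inter> {x \<in> I01. phase k x \<in> R} = (\<Union>n\<in>R. A \<inter> {x \<in> I01. phase k x \<in> {n}})" by auto
  moreover have "mu (\<Union>n\<in>R. A \<inter> {x \<in> I01. phase k x \<in> {n}}) = (\<Sum>n\<in>R. mu (A \<inter> {x \<in> I01. phase k x \<in> {n}}))"
  proof (rule Leb.finite_measure_finite_Union[OF R])
    show "(\<lambda>n. A \<inter> {x \<in> I01. phase k x \<in> {n}}) ` R \<subseteq> sets Leb01"
      using sets.Int[OF A phase_set_sets] by blast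
  qed (auto simp: disjoint_family_on_def)
  ultimately show ?thesis by simp
qed

text \<open>An invariant set has the same mass in every phase class. For \<open>A = I01\<close> this
  computes the measure of phase sets; in general it makes invariant sets independent of
  them.\<close>

lemma mu_invariant_phase:
  assumes A: "A \<in> sets Leb01" and inv: "sym_dist (tower -` A \<inter> I01) A = 0" and R: "R \<subseteq> {..<2 ^ (J + k)}"
  shows "mu (A \<inter> {x \<in> I01. phase k x \<in> R}) = real (card R) / 2 ^ (J + k) * mu A"
proof -
  define m where "m n = mu (A \<inter> {x \<in> I01. phase k x \<in> {n}})" for n
  have c: "m n = m 0" if "n < 2 ^ (J + k)" for n
    using that
  proof (induction n)
    case (Suc n)
    then show ?case using mu_invariant_phase_step[OF A inv, of n k] by (simp only: m_def Suc_lessD)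
  qed simp
  have S: "mu (A \<inter> {x \<in> I01. phase k x \<in> S}) = card S * m 0" if "S \<subseteq> {..<2 ^ (J + k)}" for S
  proof -
    have "finite S" using that finite_subset by blast
    then have "mu (A \<inter> {x \<in> I01. phase k x \<in> S}) = (\<Sum>n\<in>S. m n)"
      unfolding m_def by (rule mu_phase_set_sum[OF A])
    also have "\<dots> = (\<Sum>n\<in>S. m 0)"
    proof (rule sum.cong[OF refl])
      fix n assume "n \<in> S"
      with that have "n < 2 ^ (J + k)" by blast
      then show "m n = m 0" by (rule c)
    qed
    finally show ?thesis by simp
  qed
  have "A \<inter> {x \<in> I01. phase k x \<in> {..<2 ^ (J + k)}} = A"
    using phase_less sets_Leb01_subset[OF A] by blast
  then have "mu A = 2 ^ (J + k) * m 0" using S[OF subset_refl] by simp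
  then show ?thesis using S[OF R] by simp
qed

lemma mu_phase:
  assumes "R \<subseteq> {..<2 ^ (J + k)}"
  shows "mu {x \<in> I01. phase k x \<in> R} = real (card R) / 2 ^ (J + k)"
proof -
  have "tower -` I01 \<inter> I01 = I01" using MPT_in[OF tower_MPT] by auto
  moreover have "I01 \<inter> {x \<in> I01. phase k x \<in> R} = {x \<in> I01. phase k x \<in> R}" by auto
  ultimately show ?thesis using mu_invariant_phase[OF I01_sets _ assms] by simp
qed

text \<open>Every union of cells of level at least \<open>J\<close> is a phase set, hence
  independent of an invariant \<open>A\<close>. Approximating \<open>A\<close> by such unions makes
  it independent of itself.\<close>

lemma tower_ergodic: "ergodic tower"
  unfolding ergodic_def
proof (intro ballI impI)
  fix A assume A: "A \<in> sets Leb01" and "emeasure Leb01 (sym_diff (tower -` A \<inter> I01) A) = 0"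
  then have inv: "sym_dist (tower -` A \<inter> I01) A = 0" by (simp add: sym_dist_def measure_def)
  have le: "\<bar>mu A - mu A * mu A\<bar> \<le> e" if e: "e > 0" for e
  proof -
    obtain J0 where J0: "\<And>J'. J' \<ge> J0 \<Longrightarrow> \<exists>C. sym_dist A (cells J' C) < e / 2"
      using approximate_by_cells[OF A, of "e / 2"] e by auto
    then obtain C where C: "sym_dist A (cells (J + J0) C) < e / 2" by fastforce
    let ?D = "cells (J + J0) C"
    let ?R = "phase J0 ` ?D"
    have D: "?D = {x \<in> I01. phase J0 x \<in> ?R}"
    proof (intro set_eqI iffI)
      fix x assume "x \<in> {x \<in> I01. phase J0 x \<in> ?R}"
      then obtain z where z: "x \<in> I01" "phase J0 x = phase J0 z" "z \<in> ?D" by auto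
      then have "cell (J + J0) x = cell (J + J0) z" using phase_eq_iff by (auto simp: cells_def)
      then show "x \<in> ?D" using z by (simp add: cells_def)
    qed (auto simp: cells_def)
    have R: "?R \<subseteq> {..<2 ^ (J + J0)}" using phase_less by (auto simp: cells_def)
    have "mu (A \<inter> ?D) = mu ?D * mu A"
      using mu_invariant_phase[OF A inv R] mu_phase[OF R] D by simp
    moreover have "\<bar>mu (A \<inter> ?D) - mu A\<bar> \<le> sym_dist A ?D"
      using mu_diff_le_sym_dist[OF sets.Int[OF A cells_sets] A, of "J + J0" C]
        sym_dist_Int[OF A A cells_sets A, of "J + J0" C]
      by (simp add: sym_dist_commute)
    moreover have "\<bar>mu ?D * mu A - mu A * mu A\<bar> \<le> sym_dist A ?D"
    proof -
      have "\<bar>mu ?D * mu A - mu A * mu A\<bar> = \<bar>mu ?D - mu A\<bar> * mu A"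
        by (simp add: left_diff_distrib[symmetric] abs_mult)
      also have "\<dots> \<le> \<bar>mu ?D - mu A\<bar> * 1" by (intro mult_left_mono) auto
      also have "\<dots> \<le> sym_dist A ?D"
        using mu_diff_le_sym_dist[OF A cells_sets, of "J + J0" C] by (simp add: abs_minus_commute)
      finally show ?thesis .
    qed
    ultimately show ?thesis using C by linarith
  qed
  have "\<bar>mu A - mu A * mu A\<bar> \<le> 0" by (rule field_le_epsilon) (use le in simp)
  then have "mu A * (1 - mu A) = 0" by (simp add: algebra_simps)
  then show "emeasure Leb01 A = 0 \<or> emeasure Leb01 A = 1" by (auto simp: Leb.emeasure_eq_measure)
qed

text \<open>The time, modulo \<open>2 ^ (J + k)\<close>, that the orbit of \<open>x\<close> needs to reach the cell of \<open>y\<close>.\<close>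

definition delay :: "nat \<Rightarrow> real \<Rightarrow> real \<Rightarrow> nat" where
  "delay k y x = nat ((int (phase k y) - int (phase k x)) mod 2 ^ (J + k))"

lemma int_delay: "int (delay k y x) = (int (phase k y) - int (phase k x)) mod 2 ^ (J + k)"
  by (simp add: delay_def)

text \<open>Phases of a lower level are residues of those of a higher one. This lets events
  belonging to different levels be compared at the finer of the two.\<close>

lemma delay_mod:
  assumes "x \<in> I01" "y \<in> I01"
  shows "delay (k + l) y x mod 2 ^ (J + k) = delay k y x"
proof -
  let ?M = "2 ^ (J + k) :: int"
  have p: "int (phase k z) = int (phase (k + l) z) mod ?M" if "z \<in> I01" for z
    using phase_mod[OF that, of k l] by (metis of_nat_mod of_nat_numeral of_nat_power)
  have dvd: "?M dvd 2 ^ (J + (k + l))" by (simp add: le_imp_power_dvd)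
  have "int (delay (k + l) y x mod 2 ^ (J + k)) = int (delay (k + l) y x) mod ?M"
    by (simp add: zmod_int)
  also have "\<dots> = (int (phase (k + l) y) - int (phase (k + l) x)) mod ?M"
    unfolding int_delay by (rule mod_mod_cancel[OF dvd])
  also have "\<dots> = int (delay k y x)"
    unfolding int_delay p[OF assms(1)] p[OF assms(2)] by (simp add: mod_diff_eq)
  finally show ?thesis by (simp only: of_nat_eq_iff)
qed

text \<open>Advancing by the delay equalises the phases, and equal phases mean a common cell of
  length \<open>1 / 2 ^ (J + k)\<close>.\<close>

lemma delay_hit:
  assumes x: "x \<in> I01" "x \<notin> dyadics" and y: "y \<in> I01"
  shows "\<bar>(tower ^^ delay k y x) x - y\<bar> < 1 / 2 ^ (J + k)"
proof (rule cell_eq_imp_close[OF _ y])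
  note t = tower_funpow[OF x, of "delay k y x" k]
  show "(tower ^^ delay k y x) x \<in> I01" using t by blast
  have "int (phase k ((tower ^^ delay k y x) x)) = (int (phase k x) + int (delay k y x)) mod 2 ^ (J + k)"
    using t by (simp add: zmod_int)
  also have "\<dots> = int (phase k y) mod 2 ^ (J + k)"
    unfolding int_delay by (simp add: mod_add_right_eq)
  also have "\<dots> = int (phase k y)"
    using phase_less[OF y, of k] by (intro mod_pos_pos_trivial) (auto simp flip: of_nat_less_iff)
  finally have "phase k ((tower ^^ delay k y x) x) = phase k y" by simp
  then show "cell (J + k) ((tower ^^ delay k y x) x) = cell (J + k) y"
    using phase_eq_iff t y by blast
qed

lemma mu_delay:
  assumes y: "y \<in> I01" and W: "W \<subseteq> {..<2 ^ (J + k)}"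
  shows "mu {x \<in> I01. delay k y x \<in> W} = real (card W) / 2 ^ (J + k)"
    and "{x \<in> I01. delay k y x \<in> W} \<in> sets Leb01"
proof -
  let ?M = "2 ^ (J + k) :: int"
  \<comment> \<open>Subtraction from a fixed phase is an involution of the residues, so counts of
    delays are counts of phases.\<close>
  define g where "g n = nat ((int (phase k y) - int n) mod ?M)" for n
  have gi: "int (g n) = (int (phase k y) - int n) mod ?M" for n by (simp add: g_def)
  have gg: "g (g n) = n" if "n < 2 ^ (J + k)" for n
  proof -
    have "int (g (g n)) = (int (phase k y) - (int (phase k y) - int n)) mod ?M"
      unfolding gi by (rule mod_diff_right_eq)
    also have "\<dots> = int n" using that by (simp flip: of_nat_less_iff)
    finally show ?thesis by simp
  qed
  have gl: "g n < 2 ^ (J + k)" for n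
  proof -
    have "int (g n) < int (2 ^ (J + k))" unfolding gi by simp
    then show ?thesis by (simp only: of_nat_less_iff)
  qed
  have dg: "delay k y x = g (phase k x)" for x by (simp add: delay_def g_def)
  have eq: "{x \<in> I01. delay k y x \<in> W} = {x \<in> I01. phase k x \<in> g ` W}"
    using gg phase_less W by (force simp: dg image_iff)
  have "inj_on g W" by (rule inj_onI) (metis W gg lessThan_iff subsetD)
  then have "card (g ` W) = card W" by (rule card_image)
  moreover have "g ` W \<subseteq> {..<2 ^ (J + k)}" using gl by auto
  ultimately show "mu {x \<in> I01. delay k y x \<in> W} = real (card W) / 2 ^ (J + k)"
    unfolding eq using mu_phase by simp
  show "{x \<in> I01. delay k y x \<in> W} \<in> sets Leb01" unfolding eq by (rule phase_set_sets)
qed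

end

section \<open>Towers hit the shrinking targets\<close>

context dyadic_tower
begin

lemma tower_hits:
  fixes eps :: "nat \<Rightarrow> real"
  assumes dec: "\<forall>n\<ge>1. eps (Suc n) \<le> eps n" and pos: "\<forall>n\<ge>1. eps n > 0"
    and div: "\<not> summable (\<lambda>n. eps (Suc n))" and y: "y \<in> I01"
  shows "emeasure Leb01 (\<Union>n\<in>{N..}. (tower ^^ n) -` cball01 y (eps n) \<inter> I01) = 1"
proof -
  have mono: "eps n \<le> eps m" if "1 \<le> m" "m \<le> n" for m n
    using that(2,1) by (induction n rule: dec_induct) (use dec in \<open>auto intro: order_trans\<close>)
  \<comment> \<open>The first condition fits the block of times up to \<open>2 ^ Suc j\<close> into
    one period \<open>2 ^ (J + k)\<close>; the second makes a cell no longer than the radius, for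
    all times of the block.\<close>
  define good where "good j k \<longleftrightarrow> j + 1 \<le> J + k \<and> 1 / 2 ^ (J + k) \<le> eps (2 ^ Suc j)" for j k
  \<comment> \<open>Minimality makes the events as large as possible, which their divergence depends
    on.\<close>
  define K where "K j = (LEAST k. good j k)" for j
  have ex: "\<exists>k. good j k" for j
  proof -
    have "eps (2 ^ Suc j) > 0" using pos by simp
    then obtain l where l: "(1 / 2) ^ l < eps (2 ^ Suc j)" using real_arch_pow_inv[of _ "1 / 2"] by auto
    have "(1 / 2 :: real) ^ (J + (j + 1 + l)) \<le> (1 / 2) ^ l" by (rule power_decreasing) auto
    then have "good j (j + 1 + l)" unfolding good_def using l by (simp add: power_divide)
    then show ?thesis by blast
  qed
  have K: "good j (K j)" for j unfolding K_def using ex by (rule LeastI_ex)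
  have Kmono: "K i \<le> K j" if "i \<le> j" for i j
  proof -
    have "(2::nat) ^ Suc i \<le> 2 ^ Suc j" using that by (intro power_increasing) auto
    then have "eps (2 ^ Suc j) \<le> eps (2 ^ Suc i)" by (intro mono) auto
    then have "good i (K j)" using K[of j] that unfolding good_def by auto
    then show ?thesis unfolding K_def[of i] by (rule Least_le)
  qed
  define W where "W j = {2 ^ j..<(2::nat) ^ Suc j}" for j
  have cardW: "card (W j) = 2 ^ j" for j by (simp add: W_def)
  have WM: "W j \<subseteq> {..<2 ^ (J + K j)}" for j
  proof -
    have "(2::nat) ^ Suc j \<le> 2 ^ (J + K j)" using K[of j] by (intro power_increasing) (auto simp: good_def)
    then show ?thesis by (auto simp: W_def)
  qed
  define F where "F j = {x \<in> I01. delay (K j) y x \<in> W j}" for j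
  have Fs: "F j \<in> sets Leb01" and Fm: "mu (F j) = 2 ^ j / 2 ^ (J + K j)" for j
    unfolding F_def using mu_delay[OF y WM] by (simp_all add: cardW)
  have corr: "mu (F i \<inter> F j) \<le> mu (F i) * mu (F j)" if ij: "i < j" for i j
  proof -
    \<comment> \<open>Both delays are read off from the finer one, so the intersection is a count of
      residues in a window.\<close>
    let ?V = "{n \<in> W j. n mod 2 ^ (J + K i) \<in> W i}"
    have iK: "i < J + K i" using K[of i] by (simp add: good_def)
    have "delay (K j) y x mod 2 ^ (J + K i) = delay (K i) y x" if "x \<in> I01" for x
      using delay_mod[OF that y, of "K i" "K j - K i"] Kmono[of i j] ij by simp
    then have eq: "F i \<inter> F j = {x \<in> I01. delay (K j) y x \<in> ?V}" by (auto simp: F_def)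
    have "?V \<subseteq> {..<2 ^ (J + K j)}" using WM by blast
    from mu_delay(1)[OF y this] have m: "mu (F i \<inter> F j) = card ?V / 2 ^ (J + K j)" unfolding eq .
    have "card ?V * 2 ^ (J + K i) \<le> 2 ^ i * (2 ^ j :: nat)"
      using card_dyadic_window[OF ij iK] by (simp only: W_def)
    then have "real (card ?V * 2 ^ (J + K i)) \<le> real (2 ^ i * 2 ^ j)" by (rule of_nat_mono)
    then have "card ?V \<le> 2 ^ i * 2 ^ j / (2::real) ^ (J + K i)" by (simp add: field_simps)
    then have "card ?V / 2 ^ (J + K j) \<le> 2 ^ i * 2 ^ j / (2::real) ^ (J + K i) / 2 ^ (J + K j)"
      by (intro divide_right_mono) auto
    then show ?thesis unfolding m Fm by simp
  qed
  have ndiv: "\<not> summable (\<lambda>j. mu (F j))"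
  proof
    assume s: "summable (\<lambda>j. mu (F j))"
    then have "(\<lambda>j. mu (F j)) \<longlonglongrightarrow> 0" by (rule summable_LIMSEQ_zero)
    then have "\<forall>\<^sub>F j in sequentially. mu (F j) < 1 / 2" by (intro order_tendstoD) auto
    then obtain m where m: "\<And>j. j \<ge> m \<Longrightarrow> mu (F j) < 1 / 2" by (auto simp: eventually_sequentially)
    \<comment> \<open>Nothing is assumed about \<open>eps 0\<close>; this value makes
      \<open>f\<close> positive and decreasing from 0 on, as condensation requires.\<close>
    define f where "f n = (if n = 0 then eps 1 else eps n)" for n
    have fpos: "f n > 0" for n using pos by (simp add: f_def)
    have le: "2 ^ Suc j * f (2 ^ Suc j) \<le> 4 * mu (F j)" if j: "j \<ge> max m J" for j
    proof -
      \<comment> \<open>Equality would mean that the block fills half of the period, giving measure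
        1/2. With \<open>j \<ge> J\<close> the strict inequality also makes \<open>K j\<close>
        positive; its predecessor still satisfies the first condition of \<open>good\<close>, so it
        fails on the radius.\<close>
      have "j + 1 < J + K j"
      proof (rule ccontr)
        assume "\<not> ?thesis"
        then have "J + K j = Suc j" using K[of j] by (simp add: good_def)
        then have "mu (F j) = 1 / 2" unfolding Fm by simp
        then show False using m[of j] j by simp
      qed
      moreover from this obtain k where k: "K j = Suc k" using j by (cases "K j") auto
      ultimately have "j + 1 \<le> J + k" by simp
      moreover have "\<not> good j k" using not_less_Least[of k "good j"] k by (simp add: K_def)
      ultimately have e: "eps (2 ^ Suc j) < 1 / 2 ^ (J + k)" by (simp add: good_def)
      have "2 ^ Suc j * f (2 ^ Suc j) \<le> 2 ^ Suc j * (1 / 2 ^ (J + k))"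
        using e by (intro mult_left_mono) (auto simp: f_def)
      \<comment> \<open>One factor 2 comes from \<open>Suc j\<close> against \<open>j\<close>, the
        other from \<open>k\<close> against \<open>K j = Suc k\<close>.\<close>
      also have "\<dots> = 4 * mu (F j)" unfolding Fm k by (simp add: field_simps)
      finally show ?thesis .
    qed
    have "summable (\<lambda>j. 2 ^ Suc j * f (2 ^ Suc j))"
    proof (rule summable_comparison_test'[OF summable_mult[OF s, of 4]])
      fix j assume "j \<ge> max m J"
      then show "norm (2 ^ Suc j * f (2 ^ Suc j)) \<le> 4 * mu (F j)"
        using le[of j] fpos[of "2 ^ Suc j"] by (simp add: abs_mult)
    qed
    then have "summable (\<lambda>j. 2 ^ j * f (2 ^ j))" by (subst (asm) summable_Suc_iff)
    then have "summable f"
      using fpos dec by (subst condensation_test) (auto simp: f_def less_imp_le)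
    then have "summable (\<lambda>n. f (Suc n))" by (simp only: summable_Suc_iff)
    then show False using div by (simp add: f_def)
  qed
  have one: "mu (\<Union>j\<in>{N..}. F j) = 1"
  proof (rule Leb.prob_UN_eq_1_of_neg_correlated[OF Fs _ ndiv])
    show "mu (F i \<inter> F j) \<le> mu (F i) * mu (F j)" if "i \<noteq> j" for i j
      using corr[of i j] corr[of j i] that by (cases "i < j") (auto simp: Int_commute mult.commute)
  qed
  have hit: "x \<in> (tower ^^ n) -` cball01 y (eps n) \<inter> I01"
    if x: "x \<in> I01" "x \<notin> dyadics" "x \<in> F j" and n: "n = delay (K j) y x" for x j n
  proof -
    have nW: "1 \<le> n" "n \<le> 2 ^ Suc j" using x(3) one_le_power[of "2::nat" j] unfolding n F_def W_def by auto
    have i: "(tower ^^ n) x \<in> I01" using tower_funpow[OF x(1,2)] by blast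
    have "cdist ((tower ^^ n) x) y \<le> \<bar>(tower ^^ n) x - y\<bar>" using cdist_le[of _ y 0] by simp
    also have "\<dots> \<le> 1 / 2 ^ (J + K j)" unfolding n using delay_hit[OF x(1,2) y] by (rule less_imp_le)
    also have "\<dots> \<le> eps (2 ^ Suc j)" using K[of j] by (simp add: good_def)
    also have "\<dots> \<le> eps n" by (rule mono[OF nW])
    finally show ?thesis using i x(1) by (simp add: cball01_def)
  qed
  let ?H = "\<Union>n\<in>{N..}. (tower ^^ n) -` cball01 y (eps n) \<inter> I01"
  have H: "?H \<in> sets Leb01"
    using MPT_vimage_sets[OF MPT_funpow[OF tower_MPT] cball01_sets] by (intro sets.countable_UN') auto
  have "AE x in Leb01. x \<in> (\<Union>j\<in>{N..}. F j) \<longrightarrow> x \<in> ?H"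
    using AE_not_dyadic AE_space
  proof eventually_elim
    case (elim x)
    show ?case
    proof
      assume "x \<in> (\<Union>j\<in>{N..}. F j)"
      then obtain j where j: "N \<le> j" "x \<in> F j" by auto
      have "2 ^ j \<le> delay (K j) y x" using j(2) by (simp add: F_def W_def)
      \<comment> \<open>Blocks with \<open>j \<ge> N\<close> contain only times beyond
        \<open>N\<close>, since \<open>j < 2 ^ j\<close>.\<close>
      then have "N \<le> delay (K j) y x" using j(1) less_exp[of j] by linarith
      then show "x \<in> ?H" using hit[OF _ _ j(2) refl] elim by (intro UN_I[of "delay (K j) y x"]) auto
    qed
  qed
  then have "mu (\<Union>j\<in>{N..}. F j) \<le> mu ?H" by (rule Leb.finite_measure_mono_AE[OF _ H])
  then have "mu ?H = 1" using one Leb.prob_le_1[of ?H] by linarith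
  then show ?thesis by (simp add: Leb.emeasure_eq_measure)
qed

end

subsection \<open>Cyclic orders with few bad transitions\<close>

text \<open>Along a trail whose edges run from \<open>g c\<close> to \<open>f c\<close>, every
  arrival at \<open>s\<close> is followed by a departure, except at the two ends of the
  trail.\<close>

lemma successively_colour_count:
  assumes "xs \<noteq> []" "successively (\<lambda>x y. f x = g y) xs"
  shows "length (filter (\<lambda>c. g c = s) xs) + of_bool (f (last xs) = s)
       = length (filter (\<lambda>c. f c = s) xs) + of_bool (g (hd xs) = s)"
  using assms
proof (induction xs rule: list_nonempty_induct)
  case (cons x xs)
  then have "f x = g (hd xs)" "successively (\<lambda>x y. f x = g y) xs"
    by (simp_all add: successively_Cons)
  with cons.IH cons.hyps show ?case by simp
qed simp

text \<open>Failures occur only where two lists are joined or at the very end; charging them to last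
  elements will bound them by the number of trails.\<close>

lemma concat_transition:
  assumes "\<forall>xs\<in>set xss. xs \<noteq> [] \<and> successively P xs" "i < length (concat xss)"
    "concat xss ! i \<notin> last ` set xss"
  shows "Suc i < length (concat xss) \<and> P (concat xss ! i) (concat xss ! Suc i)"
  using assms
proof (induction xss arbitrary: i)
  case (Cons xs xss)
  show ?case
  proof (cases "i < length xs")
    case True
    then have "xs ! i \<noteq> last xs" using Cons.prems(3) by (simp add: nth_append)
    then have i: "Suc i < length xs" using True by (metis Suc_lessI diff_Suc_1 last_conv_nth list.size(3) not_less_zero)
    then have "P (xs ! i) (xs ! Suc i)" using Cons.prems(1) by (simp add: successively_conv_nth)
    then show ?thesis using i by (simp add: nth_append)
  next
    case False
    with Cons.prems have "Suc (i - length xs) < length (concat xss)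
        \<and> P (concat xss ! (i - length xs)) (concat xss ! Suc (i - length xs))"
      by (intro Cons.IH) (auto simp: nth_append)
    then show ?thesis using False by (auto simp: nth_append Suc_diff_le)
  qed
qed simp

text \<open>View a cell \<open>c\<close> as an edge from \<open>g c\<close> to \<open>f c\<close>. In a decomposition of all edges into
  as few trails as possible, no trail ends where a different one starts, so the number of trails
  starting at \<open>s\<close> is at most one unless the in- and out-degrees at \<open>s\<close> differ.\<close>

lemma cyclic_order_few_bad_transitions:
  fixes f g :: "'a \<Rightarrow> 'c"
  assumes C: "finite C" and S: "finite S" "g ` C \<subseteq> S"
  shows "\<exists>xs. distinct xs \<and> set xs = C \<and>
    card {i. i < length xs \<and> f (xs ! i) \<noteq> g (xs ! ((i + 1) mod length xs))}
      \<le> card S + (\<Sum>s\<in>S. card {c \<in> C. g c = s} - card {c \<in> C. f c = s})"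
proof -
  let ?ok = "\<lambda>x y. f x = g y"
  define dec where "dec P \<longleftrightarrow> finite P \<and> (\<forall>xs\<in>P. xs \<noteq> [] \<and> distinct xs \<and> successively ?ok xs) \<and>
    (\<forall>xs\<in>P. \<forall>ys\<in>P. xs \<noteq> ys \<longrightarrow> set xs \<inter> set ys = {}) \<and> \<Union> (set ` P) = C" for P
  \<comment> \<open>Single edges form a decomposition, so one with the fewest trails exists.\<close>
  have "dec ((\<lambda>c. [c]) ` C)" using C by (auto simp: dec_def)
  then obtain P where P: "dec P" and min: "\<And>Q. dec Q \<Longrightarrow> card P \<le> card Q"
    using ex_has_least_nat[of dec _ card] by blast
  have fin: "finite P" and PC: "\<Union> (set ` P) = C"
    and Pd: "\<And>xs ys. xs \<in> P \<Longrightarrow> ys \<in> P \<Longrightarrow> xs \<noteq> ys \<Longrightarrow> set xs \<inter> set ys = {}"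
    and Pt: "\<And>xs. xs \<in> P \<Longrightarrow> xs \<noteq> [] \<and> distinct xs \<and> successively ?ok xs"
    using P by (auto simp: dec_def)
  \<comment> \<open>Otherwise the two trails could be concatenated, contradicting
    minimality.\<close>
  have sep: "f (last xs) \<noteq> g (hd ys)" if xy: "xs \<in> P" "ys \<in> P" "xs \<noteq> ys" for xs ys
  proof
    assume e: "f (last xs) = g (hd ys)"
    let ?R = "P - {xs, ys}"
    let ?Q = "insert (xs @ ys) ?R"
    have R: "set zs \<inter> set (xs @ ys) = {}" if "zs \<in> ?R" for zs
      using Pd[of zs xs] Pd[of zs ys] that xy by auto
    have "dec ?Q" unfolding dec_def
    proof (intro conjI ballI impI)
      show "finite ?Q" using fin by simp
      show "\<Union> (set ` ?Q) = C" unfolding PC[symmetric] using xy by auto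
      fix zs assume zs: "zs \<in> ?Q"
      show "zs \<noteq> []" "distinct zs" "successively ?ok zs"
        using zs Pt[of zs] Pt[OF xy(1)] Pt[OF xy(2)] Pd[OF xy] e
        by (auto simp: successively_append_iff)
      fix ws assume ws: "ws \<in> ?Q" "zs \<noteq> ws"
      consider "zs = xs @ ys" "ws \<in> ?R" | "ws = xs @ ys" "zs \<in> ?R" | "zs \<in> ?R" "ws \<in> ?R"
        using zs ws by blast
      then show "set zs \<inter> set ws = {}"
      proof cases
        case 1 then show ?thesis using R[of ws] by (simp only: Int_commute)
      next
        case 2 then show ?thesis using R[of zs] by simp
      next
        case 3 then show ?thesis using Pd ws(2) by blast
      qed
    qed
    then have "card P \<le> card ?Q" by (rule min)
    also have "\<dots> \<le> Suc (card ?R)" by (rule card_insert_le_m1) auto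
    also have "card ?R = card P - 2" using xy fin by (simp add: card_Diff_subset)
    finally show False using card_mono[of P "{xs, ys}"] xy fin by simp
  qed
  define st where "st s = {xs \<in> P. g (hd xs) = s}" for s
  define en where "en s = {xs \<in> P. f (last xs) = s}" for s
  have cnt: "card {c \<in> C. h c = s} = (\<Sum>xs\<in>P. length (filter (\<lambda>c. h c = s) xs))" for h :: "'a \<Rightarrow> 'c" and s
  proof -
    have "{c \<in> C. h c = s} = (\<Union>xs\<in>P. {c \<in> set xs. h c = s})" using PC by auto
    also have "card \<dots> = (\<Sum>xs\<in>P. card {c \<in> set xs. h c = s})"
      using fin Pd by (intro card_UN_disjoint) auto
    also have "\<dots> = (\<Sum>xs\<in>P. length (filter (\<lambda>c. h c = s) xs))"
    proof (rule sum.cong[OF refl])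
      fix xs assume "xs \<in> P"
      then have "distinct (filter (\<lambda>c. h c = s) xs)" using Pt by simp
      then show "card {c \<in> set xs. h c = s} = length (filter (\<lambda>c. h c = s) xs)"
        using distinct_card by fastforce
    qed
    finally show ?thesis .
  qed
  have bal: "card {c \<in> C. g c = s} + card (en s) = card {c \<in> C. f c = s} + card (st s)" for s
  proof -
    have e: "card (en s) = (\<Sum>xs\<in>P. of_bool (f (last xs) = s))" "card (st s) = (\<Sum>xs\<in>P. of_bool (g (hd xs) = s))"
      using fin by (simp_all add: en_def st_def of_bool_def sum.If_cases Int_def conj_commute)
    show ?thesis unfolding e cnt sum.distrib[symmetric]
    proof (rule sum.cong[OF refl])
      fix xs assume "xs \<in> P"
      then show "length (filter (\<lambda>c. g c = s) xs) + of_bool (f (last xs) = s)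
          = length (filter (\<lambda>c. f c = s) xs) + of_bool (g (hd xs) = s)"
        using Pt by (intro successively_colour_count) auto
    qed
  qed
  \<comment> \<open>If no trail ends at \<open>s\<close>, the balance shows that the starts are the
    excess of out-degree over in-degree. If some trail ends at \<open>s\<close>, by
    \<open>sep\<close> no other one can start there. Truncated subtraction is intended.\<close>
  have le: "card (st s) \<le> 1 + (card {c \<in> C. g c = s} - card {c \<in> C. f c = s})" for s
  proof (cases "en s = {}")
    case True
    then show ?thesis using bal[of s] by simp
  next
    case False
    then obtain xs where xs: "xs \<in> P" "f (last xs) = s" by (auto simp: en_def)
    have "st s \<subseteq> {xs}"
    proof
      fix ys assume "ys \<in> st s"
      then have "ys \<in> P" "f (last xs) = g (hd ys)" using xs(2) by (auto simp: st_def)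
      then show "ys \<in> {xs}" using sep[OF xs(1)] by blast
    qed
    then have "card (st s) \<le> 1" using card_mono[of "{xs}" "st s"] by simp
    then show ?thesis by simp
  qed
  have "P = (\<Union>s\<in>S. st s)"
  proof
    show "P \<subseteq> (\<Union>s\<in>S. st s)"
    proof
      fix xs assume xs: "xs \<in> P"
      then have "hd xs \<in> C" using Pt[OF xs] PC by (metis UN_I hd_in_set)
      then show "xs \<in> (\<Union>s\<in>S. st s)" using S xs by (auto simp: st_def)
    qed
  qed (auto simp: st_def)
  then have "card P \<le> (\<Sum>s\<in>S. card (st s))" using card_UN_le[OF S(1), of st] by simp
  also have "\<dots> \<le> (\<Sum>s\<in>S. 1 + (card {c \<in> C. g c = s} - card {c \<in> C. f c = s}))"
    by (intro sum_mono le)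
  also have "\<dots> = card S + (\<Sum>s\<in>S. card {c \<in> C. g c = s} - card {c \<in> C. f c = s})"
    by (simp only: sum.distrib) simp
  finally have cP: "card P \<le> card S + (\<Sum>s\<in>S. card {c \<in> C. g c = s} - card {c \<in> C. f c = s})" .
  obtain xss where xss: "set xss = P" "distinct xss" using finite_distinct_list[OF fin] by blast
  let ?L = "concat xss"
  have dL: "distinct ?L"
    using xss Pt Pd by (auto simp: distinct_concat_iff distinct_removeAll)
  have sL: "set ?L = C" using PC xss by simp
  let ?B = "{i. i < length ?L \<and> f (?L ! i) \<noteq> g (?L ! ((i + 1) mod length ?L))}"
  have "(!) ?L ` ?B \<subseteq> last ` P"
  proof
    fix c assume "c \<in> (!) ?L ` ?B"
    then obtain i where i: "c = ?L ! i" "i < length ?L" "f (?L ! i) \<noteq> g (?L ! ((i + 1) mod length ?L))" by blast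
    show "c \<in> last ` P"
    proof (rule ccontr)
      assume "c \<notin> last ` P"
      then have "Suc i < length ?L \<and> f (?L ! i) = g (?L ! Suc i)"
        using concat_transition[of xss ?ok i] i xss Pt by blast
      then show False using i(3) by simp
    qed
  qed
  moreover have "inj_on ((!) ?L) ?B" using dL by (auto simp: inj_on_def nth_eq_iff_index_eq)
  ultimately have "card ?B \<le> card (last ` P)" using fin by (intro card_inj_on_le) auto
  also have "\<dots> \<le> card P" by (rule card_image_le[OF fin])
  finally have "card ?B \<le> card P" .
  then show ?thesis using dL sL cP by (intro exI[of _ ?L]) linarith
qed

subsection \<open>Density\<close>

text \<open>In the tower with the identity order, \<open>phase 0\<close> is the cell number, so
  equidistribution of phases applies.\<close>

lemma mu_cells:
  assumes "C \<subseteq> {..<2 ^ J}" shows "mu (cells J C) = real (card C) / 2 ^ J"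
proof -
  interpret dyadic_tower J id id by unfold_locales auto
  have "cells J C = {x \<in> I01. phase 0 x \<in> C}" by (simp add: cells_def phase_def)
  then show ?thesis using mu_phase[of C 0] assms by simp
qed

lemma membership_pattern_sets:
  assumes "finite \<A>" "\<And>A. A \<in> \<A> \<Longrightarrow> h A \<in> sets Leb01"
  shows "{x \<in> I01. {A \<in> \<A>. x \<in> h A} = s} \<in> sets Leb01"
proof (cases "s \<subseteq> \<A>")
  case True
  have "{x \<in> space Leb01. \<forall>A\<in>\<A>. x \<in> h A \<longleftrightarrow> A \<in> s} \<in> sets Leb01"
  proof (rule sets.sets_Collect_finite_All[OF _ assms(1)])
    fix A assume "A \<in> \<A>"
    then have "h A \<in> sets Leb01" by (rule assms(2))
    then have "I01 \<inter> h A \<in> sets Leb01" "I01 - h A \<in> sets Leb01" by auto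
    moreover have "{x \<in> space Leb01. x \<in> h A \<longleftrightarrow> A \<in> s} = (if A \<in> s then I01 \<inter> h A else I01 - h A)" by auto
    ultimately show "{x \<in> space Leb01. x \<in> h A \<longleftrightarrow> A \<in> s} \<in> sets Leb01" by simp
  qed
  moreover have "{x \<in> I01. {A \<in> \<A>. x \<in> h A} = s} = {x \<in> space Leb01. \<forall>A\<in>\<A>. x \<in> h A \<longleftrightarrow> A \<in> s}"
    using True by auto
  ultimately show ?thesis by simp
next
  case False
  then have "{x \<in> I01. {A \<in> \<A>. x \<in> h A} = s} = {}" by auto
  then show ?thesis by (simp only: sets.empty_sets)
qed

lemma colour_sets:
  fixes F :: "real \<Rightarrow> 'c"
  assumes fin: "finite (F ` I01)" and meas: "\<And>s. {x \<in> I01. F x = s} \<in> sets Leb01"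
  shows "{x \<in> I01. F x \<noteq> f (cell J x)} \<in> sets Leb01"
proof -
  have "{x \<in> I01. F x \<noteq> f (cell J x)} = (\<Union>s\<in>F ` I01. {x \<in> I01. F x = s} - cells J {c. f c = s})"
    by (auto simp: cells_def)
  also have "\<dots> \<in> sets Leb01" by (rule sets.finite_UN[OF fin sets.Diff[OF meas cells_sets]])
  finally show ?thesis .
qed

lemma colour_class_diff_le:
  fixes F :: "real \<Rightarrow> 'c"
  assumes fin: "finite (F ` I01)" and meas: "\<And>s. {x \<in> I01. F x = s} \<in> sets Leb01"
  shows "\<bar>mu {x \<in> I01. F x = s} - mu (cells J {c \<in> {..<2 ^ J}. f c = s})\<bar> \<le> mu {x \<in> I01. F x \<noteq> f (cell J x)}"
proof -
  let ?D = "cells J {c \<in> {..<2 ^ J}. f c = s}"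
  have "sym_dist {x \<in> I01. F x = s} ?D \<le> mu {x \<in> I01. F x \<noteq> f (cell J x)}"
    unfolding sym_dist_def
    by (rule Leb.finite_measure_mono[OF _ colour_sets[OF fin meas]]) (auto simp: cells_def dest: cell_less)
  then show ?thesis using mu_diff_le_sym_dist[OF meas cells_sets] by (rule order_trans[rotated])
qed

text \<open>Colour the points \<open>x\<close> of the source by the sets of \<open>\<A>\<close> that contain them, those of the target by
  the images under \<open>T\<close> that contain them, and let a tower respect the colours of most cells.\<close>

lemma tower_approximation:
  assumes T: "T \<in> MPT" and A: "finite \<A>" "\<A> \<subseteq> sets Leb01" and r: "r > 0"
  shows "\<exists>J a b. dyadic_tower J a b \<and> (\<forall>A\<in>\<A>. sym_dist (dyadic_tower.tower J a b ` A) (T ` A) < r)"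
proof -
  define F where "F x = {A \<in> \<A>. x \<in> A}" for x
  define G where "G y = {A \<in> \<A>. y \<in> T ` A}" for y
  define n where "n = card (Pow \<A>)"
  have finP: "finite (Pow \<A>)" using A(1) by simp
  have n: "n \<ge> 1" unfolding n_def using finP by (metis Pow_not_empty One_nat_def Suc_leI card_gt_0_iff)
  \<comment> \<open>Balances the last estimate: the errors of size \<open>e\<close> add up to at
    most \<open>4 * (n * e) = r / 2\<close>, leaving \<open>r / 2\<close> for the term
    \<open>n / 2 ^ J\<close>.\<close>
  define e where "e = r / (8 * n)"
  have e: "e > 0" using r n by (simp add: e_def)
  have FS: "F ` I01 \<subseteq> Pow \<A>" and GS: "G ` I01 \<subseteq> Pow \<A>" by (auto simp: F_def G_def)
  have Ff: "finite (F ` I01)" and Gf: "finite (G ` I01)" using FS GS finP finite_subset by blast+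
  have Fm: "{x \<in> I01. F x = s} \<in> sets Leb01" for s
    unfolding F_def using A by (intro membership_pattern_sets) auto
  have Gm: "{x \<in> I01. G x = s} \<in> sets Leb01" for s
    unfolding G_def using A MPT_image_sets[OF T] by (intro membership_pattern_sets) auto
  have inj: "inj_on T I01" using MPT_bij[OF T] by (simp add: bij_betw_def)
  have GT: "G (T x) = F x" if "x \<in> I01" for x
    unfolding F_def G_def using inj_on_image_mem_iff[OF inj that] A(2) sets_Leb01_subset by blast
  \<comment> \<open>The only place where \<open>T\<close> preserving measure enters the
    combinatorics: source and target classes of a colour have equal measure, so in- and out-degrees
    nearly agree.\<close>
  have FG: "mu {x \<in> I01. G x = s} = mu {x \<in> I01. F x = s}" for s
  proof -
    have "T -` {x \<in> I01. G x = s} \<inter> I01 = {x \<in> I01. F x = s}" using GT MPT_in[OF T] by auto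
    then show ?thesis using MPT_vimage_mu[OF T Gm, of s] by simp
  qed
  obtain J1 where J1: "\<And>J. J \<ge> J1 \<Longrightarrow> \<exists>f. range f \<subseteq> F ` I01 \<and> mu {x \<in> I01. F x \<noteq> f (cell J x)} < e"
    using approximate_colouring[OF Ff Fm e] by blast
  obtain J2 where J2: "\<And>J. J \<ge> J2 \<Longrightarrow> \<exists>g. range g \<subseteq> G ` I01 \<and> mu {x \<in> I01. G x \<noteq> g (cell J x)} < e"
    using approximate_colouring[OF Gf Gm e] by blast
  obtain J3 where J3: "(1 / 2) ^ J3 < r / (2 * n)"
    using real_arch_pow_inv[of "r / (2 * n)" "1 / 2"] r n by auto
  define J where "J = Max {J1, J2, J3}"
  have J: "J1 \<le> J" "J2 \<le> J" "J3 \<le> J" by (auto simp: J_def)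
  have "(1 / 2 :: real) ^ J \<le> (1 / 2) ^ J3" using J(3) by (intro power_decreasing) auto
  with J3 have "(1 / 2 :: real) ^ J < r / (2 * n)" by linarith
  then have nJ: "real n / 2 ^ J < r / 2" using n by (simp add: power_divide field_simps)
  obtain f where f: "mu {x \<in> I01. F x \<noteq> f (cell J x)} < e" using J1[OF J(1)] by blast
  obtain g where g: "range g \<subseteq> G ` I01" "mu {x \<in> I01. G x \<noteq> g (cell J x)} < e" using J2[OF J(2)] by blast
  let ?C = "{..<2 ^ J} :: nat set"
  let ?def = "\<lambda>s. card {c \<in> ?C. g c = s} - card {c \<in> ?C. f c = s}"
  have "g ` ?C \<subseteq> Pow \<A>" using g(1) GS by blast
  from cyclic_order_few_bad_transitions[OF finite_lessThan finP this, of f]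
  obtain xs where xs: "distinct xs" "set xs = ?C" and bad:
    "card {i. i < length xs \<and> f (xs ! i) \<noteq> g (xs ! ((i + 1) mod length xs))} \<le> n + (\<Sum>s\<in>Pow \<A>. ?def s)"
    unfolding n_def by blast
  have len: "length xs = 2 ^ J" using distinct_card[OF xs(1)] xs(2) by simp
  define b where "b = (!) xs"
  define a where "a = inv_into ?C b"
  have bb: "bij_betw b ?C ?C" unfolding b_def by (rule bij_betw_nth) (use xs len in auto)
  interpret dyadic_tower J a b
  proof
    fix i :: nat assume i: "i < 2 ^ J"
    have bi: "bij_betw a ?C ?C" unfolding a_def by (rule bij_betw_inv_into[OF bb])
    show "a i < 2 ^ J" "b i < 2 ^ J" using i bij_betwE[OF bb] bij_betwE[OF bi] by auto
    show "b (a i) = i" using i bb unfolding a_def by (intro bij_betw_inv_into_right) auto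
    show "a (b i) = i" using i bb unfolding a_def by (intro bij_betw_inv_into_left) auto
  qed
  define R where "R = {i. i < 2 ^ J \<and> f (b i) \<noteq> g (b ((i + 1) mod 2 ^ J))}"
  have cR: "card R \<le> n + (\<Sum>s\<in>Pow \<A>. ?def s)" using bad unfolding R_def b_def len .
  \<comment> \<open>Both classes of colour \<open>s\<close> have the same measure, and each
    colouring by cells misses it by less than \<open>e\<close>.\<close>
  have defect: "real (?def s) / 2 ^ J \<le> 2 * e" for s
  proof -
    have cf: "card {c \<in> ?C. h c = s} / 2 ^ J = mu (cells J {c \<in> ?C. h c = s})" for h :: "nat \<Rightarrow> real set set"
      by (rule mu_cells[symmetric]) auto
    have "real (?def s) \<le> \<bar>real (card {c \<in> ?C. g c = s}) - real (card {c \<in> ?C. f c = s})\<bar>" by simp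
    then have "real (?def s) / 2 ^ J
        \<le> \<bar>real (card {c \<in> ?C. g c = s}) - real (card {c \<in> ?C. f c = s})\<bar> / 2 ^ J"
      by (rule divide_right_mono) simp
    also have "\<dots> = \<bar>mu (cells J {c \<in> ?C. g c = s}) - mu (cells J {c \<in> ?C. f c = s})\<bar>"
      unfolding cf[symmetric] by (simp add: diff_divide_distrib[symmetric] abs_divide)
    also have "\<dots> \<le> 2 * e"
      using colour_class_diff_le[OF Ff Fm, of s J f] colour_class_diff_le[OF Gf Gm, of s J g] f g(2) FG[of s]
      by linarith
    finally show ?thesis .
  qed
  have muR: "mu {x \<in> I01. phase 0 x \<in> R} \<le> real n / 2 ^ J + n * (2 * e)"
  proof -
    have "mu {x \<in> I01. phase 0 x \<in> R} = real (card R) / 2 ^ J"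
      using mu_phase[of R 0] by (auto simp: R_def)
    also have "\<dots> \<le> real (n + (\<Sum>s\<in>Pow \<A>. ?def s)) / 2 ^ J"
      using cR by (intro divide_right_mono of_nat_mono) auto
    also have "\<dots> = real n / 2 ^ J + (\<Sum>s\<in>Pow \<A>. real (?def s) / 2 ^ J)"
      by (simp only: of_nat_add of_nat_sum add_divide_distrib sum_divide_distrib)
    also have "(\<Sum>s\<in>Pow \<A>. real (?def s) / 2 ^ J) \<le> (\<Sum>s\<in>Pow \<A>. 2 * e)"
      by (intro sum_mono defect)
    finally show ?thesis by (simp add: n_def)
  qed
  \<comment> \<open>Three ways to fail: \<open>x\<close> has not the source colour of its cell, the
    transition is bad, or \<open>tower x\<close> has not the target colour of its cell.\<close>
  let ?E1 = "{x \<in> I01. F x \<noteq> f (cell J x)}"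
  let ?E2 = "{x \<in> I01. phase 0 x \<in> R}"
  let ?E3 = "tower -` {y \<in> I01. G y \<noteq> g (cell J y)} \<inter> I01"
  have E: "?E1 \<in> sets Leb01" "?E2 \<in> sets Leb01" "?E3 \<in> sets Leb01"
    using colour_sets[OF Ff Fm] phase_set_sets MPT_vimage_sets[OF tower_MPT colour_sets[OF Gf Gm]] by auto
  have close: "G (tower x) = F x"
    if x: "x \<in> I01" "x \<notin> dyadics" and no: "x \<notin> ?E1 \<union> ?E2 \<union> ?E3" for x
  proof -
    let ?i = "a (cell J x)"
    have i: "?i < 2 ^ J" by (intro a_less cell_less x)
    have "?i \<notin> R" using no x by (simp add: phase_def)
    then have "f (b ?i) = g (b ((?i + 1) mod 2 ^ J))" using i by (simp add: R_def)
    then have "f (cell J x) = g (cell J (tower x))"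
      using b_a[OF cell_less[OF x(1)]] tower_nondyadic(2)[OF x] by simp
    moreover have "F x = f (cell J x)" using no x by blast
    moreover have "G (tower x) = g (cell J (tower x))" using no x tower_nondyadic(1)[OF x] by blast
    ultimately show ?thesis by simp
  qed
  have "sym_dist (tower ` A) (T ` A) < r" if AA: "A \<in> \<A>" for A
  proof -
    have As: "A \<in> sets Leb01" using AA A(2) by blast
    have s: "sym_diff (tower ` A) (T ` A) \<in> sets Leb01"
      using MPT_image_sets[OF T As] MPT_image_sets[OF tower_MPT As] by auto
    \<comment> \<open>Pulled back by \<open>tower\<close>, membership becomes a condition on
      \<open>x\<close>, where the colours of \<open>x\<close> and \<open>tower x\<close> can be
      compared.\<close>
    have "sym_dist (tower ` A) (T ` A) = mu (tower -` sym_diff (tower ` A) (T ` A) \<inter> I01)"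
      unfolding sym_dist_def by (rule MPT_vimage_mu[OF tower_MPT s, symmetric])
    also have "\<dots> \<le> mu (?E1 \<union> ?E2 \<union> ?E3)"
    proof (rule Leb.finite_measure_mono_AE)
      show "AE x in Leb01. x \<in> tower -` sym_diff (tower ` A) (T ` A) \<inter> I01 \<longrightarrow> x \<in> ?E1 \<union> ?E2 \<union> ?E3"
        using AE_not_dyadic
      proof eventually_elim
        case (elim x)
        show ?case
        proof (intro impI, rule ccontr)
          assume x: "x \<in> tower -` sym_diff (tower ` A) (T ` A) \<inter> I01" and "x \<notin> ?E1 \<union> ?E2 \<union> ?E3"
          then have "G (tower x) = F x" using close elim by blast
          then have "tower x \<in> T ` A \<longleftrightarrow> x \<in> A" using AA by (auto simp: F_def G_def)
          moreover have "tower x \<in> tower ` A \<longleftrightarrow> x \<in> A"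
            using inj_on_image_mem_iff[OF tower_inj _ sets_Leb01_subset[OF As]] x by blast
          ultimately show False using x by blast
        qed
      qed
    qed (use E in auto)
    also have "\<dots> \<le> mu ?E1 + mu ?E2 + mu ?E3"
      using measure_Un_le[of "?E1 \<union> ?E2" Leb01 ?E3] measure_Un_le[of ?E1 Leb01 ?E2] E by auto
    also have "mu ?E3 < e"
      using MPT_vimage_mu[OF tower_MPT colour_sets[OF Gf Gm]] g(2) by simp
    also have "mu ?E1 + mu ?E2 + e \<le> e + (real n / 2 ^ J + n * (2 * e)) + e"
      using f muR by (intro add_mono) auto
    also have "\<dots> \<le> real n / 2 ^ J + 4 * (n * e)"
    proof -
      have "1 * e \<le> n * e" using n e by (intro mult_right_mono) auto
      then show ?thesis by (simp add: mult.commute)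
    qed
    also have "4 * (n * e) = r / 2" using n by (simp add: e_def)
    also have "real n / 2 ^ J + r / 2 < r"
      using add_strict_right_mono[OF nJ, of "r / 2"] by simp
    finally show ?thesis by simp
  qed
  then have "dyadic_tower J a b \<and> (\<forall>A\<in>\<A>. sym_dist (dyadic_tower.tower J a b ` A) (T ` A) < r)"
    using dyadic_tower_axioms by blast
  then show ?thesis by blast
qed

lemma tower_in_shrinking_target_set:
  assumes "dyadic_tower J a b"
    and eps: "\<forall>n\<ge>1. eps (Suc n) \<le> eps n" "\<forall>n\<ge>1. eps n > 0" "\<not> summable (\<lambda>n. eps (Suc n))"
  shows "dyadic_tower.tower J a b \<in> shrinking_target_set eps"
proof -
  interpret dyadic_tower J a b by (rule assms(1))
  have "AE y in Leb01. \<forall>N\<ge>1. emeasure Leb01 (\<Union>n\<in>{N..}. (tower ^^ n) -` cball01 y (eps n) \<inter> I01) = 1"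
    by (rule AE_I2) (use tower_hits[OF eps] in simp)
  then show ?thesis using tower_MPT tower_ergodic unfolding shrinking_target_set_def by blast
qed

theorem mainTheorem2:
  fixes eps :: "nat \<Rightarrow> real"
  assumes "\<forall>n\<ge>1. eps (Suc n) \<le> eps n"
    and "\<forall>n\<ge>1. eps n > 0"
    and "\<not> summable (\<lambda>n. eps (Suc n))"
  shows "gdelta_in weak_top (shrinking_target_set eps) \<and>
         dense_in_top weak_top (shrinking_target_set eps)"
proof
  let ?R = "shrinking_target_set eps"
  have "?R = {T \<in> MPT. ergodic T} \<inter>
      {T \<in> MPT. AE y in Leb01. \<forall>N\<ge>1. emeasure Leb01 (\<Union>n\<in>{N..}. hits eps T n y) = 1}"
    by (auto simp: shrinking_target_set_def hits_def)
  then show "gdelta_in weak_top ?R" using gdelta_in_Int[OF gdelta_ergodic gdelta_hits] by simp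
  show "dense_in_top weak_top ?R" unfolding dense_in_top_def topspace_weak_top
  proof
    show "?R \<subseteq> MPT" by (auto simp: shrinking_target_set_def)
    show "weak_top closure_of ?R = MPT"
    proof (intro equalityI subsetI)
      show "T \<in> MPT" if "T \<in> weak_top closure_of ?R" for T
        using that closure_of_subset_topspace[of weak_top ?R] by auto
      fix T assume T: "T \<in> MPT"
      have "\<exists>S. S \<in> ?R \<and> S \<in> U" if U: "T \<in> U" "openin weak_top U" for U
      proof -
        obtain \<A> r where A: "finite \<A>" "\<A> \<subseteq> sets Leb01" "r > 0"
          and sub: "\<And>S. S \<in> MPT \<Longrightarrow> \<forall>A\<in>\<A>. sym_dist (S ` A) (T ` A) < r \<Longrightarrow> S \<in> U"
          using openin_weak_top_basic_nhd[OF U(2,1)] by blast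
        obtain J a b where tw: "dyadic_tower J a b"
          and close: "\<forall>A\<in>\<A>. sym_dist (dyadic_tower.tower J a b ` A) (T ` A) < r"
          using tower_approximation[OF T A] by blast
        have "dyadic_tower.tower J a b \<in> ?R"
          by (rule tower_in_shrinking_target_set[OF tw assms])
        moreover from this have "dyadic_tower.tower J a b \<in> U"
          using close by (intro sub) (simp_all add: shrinking_target_set_def)
        ultimately show ?thesis by blast
      qed
      then show "T \<in> weak_top closure_of ?R" using T by (auto simp: in_closure_of)
    qed
  qed
qed

end
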